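(* Let $N\in\mathbb N$ and let $f_N=f_N(t,x,c)$ be the $N$th Galerkin approximation (in the Hermite basis in $c$) of the solution of the Fokker–Planck equation, as described in the context. If the $N$th Fokker–Planck polynomial $P(\tau,\xi)$ is strongly stable, then for all $t\ge0$ we have the estimate $$\|f_N(t,x,c)\|_{L^\infty(\mathbb R^n_x)L^2_w(\mathbb R^n_c)}\le C(1+t)^{-n/2}+C_Ne^{-\epsilon(N)t},$$ with $w=\exp(-|c|^2/2)$ and $\epsilon(N)>0$. Here the constant $C$ is independent of $N$.
   Context: The Fokker–Planck equation for $f=f(t,x,c)$, $t>0$, $x,c\in\mathbb R^n$, $n\in\{1,2,3\}$, is $\big(\partial_t+\sum_{k=1}^nc_k\partial_{x_k}\big)f=\sum_{k=1}^n\partial_{c_k}(c_k+\partial_{c_k})f$. Let $\psi^\alpha(c)=(2\pi)^{-n/2}(-\partial_c)^\alpha\exp(-|c|^2/2)$. Writing $f=\sum_\alpha\frac1{\alpha!}m_\alpha(t,x)\psi^\alpha(c)$ leads to the infinite system $\partial_tm_\beta+\sum_{k=1}^n\beta_k\partial_{x_k}m_{\beta-e_k}+\sum_{k=1}^n\partial_{x_k}m_{\beta+e_k}+|\beta|m_\beta=0$. The $N$th Galerkin approximation is $f_N(t,x,c)=\sum_{0\le|\alpha|\le N}\frac1{\alpha!}m_\alpha(t,x)\psi^\alpha(c)$, where $m=\{m_\beta:0\le|\beta|\le N\}$ solves the truncated system (the same equations for $|\beta|\le N$, with $m_\gamma:=0$ if $|\gamma|>N$ or $\gamma$ has a negative entry),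 with prescribed initial data $m_\beta(0,\cdot)\in C_0^\infty(\mathbb R^n)$ (given for all $\beta$, and restricted to $|\beta|\le N$); the constants may depend on the initial data. In matrix form, with $D_t=\frac1i\partial_t$, $D_{x_j}=\frac1i\partial_{x_j}$, the truncated system is $D_tm+\sum_jA_jD_{x_j}m-iBm=0$, where $B_{\alpha,\beta}=|\alpha|\delta_{\alpha,\beta}$ and $(A_jm)_\beta=\beta_jm_{\beta-e_j}+m_{\beta+e_j}$. The $N$th Fokker–Planck polynomial is $P(\tau,\xi)=\det\big(\tau I+\sum_jA_j\xi_j-iB\big)$, $\tau\in\mathbb C$, $\xi\in\mathbb R^n$. It is called stable if its roots $\tau(\xi)$ (with respect to $\tau$) satisfy $\operatorname{Im}\tau(\xi)\ge0$ for all $\xi\in\mathbb R^n$ and $\operatorname{Im}\tau(\xi)=0$ implies $\xi=0$. It is called strongly stable if, moreover, $\operatorname{Im}\tau(\xi)=0$ implies $\xi=0$ and $\operatorname{Re}\tau(\xi)=0$, and its roots satisfy $\liminf_{|\xi|\to\infty}\operatorname{Im}\tau(\xi)>0$. $L^2_w(\mathbb R^n_c)$ is the weighted $L^2$ space in $c$ with weight $w$; the norm on the left is the supremum over $x$ of the $L^2_w(\mathbb R^n_c)$ norm in $c$. *)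

theory Defs
  imports "HOL-Analysis.Analysis"
begin

definition mi_abs :: "nat ^ 'n \<Rightarrow> nat" where
  "mi_abs \<alpha> = (\<Sum>k\<in>UNIV. \<alpha> $ k)"

definition mi_fact :: "nat ^ 'n \<Rightarrow> nat" where
  "mi_fact \<alpha> = (\<Prod>k\<in>UNIV. fact (\<alpha> $ k))"

definition mi_upto :: "nat \<Rightarrow> (nat ^ 'n) set" where
  "mi_upto N = {\<alpha>. mi_abs \<alpha> \<le> N}"

abbreviation mi_unit :: "'n \<Rightarrow> nat ^ 'n" where
  "mi_unit k \<equiv> axis k 1"

definition partial_deriv ::
  "'n \<Rightarrow> (real ^ 'n \<Rightarrow> 'a::real_normed_vector) \<Rightarrow> real ^ 'n \<Rightarrow> 'a" where
  "partial_deriv k f x = vector_derivative (\<lambda>s. f (x + s *\<^sub>R axis k 1)) (at 0)"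

text \<open>All iterated partial derivatives, of every order, are (totally) differentiable everywhere;
  since differentiability implies continuity, this is membership in \<open>C\<^sup>\<infinity>\<close>.\<close>

definition smooth :: "(real ^ 'n \<Rightarrow> 'a::real_normed_vector) \<Rightarrow> bool" where
  "smooth f \<longleftrightarrow> (\<forall>ks x. fold partial_deriv ks f differentiable (at x))"

definition test_function :: "(real ^ 'n \<Rightarrow> complex) \<Rightarrow> bool" where
  "test_function f \<longleftrightarrow> smooth f \<and> compact (closure {x. f x \<noteq> 0})"

text \<open>\<open>(-\<partial>\<^sub>c)\<^sup>\<alpha> exp (-|c|\<^sup>2/2)\<close> is obtained by differentiating along a list of directions in which
  each direction \<open>k\<close> occurs \<open>\<alpha> $ k\<close> times. The index type carries no order, so an arbitrary such
  list is taken; partial derivatives of the Gaussian commute, so the choice is immaterial.\<close>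

definition hermite_fun :: "nat ^ 'n \<Rightarrow> real ^ 'n \<Rightarrow> real" where
  "hermite_fun \<alpha> c =
     (2 * pi) powr (- real CARD('n) / 2) *
     fold (\<lambda>k g y. - partial_deriv k g y)
       (SOME ks. \<forall>k. count_list ks k = \<alpha> $ k)
       (\<lambda>y. exp (- (norm y)\<^sup>2 / 2)) c"

definition galerkin ::
  "nat \<Rightarrow> (nat ^ 'n \<Rightarrow> real \<Rightarrow> real ^ 'n \<Rightarrow> complex) \<Rightarrow>
   real \<Rightarrow> real ^ 'n \<Rightarrow> real ^ 'n \<Rightarrow> complex" where
  "galerkin N m t x c =
     (\<Sum>\<alpha>\<in>mi_upto N. 1 / of_nat (mi_fact \<alpha>) * m \<alpha> t x * of_real (hermite_fun \<alpha> c))"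

text \<open>Classical solutions of the truncated system for \<open>t > 0\<close>, attaining the initial data
  continuously. Only the values \<open>m \<beta>\<close> with \<open>|\<beta>| \<le> N\<close> matter. If \<open>\<beta> $ k = 0\<close> then
  \<open>\<beta> - mi_unit k\<close> truncates to \<open>\<beta>\<close>, but the term has the factor \<open>\<beta> $ k = 0\<close>.\<close>

definition truncated_solution ::
  "nat \<Rightarrow> (nat ^ 'n \<Rightarrow> real ^ 'n \<Rightarrow> complex) \<Rightarrow>
   (nat ^ 'n \<Rightarrow> real \<Rightarrow> real ^ 'n \<Rightarrow> complex) \<Rightarrow> bool" where
  "truncated_solution N m0 m \<longleftrightarrow>
     (\<forall>\<beta>\<in>mi_upto N.
        continuous_on ({0..} \<times> UNIV) (\<lambda>(t, x). m \<beta> t x) \<and>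
        (\<forall>t>0. \<forall>x. (\<lambda>(t, x). m \<beta> t x) differentiable (at (t, x))) \<and>
        continuous_on ({0<..} \<times> UNIV) (\<lambda>(t, x). vector_derivative (\<lambda>s. m \<beta> s x) (at t)) \<and>
        (\<forall>k. continuous_on ({0<..} \<times> UNIV) (\<lambda>(t, x). partial_deriv k (m \<beta> t) x)) \<and>
        (\<forall>x. m \<beta> 0 x = m0 \<beta> x) \<and>
        (\<forall>t>0. \<forall>x.
           vector_derivative (\<lambda>s. m \<beta> s x) (at t)
           + (\<Sum>k\<in>UNIV. of_nat (\<beta> $ k) * partial_deriv k (m (\<beta> - mi_unit k) t) x)
           + (\<Sum>k\<in>UNIV. if \<beta> + mi_unit k \<in> mi_upto N
                        then partial_deriv k (m (\<beta> + mi_unit k) t) x else 0)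
           + of_nat (mi_abs \<beta>) * m \<beta> t x = 0))"

text \<open>Leibniz determinant of a matrix whose rows and columns are indexed by a finite set; the
  library determinant is indexed by a finite type, whereas here the index set depends on \<open>N\<close>.\<close>

definition det_on :: "'i set \<Rightarrow> ('i \<Rightarrow> 'i \<Rightarrow> 'a::comm_ring_1) \<Rightarrow> 'a" where
  "det_on S M = (\<Sum>p | p permutes S. of_int (sign p) * (\<Prod>i\<in>S. M i (p i)))"

lemma det_on_UNIV: "det_on UNIV (\<lambda>i j. A $ i $ j) = det A"
  by (simp add: det_on_def det_def)

definition fp_A :: "'n \<Rightarrow> nat ^ 'n \<Rightarrow> nat ^ 'n \<Rightarrow> complex" where
  "fp_A j \<beta> \<gamma> =
     (if \<gamma> = \<beta> - mi_unit j then of_nat (\<beta> $ j) else 0) +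
     (if \<gamma> = \<beta> + mi_unit j then 1 else 0)"

definition fp_B :: "nat ^ 'n \<Rightarrow> nat ^ 'n \<Rightarrow> complex" where
  "fp_B \<alpha> \<beta> = (if \<alpha> = \<beta> then of_nat (mi_abs \<alpha>) else 0)"

definition fp_poly :: "nat \<Rightarrow> complex \<Rightarrow> real ^ 'n \<Rightarrow> complex" where
  "fp_poly N \<tau> \<xi> =
     det_on (mi_upto N)
       (\<lambda>\<alpha> \<beta>. (if \<alpha> = \<beta> then \<tau> else 0)
              + (\<Sum>j\<in>UNIV. fp_A j \<alpha> \<beta> * of_real (\<xi> $ j))
              - \<i> * fp_B \<alpha> \<beta>)"

definition stable :: "(complex \<Rightarrow> real ^ 'n \<Rightarrow> complex) \<Rightarrow> bool" where
  "stable P \<longleftrightarrow>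
     (\<forall>\<tau> \<xi>. P \<tau> \<xi> = 0 \<longrightarrow> Im \<tau> \<ge> 0 \<and> (Im \<tau> = 0 \<longrightarrow> \<xi> = 0))"

text \<open>The lower limit is that of the smallest imaginary part of the roots, i.e. it is taken over
  all roots simultaneously.\<close>

definition strongly_stable :: "(complex \<Rightarrow> real ^ 'n \<Rightarrow> complex) \<Rightarrow> bool" where
  "strongly_stable P \<longleftrightarrow>
     stable P \<and>
     (\<forall>\<tau> \<xi>. P \<tau> \<xi> = 0 \<longrightarrow> Im \<tau> = 0 \<longrightarrow> \<xi> = 0 \<and> Re \<tau> = 0) \<and>
     Liminf at_infinity (\<lambda>\<xi>. INF \<tau>\<in>{\<tau>. P \<tau> \<xi> = 0}. ereal (Im \<tau>)) > 0"

text \<open>Extended-valued, so that it is infinite (rather than a junk value) where the integral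
  diverges or the supremum is infinite.\<close>

definition L2_weighted_norm ::
  "('a::euclidean_space \<Rightarrow> real) \<Rightarrow> ('a \<Rightarrow> complex) \<Rightarrow> ennreal" where
  "L2_weighted_norm w g =
     (let I = (\<integral>\<^sup>+ c. ennreal ((norm (g c))\<^sup>2 * w c) \<partial>lborel)
      in if I = \<infinity> then \<infinity> else ennreal (sqrt (enn2real I)))"

definition Linf_L2_norm ::
  "('a::euclidean_space \<Rightarrow> real) \<Rightarrow> ('b \<Rightarrow> 'a \<Rightarrow> complex) \<Rightarrow> ennreal" where
  "Linf_L2_norm w f = (SUP x. L2_weighted_norm w (f x))"

end

theory Submission
  imports Defs "HOL-Probability.Probability" "HOL-Real_Asymp.Real_Asymp"
begin

text \<open>With the weights \<open>1 / \<beta>!\<close> the coupling matrices \<open>A\<^sub>k\<close> of the truncated system are symmetric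
(\<open>transport_inner\<close>), so the system is symmetric hyperbolic with the dissipative zeroth order term
\<open>|\<beta>| m\<^sub>\<beta>\<close>. The energy \<open>\<Sum> |m\<^sub>\<beta>|\<^sup>2 / \<beta>!\<close> is, up to a constant, the squared norm of the Galerkin approximation in the
space with weight \<open>exp (|c|\<^sup>2/2)\<close>, in which the Hermite functions are orthogonal, and therefore
controls the norm with weight \<open>exp (-|c|\<^sup>2/2)\<close> (\<open>L2_weighted_norm_galerkin\<close>).

Classical solutions come with no growth condition in \<open>x\<close>. The local energy balance gives finite speed
of propagation (\<open>finite_propagation_speed\<close>), so solutions with compactly supported data stay compactly
supported and may be Fourier transformed in \<open>x\<close>. At each frequency \<open>\<xi>\<close> this leaves a linear
system of ordinary differential equations (\<open>fourier_m_ode\<close>).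

Its dissipation controls every component except the density \<open>m\<^sub>0\<close>. Strong stability excludes
\<open>N = 0\<close>, and for \<open>N \<ge> 1\<close> the coupling of \<open>m\<^sub>0\<close> to the first moments transfers
dissipation to \<open>m\<^sub>0\<close>: adding a small multiple of a mixed term to the energy yields a Lyapunov function, and the
energy decays like \<open>exp (- \<kappa> t |\<xi>|\<^sup>2 / (1 + |\<xi>|\<^sup>2))\<close> with \<open>\<kappa>\<close> depending only on the
dimension (\<open>hypocoercive_decay\<close>). Integrating the square root of the energy over \<open>\<xi>\<close> bounds the supremum over \<open>x\<close>
(\<open>sqrt_mi_energy_le_integral_fourier\<close>). Frequencies away from \<open>0\<close> contribute an
exponentially small amount, and frequencies near \<open>0\<close> contribute a Gaussian integral of order \<open>t\<close> to the power \<open>-n/2\<close>.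

It remains to make the constant in front of that power independent of \<open>N\<close>, although the initial
energy is not bounded in \<open>N\<close>. After a waiting time \<open>s\<close> all components other than \<open>m\<^sub>0\<close> have
decayed, so at low frequencies the energy is close to what \<open>m\<^sub>0\<close> carried initially
(\<open>low_frequency\<close>); restarting the decay estimate at time \<open>s\<close> gives a leading constant that only
involves the integral of \<open>|m\<^sub>0(0, \<cdot>)|\<close>. The time \<open>s\<close>, the low frequency window and the exponential rate depend on
\<open>N\<close> and the data, but they only determine the time after which the power of \<open>t\<close> dominates. What happens before that
time is bounded, hence absorbed by \<open>C\<^sub>N exp (-t)\<close>, and the choice \<open>\<epsilon>(N) = 1\<close> is possible.\<close>

section \<open>Integration over Euclidean space\<close>

lemma Basis_vec_eq_axis: "(Basis :: (real ^ 'n) set) = range (\<lambda>k. axis k 1)"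
  by (auto simp: Basis_vec_def)

text \<open>Lebesgue measure on \<open>real ^ 'n\<close> is the image of a finite product of one-dimensional Lebesgue
measures indexed by the basis vectors; transporting the product rule along this map reduces the Gaussian and
Hermite integrals below to one variable.\<close>

lemma lborel_integral_prod_coords:
  fixes f :: "'n::finite \<Rightarrow> real \<Rightarrow> 'b::{real_normed_field,banach,second_countable_topology}"
  assumes "\<And>k. integrable lborel (f k)"
  shows "integrable lborel (\<lambda>x::real^'n. \<Prod>k\<in>UNIV. f k (x $ k))"
    and "(\<integral>x. (\<Prod>k\<in>UNIV. f k ((x::real^'n) $ k)) \<partial>lborel) = (\<Prod>k\<in>UNIV. \<integral>y. f k y \<partial>lborel)"
proof -
  interpret product_sigma_finite "\<lambda>_::real^'n. lborel :: real measure" ..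
  define g where "g b = f (inv (\<lambda>k::'n. axis k (1::real)) b)" for b :: "real^'n"
  have inj: "inj (\<lambda>k::'n. axis k (1::real))"
    by (auto simp: inj_on_def axis_eq_axis)
  have g_axis: "g (axis k 1) = f k" for k
    by (simp add: g_def inv_f_f[OF inj])
  have [measurable]: "f k \<in> borel_measurable borel" for k
    using assms[of k] borel_measurable_integrable by fastforce
  have int: "integrable lborel (g b)" if "b \<in> Basis" for b
    unfolding g_def by (rule assms)
  have meas[measurable]: "(\<lambda>x::real^'n. \<Prod>k\<in>UNIV. f k (x $ k)) \<in> borel_measurable borel"
    by measurable
  have mT: "(\<lambda>h::real^'n\<Rightarrow>real. \<Sum>b\<in>Basis. h b *\<^sub>R b) \<in> (\<Pi>\<^sub>M b\<in>Basis. lborel) \<rightarrow>\<^sub>M borel"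
    by measurable
  have comp: "(\<Sum>b\<in>Basis. h b *\<^sub>R b) $ k = h (axis k 1)" for h and k :: 'n
  proof -
    have "(\<Sum>b\<in>Basis. h b *\<^sub>R b) $ k = (\<Sum>b\<in>Basis. h b *\<^sub>R b) \<bullet> axis k 1"
      by (simp add: inner_axis)
    also have "\<dots> = h (axis k 1)"
      by (rule inner_sum_left_Basis) (simp add: Basis_vec_eq_axis)
    finally show ?thesis .
  qed
  have reidx: "(\<Prod>k\<in>UNIV. f k ((\<Sum>b\<in>Basis. h b *\<^sub>R b) $ k)) = (\<Prod>b\<in>Basis. g b (h b))" for h
  proof -
    have "(\<Prod>b\<in>Basis. g b (h b)) = (\<Prod>k\<in>UNIV. g (axis k 1) (h (axis k 1)))"
      by (simp only: Basis_vec_eq_axis prod.reindex[OF inj] o_def)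
    then show ?thesis by (simp only: comp g_axis)
  qed
  show "integrable lborel (\<lambda>x::real^'n. \<Prod>k\<in>UNIV. f k (x $ k))"
    apply (subst lborel_eq, subst integrable_distr_eq[OF mT meas])
    unfolding reidx by (rule product_integrable_prod) (auto intro: int)
  have "(\<integral>x. (\<Prod>k\<in>UNIV. f k ((x::real^'n) $ k)) \<partial>lborel) = (\<Prod>b\<in>Basis. \<integral>y. g b y \<partial>lborel)"
    apply (subst lborel_eq, subst integral_distr[OF mT meas])
    unfolding reidx by (rule product_integral_prod) (auto intro: int)
  also have "\<dots> = (\<Prod>k\<in>UNIV. \<integral>y. f k y \<partial>lborel)"
    by (simp only: Basis_vec_eq_axis prod.reindex[OF inj] o_def g_axis)
  finally show "(\<integral>x. (\<Prod>k\<in>UNIV. f k ((x::real^'n) $ k)) \<partial>lborel) = (\<Prod>k\<in>UNIV. \<integral>y. f k y \<partial>lborel)" .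
qed

lemma integral_vanishing_outside_cbox:
  fixes f :: "'a::euclidean_space \<Rightarrow> 'b::euclidean_space"
  assumes "continuous_on UNIV f" and "\<And>x. x \<notin> cbox a b \<Longrightarrow> f x = 0"
  shows "integrable lborel f" and "(\<integral>x. f x \<partial>lborel) = integral (cbox a b) f"
proof -
  have eq: "(\<lambda>x. indicator (cbox a b) x *\<^sub>R f x) = f"
    using assms(2) by (auto simp: indicator_def)
  have *: "set_integrable lborel (cbox a b) f"
    unfolding set_integrable_def
    by (rule borel_integrable_compact) (use assms(1) in \<open>auto intro: continuous_on_subset\<close>)
  then show "integrable lborel f" unfolding set_integrable_def eq .
  show "(\<integral>x. f x \<partial>lborel) = integral (cbox a b) f"
    using set_borel_integral_eq_integral(2)[OF *] unfolding set_lebesgue_integral_def eq .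
qed

lemma integral_lborel_affine:
  fixes f :: "'a::euclidean_space \<Rightarrow> 'b::{banach,second_countable_topology}"
  assumes [measurable]: "f \<in> borel_measurable borel" and c: "c \<noteq> 0"
  shows "(\<integral>x. f x \<partial>lborel) = \<bar>c\<bar> ^ DIM('a) *\<^sub>R (\<integral>x. f (t + c *\<^sub>R x) \<partial>lborel)"
proof -
  have "(\<integral>x. f x \<partial>lborel) =
      (\<integral>x. f x \<partial>density (distr lborel borel (\<lambda>x. t + c *\<^sub>R x)) (\<lambda>_. ennreal (\<bar>c\<bar> ^ DIM('a))))"
    using lborel_affine[OF c, of t] by (simp add: ennreal_power)
  also have "\<dots> = \<bar>c\<bar> ^ DIM('a) *\<^sub>R (\<integral>x. f (t + c *\<^sub>R x) \<partial>lborel)"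
    by (subst integral_density) (auto simp: integral_distr)
  finally show ?thesis .
qed

text \<open>The Leibniz rule for integrals over a box extends to the whole space when one box contains the
supports of all the functions. The derivative then has its support in the same box, because \<open>f s x = 0\<close> for all
\<open>s\<close> in the open set \<open>U\<close>.\<close>

lemma has_vector_derivative_integral_vanishing:
  fixes f :: "real \<Rightarrow> 'a::euclidean_space \<Rightarrow> 'b::euclidean_space"
  assumes U: "open U" "convex U" "t \<in> U"
    and cont: "\<And>s. s \<in> U \<Longrightarrow> continuous_on UNIV (f s)"
    and der: "\<And>s x. s \<in> U \<Longrightarrow> ((\<lambda>s. f s x) has_vector_derivative f' s x) (at s)"
    and cont': "continuous_on (U \<times> UNIV) (\<lambda>(s, x). f' s x)"
    and van: "\<And>s x. s \<in> U \<Longrightarrow> x \<notin> cbox a b \<Longrightarrow> f s x = 0"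
  shows "((\<lambda>s. \<integral>x. f s x \<partial>lborel) has_vector_derivative (\<integral>x. f' t x \<partial>lborel)) (at t)"
proof -
  have van': "f' s x = 0" if "s \<in> U" "x \<notin> cbox a b" for s x
  proof -
    have "((\<lambda>s. f s x) has_vector_derivative 0) (at s)"
      by (rule has_vector_derivative_transform_within_open[OF has_vector_derivative_const[of 0]])
         (use U that van in auto)
    with der[OF that(1)] show ?thesis by (rule vector_derivative_unique_at)
  qed
  have c': "continuous_on UNIV (f' s)" if "s \<in> U" for s
  proof -
    have "continuous_on UNIV (\<lambda>x. (\<lambda>(s, x). f' s x) (s, x))"
      by (rule continuous_on_compose2[OF cont']) (use that in \<open>auto intro!: continuous_intros\<close>)
    then show ?thesis by simp
  qed
  have "((\<lambda>s. integral (cbox a b) (f s)) has_vector_derivative integral (cbox a b) (f' t)) (at t within U)"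
  proof (rule leibniz_rule_vector_derivative)
    show "f s integrable_on cbox a b" if "s \<in> U" for s
      by (rule integrable_continuous) (use cont[OF that] in \<open>auto intro: continuous_on_subset\<close>)
    show "continuous_on (U \<times> cbox a b) (\<lambda>(s, x). f' s x)"
      by (rule continuous_on_subset[OF cont']) auto
  qed (use U der in \<open>auto intro: has_vector_derivative_at_within\<close>)
  then have "((\<lambda>s. integral (cbox a b) (f s)) has_vector_derivative integral (cbox a b) (f' t)) (at t)"
    by (simp only: at_within_open[OF U(3,1)])
  then have "((\<lambda>s. \<integral>x. f s x \<partial>lborel) has_vector_derivative integral (cbox a b) (f' t)) (at t)"
  proof (rule has_vector_derivative_transform_within_open[OF _ U(1,3)])
    show "integral (cbox a b) (f s) = (\<integral>x. f s x \<partial>lborel)" if "s \<in> U" for s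
      by (rule integral_vanishing_outside_cbox(2)[OF cont van, symmetric]) (use that in simp_all)
  qed
  moreover have "integral (cbox a b) (f' t) = (\<integral>x. f' t x \<partial>lborel)"
    by (rule integral_vanishing_outside_cbox(2)[OF c' van', symmetric]) (use U(3) in simp_all)
  ultimately show ?thesis
    by simp
qed

lemma continuous_on_integral_vanishing:
  fixes f :: "'c::topological_space \<Rightarrow> 'a::euclidean_space \<Rightarrow> 'b::euclidean_space"
  assumes cont: "continuous_on (U \<times> UNIV) (\<lambda>(s, x). f s x)"
    and van: "\<And>s x. s \<in> U \<Longrightarrow> x \<notin> cbox a b \<Longrightarrow> f s x = 0"
  shows "continuous_on U (\<lambda>s. \<integral>x. f s x \<partial>lborel)"
proof -
  have "continuous_on U (\<lambda>s. integral (cbox a b) (f s))"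
    by (rule integral_continuous_on_param) (rule continuous_on_subset[OF cont], auto)
  moreover have "(\<integral>x. f s x \<partial>lborel) = integral (cbox a b) (f s)" if "s \<in> U" for s
  proof (rule integral_vanishing_outside_cbox(2))
    have "continuous_on UNIV (\<lambda>x. (\<lambda>(s, x). f s x) (s, x))"
      by (rule continuous_on_compose2[OF cont]) (use that in \<open>auto intro!: continuous_intros\<close>)
    then show "continuous_on UNIV (f s)" by simp
  qed (use van that in auto)
  ultimately show ?thesis by (simp cong: continuous_on_cong)
qed

section \<open>Partial derivatives\<close>

text \<open>Relational counterpart of \<^const>\<open>partial_deriv\<close>, which as a total function has an arbitrary value where
the derivative does not exist.\<close>

definition has_partial_deriv :: "(real ^ 'n \<Rightarrow> 'b::real_normed_vector) \<Rightarrow> 'n \<Rightarrow> 'b \<Rightarrow> real ^ 'n \<Rightarrow> bool" where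
  "has_partial_deriv f k d x \<longleftrightarrow> ((\<lambda>s. f (x + s *\<^sub>R axis k 1)) has_vector_derivative d) (at 0)"

lemma has_partial_deriv_shift:
  assumes "has_partial_deriv f k d (x + s *\<^sub>R axis k 1)"
  shows "((\<lambda>s. f (x + s *\<^sub>R axis k 1)) has_vector_derivative d) (at s)"
proof -
  have "((\<lambda>r. f (x + s *\<^sub>R axis k 1 + r *\<^sub>R axis k 1)) has_vector_derivative d) (at (s - s))"
    using assms by (simp add: has_partial_deriv_def)
  then have "(((\<lambda>r. f (x + s *\<^sub>R axis k 1 + r *\<^sub>R axis k 1)) \<circ> (\<lambda>r. r - s)) has_vector_derivative 1 *\<^sub>R d) (at s)"
    by (intro vector_diff_chain_at) (auto intro!: derivative_eq_intros)
  then show ?thesis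
    by (simp add: o_def algebra_simps)
qed

lemma partial_deriv_vanishing:
  assumes der: "has_partial_deriv f k d x"
    and van: "\<And>y. y \<notin> C \<Longrightarrow> f y = 0" and C: "closed C" "x \<notin> C"
  shows "d = 0"
proof -
  let ?e = "axis k 1 :: real ^ 'a"
  have "open ((\<lambda>s. x + s *\<^sub>R ?e) -` (- C))"
    by (rule open_vimage) (use C in \<open>auto intro!: continuous_intros\<close>)
  then have "((\<lambda>s. f (x + s *\<^sub>R ?e)) has_vector_derivative 0) (at 0)"
    by (rule has_vector_derivative_transform_within_open[OF has_vector_derivative_const[of 0]])
       (use C van in auto)
  with der show ?thesis
    unfolding has_partial_deriv_def by (rule vector_derivative_unique_at)
qed

lemma differentiable_has_partial_deriv:
  assumes "f differentiable (at x)"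
  shows "has_partial_deriv f k (partial_deriv k f x) x"
proof -
  have "(\<lambda>s. x + s *\<^sub>R axis k 1) differentiable (at (0::real))"
    by (auto intro!: derivative_intros)
  then have "(f \<circ> (\<lambda>s. x + s *\<^sub>R axis k 1)) differentiable (at (0::real))"
    by (rule differentiable_chain_at) (use assms in simp)
  then show ?thesis
    unfolding has_partial_deriv_def partial_deriv_def
    by (simp add: vector_derivative_works o_def)
qed

text \<open>By translation invariance the integral of \<open>x \<mapsto> f (x + s e\<^sub>k)\<close> does not depend on \<open>s\<close>.
Differentiating in \<open>s\<close> under the integral sign shows that a partial derivative has integral zero.\<close>

lemma integral_partial_deriv_eq_0:
  fixes f :: "real ^ 'n \<Rightarrow> 'b::euclidean_space"
  assumes cont: "continuous_on UNIV f" and cont': "continuous_on UNIV f'"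
    and der: "\<And>x. has_partial_deriv f k (f' x) x"
    and van: "\<And>x. x \<notin> cbox a b \<Longrightarrow> f x = 0"
  shows "(\<integral>x. f' x \<partial>lborel) = 0"
proof -
  let ?e = "axis k 1 :: real ^ 'n"
  have e: "\<bar>s * ?e $ i\<bar> \<le> 1" if "\<bar>s\<bar> < 1" for s :: real and i
    using that by (auto simp: axis_def)
  have out: "x + s *\<^sub>R ?e \<notin> cbox a b" if "\<bar>s\<bar> < 1" "x \<notin> cbox (a - 1) (b + 1)" for x s
  proof
    assume *: "x + s *\<^sub>R ?e \<in> cbox a b"
    have "a $ i - 1 \<le> x $ i \<and> x $ i \<le> b $ i + 1" for i
    proof -
      have "a $ i \<le> x $ i + s * ?e $ i \<and> x $ i + s * ?e $ i \<le> b $ i"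
        using * by (simp add: mem_box_cart)
      then show ?thesis using e[OF that(1), of i] by linarith
    qed
    then have "x \<in> cbox (a - 1) (b + 1)" by (simp add: mem_box_cart)
    with that show False by simp
  qed
  have "((\<lambda>s. \<integral>x. f (x + s *\<^sub>R ?e) \<partial>lborel) has_vector_derivative (\<integral>x. f' (x + 0 *\<^sub>R ?e) \<partial>lborel)) (at 0)"
  proof (rule has_vector_derivative_integral_vanishing[where U="{-1<..<1}" and a="a - 1" and b="b + 1"])
    show "continuous_on UNIV (\<lambda>x. f (x + s *\<^sub>R ?e))" for s
      by (rule continuous_on_compose2[OF cont]) (auto intro!: continuous_intros)
    show "((\<lambda>s. f (x + s *\<^sub>R ?e)) has_vector_derivative f' (x + s *\<^sub>R ?e)) (at s)" for s x
      by (rule has_partial_deriv_shift[OF der])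
    show "continuous_on ({-1<..<1} \<times> UNIV) (\<lambda>(s, x). f' (x + s *\<^sub>R ?e))"
      unfolding case_prod_beta
      by (rule continuous_on_compose2[OF cont']) (auto intro!: continuous_intros)
    show "f (x + s *\<^sub>R ?e) = 0" if "s \<in> {-1<..<1}" "x \<notin> cbox (a - 1) (b + 1)" for s x
      by (intro van out) (use that in auto)
  qed auto
  moreover have "(\<integral>x. f (x + s *\<^sub>R ?e) \<partial>lborel) = (\<integral>x. f x \<partial>lborel)" for s
    using integral_lborel_affine[of f 1 "s *\<^sub>R ?e"] cont
    by (simp add: borel_measurable_continuous_onI add.commute)
  ultimately have "((\<lambda>s::real. \<integral>x. f x \<partial>lborel) has_vector_derivative (\<integral>x. f' x \<partial>lborel)) (at 0)"
    by simp
  then show ?thesis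
    by (rule vector_derivative_unique_at[OF _ has_vector_derivative_const])
qed

section \<open>Hermite functions and the weighted norm\<close>

fun hermite :: "nat \<Rightarrow> real poly" where
  "hermite 0 = 1"
| "hermite (Suc n) = [:0, 1:] * hermite n - pderiv (hermite n)"

definition gauss_mean :: "real poly \<Rightarrow> real" where
  "gauss_mean p = (\<integral>y. poly p y * std_normal_density y \<partial>lborel)"

lemma integrable_poly_std_normal: "integrable lborel (\<lambda>y. poly p y * std_normal_density y)"
proof -
  have "integrable lborel (\<lambda>y. \<Sum>i\<le>degree p. coeff p i * (std_normal_density y * y ^ i))"
    by (intro Bochner_Integration.integrable_sum integrable_mult_right integrable_std_normal_moment)
  moreover have "(\<lambda>y. \<Sum>i\<le>degree p. coeff p i * (std_normal_density y * y ^ i)) =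
      (\<lambda>y. poly p y * std_normal_density y)"
    by (auto simp: poly_altdef sum_distrib_right sum_distrib_left mult_ac)
  ultimately show ?thesis by simp
qed

lemma gauss_mean_add: "gauss_mean (p + q) = gauss_mean p + gauss_mean q"
  unfolding gauss_mean_def poly_add distrib_right
  by (rule Bochner_Integration.integral_add) (rule integrable_poly_std_normal)+

lemma gauss_mean_diff: "gauss_mean (p - q) = gauss_mean p - gauss_mean q"
  unfolding gauss_mean_def poly_diff left_diff_distrib
  by (rule Bochner_Integration.integral_diff) (rule integrable_poly_std_normal)+

text \<open>The truncated exponent \<open>n - 1\<close> is harmless for \<open>n = 0\<close> because of the factor \<open>n\<close>.\<close>

lemma std_normal_moment_rec:
  "(\<integral>y. std_normal_density y * y ^ Suc n \<partial>lborel) =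
     real n * (\<integral>y. std_normal_density y * y ^ (n - 1) \<partial>lborel)"
proof (cases "even n")
  case True
  then obtain k where k: "n = 2 * k" by (elim evenE)
  have 1: "(\<integral>y. std_normal_density y * y ^ Suc n \<partial>lborel) = 0"
    using integral_std_normal_moment_odd[of k] by (simp only: k Suc_eq_plus1)
  show ?thesis
  proof (cases k)
    case 0 show ?thesis unfolding 1 by (simp add: k 0)
  next
    case (Suc l)
    have "n - 1 = 2 * l + 1" using k Suc by simp
    then show ?thesis unfolding 1 using integral_std_normal_moment_odd[of l] by simp
  qed
next
  case False
  then obtain k where k: "n = 2 * k + 1" by (elim oddE)
  have e1: "Suc n = 2 * Suc k" and e2: "n - 1 = 2 * k" using k by auto
  have "(fact (2 * Suc k) :: real) / (2 ^ Suc k * fact (Suc k)) =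
      real (2 * k + 1) * (fact (2 * k) / (2 ^ k * fact k))"
  proof -
    have *: "(2 * (real k + 1)) \<noteq> 0" by (simp add: add_nonneg_eq_0_iff)
    have "(fact (2 * Suc k) :: real) = (2 * (real k + 1)) * (real (2 * k + 1) * fact (2 * k))"
      by (simp add: algebra_simps)
    moreover have "(2 ^ Suc k * fact (Suc k) :: real) = (2 * (real k + 1)) * (2 ^ k * fact k)"
      by (simp add: algebra_simps)
    ultimately show ?thesis
      by (simp only: nonzero_mult_divide_mult_cancel_left[OF *] times_divide_eq_right)
  qed
  then show ?thesis
    unfolding e1 e2 integral_std_normal_moment_even using k by simp
qed

text \<open>Gaussian integration by parts. On monomials it is the recursion for the moments of the normal distribution,
and both sides are linear.\<close>

lemma gauss_mean_by_parts: "gauss_mean ([:0, 1:] * p) = gauss_mean (pderiv p)"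
proof -
  have mon: "gauss_mean (monom c n) = c * (\<integral>y. std_normal_density y * y ^ n \<partial>lborel)" for c n
    unfolding gauss_mean_def poly_monom mult.assoc
    by (simp add: mult.commute[of "_ ^ _"])
  have 1: "gauss_mean ([:0, 1:] * monom c n) = gauss_mean (pderiv (monom c n))" for c n
  proof -
    have "[:0, 1:] * monom c n = monom c (Suc n)" by (simp add: monom_Suc)
    then show ?thesis
      by (simp only: mon pderiv_monom std_normal_moment_rec) simp
  qed
  have "gauss_mean ([:0, 1:] * (\<Sum>i\<le>n. monom (coeff p i) i)) =
      gauss_mean (pderiv (\<Sum>i\<le>n. monom (coeff p i) i))" for n
  proof (induction n)
    case 0 show ?case using 1 by simp
  next
    case (Suc n)
    show ?case
      by (simp only: sum.atMost_Suc distrib_left pderiv_add gauss_mean_add Suc 1)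
  qed
  from this[of "degree p"] show ?thesis by (simp only: poly_as_sum_of_monoms)
qed

text \<open>The operator \<open>p \<mapsto> X p - p'\<close> that generates the Hermite polynomials is adjoint to differentiation with
respect to the Gaussian measure, so \<open>i\<close> applications of it can be moved to the other factor as \<open>i\<close> derivatives.\<close>

lemma gauss_mean_hermite_mult: "gauss_mean (hermite i * q) = gauss_mean ((pderiv ^^ i) q)"
proof (induction i arbitrary: q)
  case (Suc i)
  have "hermite (Suc i) * q = [:0, 1:] * (hermite i * q) - pderiv (hermite i * q) + hermite i * pderiv q"
    by (simp add: pderiv_mult algebra_simps)
  then have "gauss_mean (hermite (Suc i) * q) = gauss_mean (hermite i * pderiv q)"
    by (simp only: gauss_mean_add gauss_mean_diff gauss_mean_by_parts)
  then show ?case by (simp only: Suc funpow_Suc_right o_def)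
qed simp

lemma pderiv_hermite: "pderiv (hermite (Suc n)) = smult (real (Suc n)) (hermite n)"
proof (induction n)
  case 0 show ?case by (simp add: pderiv_pCons one_pCons)
next
  case (Suc n)
  have "pderiv (hermite (Suc (Suc n))) =
      hermite (Suc n) + [:0, 1:] * pderiv (hermite (Suc n)) - pderiv (pderiv (hermite (Suc n)))"
    by (simp only: hermite.simps(2)[of "Suc n"] pderiv_diff pderiv_mult) (simp add: pderiv_pCons)
  also have "\<dots> = hermite (Suc n) + smult (real (Suc n)) ([:0, 1:] * hermite n - pderiv (hermite n))"
    by (simp only: Suc pderiv_smult smult_diff_right mult_smult_right)
  also have "\<dots> = smult (real (Suc (Suc n))) (hermite (Suc n))"
  proof -
    have "smult (real (Suc (Suc n))) (hermite (Suc n)) = smult (1 + real (Suc n)) (hermite (Suc n))"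
      by simp
    then show ?thesis by (simp only: hermite.simps(2)[symmetric] smult_add_left smult_1_left)
  qed
  finally show ?case .
qed

lemma pderiv_funpow_hermite: "(pderiv ^^ n) (hermite n) = [:fact n:]"
proof (induction n)
  case (Suc n)
  have sm: "(pderiv ^^ k) (smult c p) = smult c ((pderiv ^^ k) p)" for k and c :: real and p
    by (induction k) (auto simp: pderiv_smult)
  show ?case
    by (simp only: funpow_Suc_right o_def pderiv_hermite sm Suc) simp
qed (simp add: one_pCons)

text \<open>If \<open>j < i\<close>, then \<open>i\<close> derivatives annihilate the \<open>j\<close>-th Hermite polynomial; if \<open>i = j\<close>,
they leave the constant \<open>i!\<close>.\<close>

lemma hermite_orthogonal: "gauss_mean (hermite i * hermite j) = (if i = j then fact i else 0)"
proof -
  have const: "gauss_mean [:c:] = c" for c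
    by (simp add: gauss_mean_def)
  have less: "gauss_mean (hermite i * hermite j) = 0" if ij: "j < i" for i j
  proof -
    have "(pderiv ^^ (k + Suc j)) (hermite j) = 0" for k
    proof (induction k)
      case 0 show ?case by (simp add: pderiv_funpow_hermite pderiv_pCons)
    qed simp
    from this[of "i - Suc j"] have "(pderiv ^^ i) (hermite j) = 0" using ij by simp
    then show ?thesis using const[of 0] by (simp add: gauss_mean_hermite_mult)
  qed
  consider "i = j" | "i < j" | "j < i" by linarith
  then show ?thesis
  proof cases
    case 1 then show ?thesis by (simp add: gauss_mean_hermite_mult pderiv_funpow_hermite const)
  next
    case 2 then show ?thesis using less[of i j] by (simp add: mult.commute)
  next
    case 3 then show ?thesis using less[of j i] by simp
  qed
qed

text \<open>The function \<open>(-d/dy)\<^sup>n exp (-y\<^sup>2/2)\<close>.\<close>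

definition gauss_deriv :: "nat \<Rightarrow> real \<Rightarrow> real" where
  "gauss_deriv n y = poly (hermite n) y * exp (- y\<^sup>2 / 2)"

lemma DERIV_gauss_deriv: "(gauss_deriv n has_real_derivative - gauss_deriv (Suc n) y) (at y)"
  unfolding gauss_deriv_def
  by (auto intro!: derivative_eq_intros simp: power2_eq_square algebra_simps)

text \<open>The Gaussian is a product of functions of one coordinate, and differentiating in direction \<open>k\<close>
raises the index of the \<open>k\<close>-th factor. The result depends on the list of directions only through its
counts, so the choice made in \<^const>\<open>hermite_fun\<close> does not matter.\<close>

lemma fold_neg_partial_deriv_gauss:
  fixes ks :: "'n::finite list"
  shows "fold (\<lambda>k g y. - partial_deriv k g y) ks (\<lambda>y::real^'n. exp (- (norm y)\<^sup>2 / 2)) =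
    (\<lambda>c. \<Prod>k\<in>UNIV. gauss_deriv (count_list ks k) (c $ k))"
proof (induction ks rule: rev_induct)
  case Nil
  have "exp (- (norm y)\<^sup>2 / 2) = (\<Prod>k\<in>UNIV. exp (- (y $ k)\<^sup>2 / 2))" for y :: "real^'n"
    by (subst exp_sum[symmetric])
       (auto simp: norm_vec_def L2_set_def sum_nonneg sum_divide_distrib sum_negf)
  then show ?case by (simp add: gauss_deriv_def)
next
  case (snoc k ks)
  let ?n = "count_list ks"
  have "partial_deriv k (\<lambda>c. \<Prod>j\<in>UNIV. gauss_deriv (?n j) (c $ j)) c =
      - (\<Prod>j\<in>UNIV. gauss_deriv (count_list (ks @ [k]) j) (c $ j))" for c :: "real^'n"
  proof -
    have split: "(\<Prod>j\<in>UNIV. gauss_deriv (?n j) ((c + s *\<^sub>R axis k 1) $ j)) =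
        gauss_deriv (?n k) (c $ k + s) * (\<Prod>j\<in>UNIV - {k}. gauss_deriv (?n j) (c $ j))" for s
    proof -
      have "(\<Prod>j\<in>UNIV - {k}. gauss_deriv (?n j) ((c + s *\<^sub>R axis k 1) $ j)) =
          (\<Prod>j\<in>UNIV - {k}. gauss_deriv (?n j) (c $ j))"
        by (rule prod.cong) (auto simp: axis_def)
      then show ?thesis by (subst prod.remove[of UNIV k]) auto
    qed
    have "((\<lambda>s. gauss_deriv (?n k) (c $ k + s)) has_real_derivative - gauss_deriv (Suc (?n k)) (c $ k)) (at 0)"
      using DERIV_shift[of "gauss_deriv (?n k)" _ 0 "c $ k"] DERIV_gauss_deriv[of "?n k" "c $ k"]
      by (simp add: add.commute)
    then have "((\<lambda>s. gauss_deriv (?n k) (c $ k + s) * (\<Prod>j\<in>UNIV - {k}. gauss_deriv (?n j) (c $ j)))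
        has_real_derivative - gauss_deriv (Suc (?n k)) (c $ k) * (\<Prod>j\<in>UNIV - {k}. gauss_deriv (?n j) (c $ j))) (at 0)"
      by (rule DERIV_cmult_right)
    then have "partial_deriv k (\<lambda>c. \<Prod>j\<in>UNIV. gauss_deriv (?n j) (c $ j)) c =
       - gauss_deriv (Suc (?n k)) (c $ k) * (\<Prod>j\<in>UNIV - {k}. gauss_deriv (?n j) (c $ j))"
      unfolding partial_deriv_def split
      by (intro vector_derivative_at) (simp add: has_real_derivative_iff_has_vector_derivative)
    also have "\<dots> = - (\<Prod>j\<in>UNIV. gauss_deriv (count_list (ks @ [k]) j) (c $ j))"
    proof -
      have "(\<Prod>j\<in>UNIV - {k}. gauss_deriv (count_list (ks @ [k]) j) (c $ j)) =
          (\<Prod>j\<in>UNIV - {k}. gauss_deriv (?n j) (c $ j))"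
        by (rule prod.cong) auto
      then show ?thesis by (subst prod.remove[of UNIV k]) auto
    qed
    finally show ?thesis .
  qed
  then show ?case using snoc by simp
qed

lemma ex_list_with_counts:
  fixes \<nu> :: "'n::finite \<Rightarrow> nat"
  shows "\<exists>ks. \<forall>k. count_list ks k = \<nu> k"
proof -
  have rep: "count_list (replicate m a) k = (if k = a then m else 0)" for m and a k :: 'n
    by (induction m) auto
  have "\<exists>ks. \<forall>k. count_list ks k = (if k \<in> A then \<nu> k else 0)" if "finite A" for A
    using that
  proof (induction A)
    case empty show ?case by (intro exI[of _ "[]"]) simp
  next
    case (insert a A)
    then obtain ks where "\<forall>k. count_list ks k = (if k \<in> A then \<nu> k else 0)" by blast
    then show ?case
      using insert.hyps by (intro exI[of _ "replicate (\<nu> a) a @ ks"]) (auto simp: rep)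
  qed
  from this[of UNIV] show ?thesis by simp
qed

lemma hermite_fun_eq_prod:
  fixes \<alpha> :: "nat ^ 'n::finite"
  shows "hermite_fun \<alpha> c = (2 * pi) powr (- real CARD('n) / 2) * (\<Prod>k\<in>UNIV. gauss_deriv (\<alpha> $ k) (c $ k))"
proof -
  have "\<forall>k. count_list (SOME ks. \<forall>k. count_list ks k = \<alpha> $ k) k = \<alpha> $ k"
    by (rule someI_ex) (rule ex_list_with_counts)
  then show ?thesis
    unfolding hermite_fun_def fold_neg_partial_deriv_gauss by simp
qed

text \<open>The factor \<open>exp (|c|\<^sup>2/2)\<close> cancels one of the two Gaussians, which leaves a product over the coordinates of
one-dimensional Gaussian means of products of two Hermite polynomials.\<close>

lemma hermite_fun_orthogonal:
  fixes \<alpha> \<beta> :: "nat ^ 'n::finite"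
  shows "has_bochner_integral lborel
    (\<lambda>c. hermite_fun \<alpha> c * hermite_fun \<beta> c * exp ((norm c)\<^sup>2 / 2))
    (if \<alpha> = \<beta> then (2 * pi) powr (- real CARD('n) / 2) * real (mi_fact \<alpha>) else 0)"
proof -
  let ?c = "(2 * pi) powr (- real CARD('n) / 2)"
  let ?p = "\<lambda>k. hermite (\<alpha> $ k) * hermite (\<beta> $ k)"
  have gd: "gauss_deriv i y * gauss_deriv j y * exp (y\<^sup>2 / 2) =
      sqrt (2 * pi) * (poly (hermite i * hermite j) y * std_normal_density y)" for i j y
  proof -
    have "exp (- y\<^sup>2 / 2) * exp (y\<^sup>2 / 2) = (1::real)" by (simp add: exp_add[symmetric])
    then show ?thesis by (simp add: gauss_deriv_def std_normal_density_def)
  qed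
  have norm2: "exp ((norm c)\<^sup>2 / 2) = (\<Prod>k\<in>UNIV. exp ((c $ k)\<^sup>2 / 2))" for c :: "real^'n"
    by (subst exp_sum[symmetric]) (auto simp: norm_vec_def L2_set_def sum_nonneg sum_divide_distrib)
  have "sqrt (2 * pi) ^ CARD('n) = (2 * pi) powr (real CARD('n) / 2)"
    by (simp add: powr_half_sqrt[symmetric] powr_realpow[symmetric] powr_powr)
  then have cc: "?c * ?c * sqrt (2 * pi) ^ CARD('n) = ?c"
    by (simp add: powr_add[symmetric])
  have eq: "hermite_fun \<alpha> c * hermite_fun \<beta> c * exp ((norm c)\<^sup>2 / 2) =
      ?c * (\<Prod>k\<in>UNIV. poly (?p k) (c $ k) * std_normal_density (c $ k))" for c
  proof -
    have "hermite_fun \<alpha> c * hermite_fun \<beta> c * exp ((norm c)\<^sup>2 / 2) = ?c * ?c *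
       (\<Prod>k\<in>UNIV. gauss_deriv (\<alpha> $ k) (c $ k) * gauss_deriv (\<beta> $ k) (c $ k) * exp ((c $ k)\<^sup>2 / 2))"
      by (simp add: hermite_fun_eq_prod norm2 prod.distrib mult_ac)
    also have "\<dots> = ?c * ?c * (sqrt (2 * pi) ^ CARD('n) *
       (\<Prod>k\<in>UNIV. poly (?p k) (c $ k) * std_normal_density (c $ k)))"
      by (simp only: gd prod.distrib prod_constant card_UNIV)
    also have "\<dots> = ?c * (\<Prod>k\<in>UNIV. poly (?p k) (c $ k) * std_normal_density (c $ k))"
      by (simp only: mult.assoc[symmetric] cc)
    finally show ?thesis .
  qed
  have "(\<Prod>k\<in>UNIV. gauss_mean (?p k)) = (if \<alpha> = \<beta> then real (mi_fact \<alpha>) else 0)"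
  proof (cases "\<alpha> = \<beta>")
    case False
    then obtain k where "\<alpha> $ k \<noteq> \<beta> $ k" by (auto simp: vec_eq_iff)
    then have "\<exists>k\<in>UNIV. gauss_mean (?p k) = 0" by (auto simp: hermite_orthogonal)
    then show ?thesis using False by (simp add: prod_zero_iff del: hermite.simps)
  qed (simp add: hermite_orthogonal mi_fact_def)
  then have "has_bochner_integral lborel
    (\<lambda>c::real^'n. \<Prod>k\<in>UNIV. poly (?p k) (c $ k) * std_normal_density (c $ k))
    (if \<alpha> = \<beta> then real (mi_fact \<alpha>) else 0)"
    unfolding has_bochner_integral_iff
    using lborel_integral_prod_coords[of "\<lambda>k y. poly (?p k) y * std_normal_density y"] integrable_poly_std_normal
    by (simp add: gauss_mean_def[symmetric] del: poly_mult)
  from has_bochner_integral_mult_right[OF this, of ?c] show ?thesis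
    unfolding eq by (simp split: if_splits)
qed

lemma finite_mi_upto: "finite (mi_upto N :: (nat ^ 'n::finite) set)"
proof -
  have "(mi_upto N :: (nat ^ 'n) set) \<subseteq> vec_lambda ` (PiE UNIV (\<lambda>_. {..N}))"
  proof
    fix \<alpha> :: "nat ^ 'n" assume "\<alpha> \<in> mi_upto N"
    then have *: "(\<Sum>k\<in>UNIV. \<alpha> $ k) \<le> N" by (simp add: mi_upto_def mi_abs_def)
    have "\<alpha> $ k \<le> (\<Sum>k\<in>UNIV. \<alpha> $ k)" for k by (rule member_le_sum) auto
    then have "vec_nth \<alpha> \<in> PiE UNIV (\<lambda>_. {..N})" using * order_trans by (auto simp: PiE_def)
    then show "\<alpha> \<in> vec_lambda ` (PiE UNIV (\<lambda>_. {..N}))"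
      by (metis imageI vec_nth_inverse)
  qed
  then show ?thesis by (rule finite_subset) (auto intro!: finite_imageI finite_PiE)
qed

definition mi_weight :: "nat ^ 'n \<Rightarrow> real" where
  "mi_weight \<alpha> = 1 / real (mi_fact \<alpha>)"

lemma mi_fact_pos: "0 < mi_fact \<alpha>"
  by (auto simp: mi_fact_def)

lemma mi_weight_pos: "0 < mi_weight \<alpha>"
  by (simp add: mi_weight_def mi_fact_pos)

text \<open>The weight is at most \<open>exp (|c|\<^sup>2/2)\<close>, for which the Hermite functions are orthogonal, so
Parseval's identity bounds the norm. Its constant \<open>(2\<pi>)\<close> to the power \<open>-n/2\<close> is at most 1, whatever \<open>N\<close> is.\<close>

lemma L2_weighted_norm_galerkin:
  fixes m :: "nat ^ 'n::finite \<Rightarrow> real \<Rightarrow> real ^ 'n \<Rightarrow> complex"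
  shows "L2_weighted_norm (\<lambda>c. exp (- (norm c)\<^sup>2 / 2)) (galerkin N m t x)
    \<le> ennreal (sqrt (\<Sum>\<alpha>\<in>mi_upto N. mi_weight \<alpha> * (norm (m \<alpha> t x))\<^sup>2))"
proof -
  let ?S = "mi_upto N :: (nat ^ 'n) set"
  let ?H = "hermite_fun :: nat ^ 'n \<Rightarrow> _"
  let ?c = "(2 * pi) powr (- real CARD('n) / 2)"
  define b where "b \<alpha> = mi_weight \<alpha> *\<^sub>R m \<alpha> t x" for \<alpha>
  define e where "e = (\<Sum>\<alpha>\<in>?S. mi_weight \<alpha> * (norm (m \<alpha> t x))\<^sup>2)"
  have e0: "0 \<le> e" unfolding e_def by (intro sum_nonneg mult_nonneg_nonneg) (auto simp: less_imp_le mi_weight_pos)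
  have gal: "galerkin N m t x c = (\<Sum>\<alpha>\<in>?S. ?H \<alpha> c *\<^sub>R b \<alpha>)" for c
    unfolding galerkin_def b_def mi_weight_def
    by (intro sum.cong) (auto simp: scaleR_conv_of_real field_simps)
  have sq: "(norm (galerkin N m t x c))\<^sup>2 * exp ((norm c)\<^sup>2 / 2) =
      (\<Sum>\<alpha>\<in>?S. \<Sum>\<beta>\<in>?S. (?H \<alpha> c * ?H \<beta> c * exp ((norm c)\<^sup>2 / 2)) * (b \<alpha> \<bullet> b \<beta>))" for c
    unfolding gal power2_norm_eq_inner inner_sum_left inner_sum_right sum_distrib_right
    by (intro sum.cong) (auto simp: mult_ac inner_commute)
  have "has_bochner_integral lborel (\<lambda>c. (norm (galerkin N m t x c))\<^sup>2 * exp ((norm c)\<^sup>2 / 2))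
     (\<Sum>\<alpha>\<in>?S. \<Sum>\<beta>\<in>?S. (if \<alpha> = \<beta> then ?c * real (mi_fact \<alpha>) else 0) * (b \<alpha> \<bullet> b \<beta>))"
    unfolding sq
    by (intro has_bochner_integral_sum has_bochner_integral_mult_left hermite_fun_orthogonal)
  also have "(\<Sum>\<alpha>\<in>?S. \<Sum>\<beta>\<in>?S. (if \<alpha> = \<beta> then ?c * real (mi_fact \<alpha>) else 0) * (b \<alpha> \<bullet> b \<beta>)) = ?c * e"
  proof -
    have "(\<Sum>\<beta>\<in>?S. (if \<alpha> = \<beta> then ?c * real (mi_fact \<alpha>) else 0) * (b \<alpha> \<bullet> b \<beta>)) =
        ?c * (mi_weight \<alpha> * (norm (m \<alpha> t x))\<^sup>2)" if "\<alpha> \<in> ?S" for \<alpha>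
    proof -
      have "(\<Sum>\<beta>\<in>?S. (if \<alpha> = \<beta> then ?c * real (mi_fact \<alpha>) else 0) * (b \<alpha> \<bullet> b \<beta>)) =
         (\<Sum>\<beta>\<in>?S. if \<alpha> = \<beta> then ?c * real (mi_fact \<alpha>) * (b \<alpha> \<bullet> b \<alpha>) else 0)"
        by (rule sum.cong) auto
      also have "\<dots> = ?c * real (mi_fact \<alpha>) * (b \<alpha> \<bullet> b \<alpha>)"
        using that by (simp add: finite_mi_upto)
      also have "\<dots> = ?c * (mi_weight \<alpha> * (norm (m \<alpha> t x))\<^sup>2)"
        using mi_fact_pos[of \<alpha>] by (simp add: b_def mi_weight_def power2_norm_eq_inner)
      finally show ?thesis .
    qed
    then show ?thesis by (simp add: e_def sum_distrib_left)
  qed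
  finally have hb: "has_bochner_integral lborel (\<lambda>c. (norm (galerkin N m t x c))\<^sup>2 * exp ((norm c)\<^sup>2 / 2)) (?c * e)" .
  have c1: "?c \<le> 1"
  proof -
    have "?c \<le> (2 * pi) powr 0" using pi_gt3 by (intro powr_mono) auto
    then show ?thesis using pi_gt3 by simp
  qed
  have "(\<integral>\<^sup>+ c. ennreal ((norm (galerkin N m t x c))\<^sup>2 * exp (- (norm c)\<^sup>2 / 2)) \<partial>lborel)
      \<le> (\<integral>\<^sup>+ c. ennreal ((norm (galerkin N m t x c))\<^sup>2 * exp ((norm c)\<^sup>2 / 2)) \<partial>lborel)"
    by (intro nn_integral_mono ennreal_leI mult_left_mono) auto
  also have "\<dots> = ennreal (?c * e)"
    using hb nn_integral_eq_integral[of lborel "\<lambda>c. (norm (galerkin N m t x c))\<^sup>2 * exp ((norm c)\<^sup>2 / 2)"]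
    by (auto simp: has_bochner_integral_iff)
  also have "\<dots> \<le> ennreal e"
    using c1 e0 by (intro ennreal_leI) (simp add: mult_left_le_one_le)
  finally have le: "(\<integral>\<^sup>+ c. ennreal ((norm (galerkin N m t x c))\<^sup>2 * exp (- (norm c)\<^sup>2 / 2)) \<partial>lborel) \<le> ennreal e" .
  then have "(\<integral>\<^sup>+ c. ennreal ((norm (galerkin N m t x c))\<^sup>2 * exp (- (norm c)\<^sup>2 / 2)) \<partial>lborel) \<noteq> \<infinity>"
    by (metis ennreal_less_top infinity_ennreal_def leD)
  with le show ?thesis
    unfolding L2_weighted_norm_def Let_def e_def[symmetric]
    using enn2real_mono[OF le] e0 by (auto intro!: ennreal_leI)
qed

section \<open>The Fourier transform\<close>

definition fourier :: "(real ^ 'n \<Rightarrow> complex) \<Rightarrow> real ^ 'n \<Rightarrow> complex" where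
  "fourier f \<xi> = (\<integral>x. cis (- (\<xi> \<bullet> x)) * f x \<partial>lborel)"

lemma norm_fourier_le: "norm (fourier f \<xi>) \<le> (\<integral>x. norm (f x) \<partial>lborel)"
proof -
  have "norm (fourier f \<xi>) \<le> (\<integral>x. norm (cis (- (\<xi> \<bullet> x)) * f x) \<partial>lborel)"
    unfolding fourier_def by (rule integral_norm_bound)
  then show ?thesis by (simp add: norm_mult)
qed

lemma continuous_on_cis_inner [continuous_intros]:
  "continuous_on S g \<Longrightarrow> continuous_on S (\<lambda>x. cis (g x :: real))"
  unfolding cis_conv_exp by (intro continuous_intros)

text \<open>The integral of the \<open>k\<close>-th partial derivative of the plane wave times \<open>f\<close> vanishes; the product rule
does the rest.\<close>

lemma fourier_partial_deriv:
  fixes f :: "real ^ 'n \<Rightarrow> complex"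
  assumes cont: "continuous_on UNIV f" and cont': "continuous_on UNIV f'"
    and der: "\<And>x. has_partial_deriv f k (f' x) x"
    and van: "\<And>x. x \<notin> cbox a b \<Longrightarrow> f x = 0"
  shows "fourier f' \<xi> = \<i> * of_real (\<xi> $ k) * fourier f \<xi>"
proof -
  have van': "f' x = 0" if "x \<notin> cbox a b" for x
    by (rule partial_deriv_vanishing[OF der van closed_cbox that])
  let ?e = "\<lambda>x. cis (- (\<xi> \<bullet> x))"
  define c where "c = - (\<i> * of_real (\<xi> $ k))"
  have "has_partial_deriv (\<lambda>x. ?e x * f x) k (?e x * f' x + c * (?e x * f x)) x" for x
  proof -
    have "((\<lambda>s. ?e (x + s *\<^sub>R axis k 1)) has_vector_derivative (c * ?e x)) (at 0)"
    proof -
      have "?e (x + s *\<^sub>R axis k 1) = exp (s *\<^sub>R c) * ?e x" for s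
      proof -
        have "\<xi> \<bullet> (x + s *\<^sub>R axis k 1) = s * \<xi> $ k + \<xi> \<bullet> x"
          by (simp add: inner_add_right inner_axis)
        then show ?thesis
          by (simp add: c_def cis_conv_exp scaleR_conv_of_real exp_add[symmetric] algebra_simps)
      qed
      moreover have "((\<lambda>s. exp (s *\<^sub>R c) * ?e x) has_vector_derivative (exp (0 *\<^sub>R c) * c) * ?e x) (at 0)"
        by (intro has_vector_derivative_mult_left exp_scaleR_has_vector_derivative_right)
      ultimately show ?thesis by simp
    qed
    from has_vector_derivative_mult[OF this der[of x, unfolded has_partial_deriv_def]]
    show ?thesis unfolding has_partial_deriv_def by (simp add: mult_ac)
  qed
  then have "(\<integral>x. (?e x * f' x + c * (?e x * f x)) \<partial>lborel) = 0"
    by (rule integral_partial_deriv_eq_0[where a=a and b=b, rotated 2])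
       (auto intro!: continuous_intros cont cont' simp: van)
  moreover have "integrable lborel (\<lambda>x. ?e x * f' x)"
    by (rule integral_vanishing_outside_cbox(1)[where a=a and b=b])
       (auto intro!: continuous_intros cont' simp: van')
  moreover have "integrable lborel (\<lambda>x. c * (?e x * f x))"
    by (rule integral_vanishing_outside_cbox(1)[where a=a and b=b])
       (auto intro!: continuous_intros cont simp: van)
  ultimately have "fourier f' \<xi> + c * fourier f \<xi> = 0"
    unfolding fourier_def by (simp add: Bochner_Integration.integral_add)
  then show ?thesis by (simp add: c_def)
qed

lemma smooth_imp_continuous: "smooth f \<Longrightarrow> continuous_on UNIV f"
  unfolding smooth_def
  by (drule spec[of _ "[]"]) (auto intro!: continuous_at_imp_continuous_on differentiable_imp_continuous_within)

lemma smooth_imp_has_partial_deriv: "smooth f \<Longrightarrow> has_partial_deriv f k (partial_deriv k f x) x"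
  unfolding smooth_def
  by (drule spec[of _ "[]"]) (auto intro: differentiable_has_partial_deriv)

lemma smooth_partial_deriv: "smooth f \<Longrightarrow> smooth (partial_deriv k f)"
  unfolding smooth_def
proof (intro allI)
  fix ks x assume "\<forall>ks x. fold partial_deriv ks f differentiable at x"
  then have "fold partial_deriv (k # ks) f differentiable at x" by blast
  then show "fold partial_deriv ks (partial_deriv k f) differentiable at x" by simp
qed

text \<open>Multiplying the transform by \<open>\<xi>\<^sub>k\<^sup>2\<close> amounts, up to sign, to differentiating the function twice in
direction \<open>k\<close>. Treating the coordinates one at a time yields a bound that is integrable in any dimension.\<close>

lemma fourier_rapid_decay:
  fixes f :: "real ^ 'n::finite \<Rightarrow> complex"
  assumes "smooth f" and "\<And>x. x \<notin> cbox a b \<Longrightarrow> f x = 0"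
  shows "\<exists>K\<ge>0. \<forall>\<xi>. norm (fourier f \<xi>) * (\<Prod>k\<in>UNIV. 1 + (\<xi> $ k)\<^sup>2) \<le> K"
proof -
  have "\<exists>K\<ge>0. \<forall>\<xi>. norm (fourier f \<xi>) * (\<Prod>k\<in>A. 1 + (\<xi> $ k)\<^sup>2) \<le> K"
    if "finite A" "smooth f" "\<And>x. x \<notin> cbox a b \<Longrightarrow> f x = 0" for A and f :: "real ^ 'n \<Rightarrow> complex"
    using that
  proof (induction A arbitrary: f)
    case empty
    then show ?case
      by (intro exI[of _ "\<integral>x. norm (f x) \<partial>lborel"]) (auto simp: norm_fourier_le)
  next
    case (insert k A)
    let ?d = "partial_deriv k"
    have van: "?d g x = 0" if "smooth g" "\<And>x. x \<notin> cbox a b \<Longrightarrow> g x = 0" "x \<notin> cbox a b"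
      for g :: "real ^ 'n \<Rightarrow> complex" and x
      by (rule partial_deriv_vanishing[OF smooth_imp_has_partial_deriv[OF that(1)] that(2) closed_cbox that(3)])
    have fd: "fourier (?d g) \<xi> = \<i> * of_real (\<xi> $ k) * fourier g \<xi>"
      if "smooth g" "\<And>x. x \<notin> cbox a b \<Longrightarrow> g x = 0" for g and \<xi>
      by (rule fourier_partial_deriv[OF _ _ smooth_imp_has_partial_deriv[OF that(1)] that(2)])
         (use that in \<open>auto intro: smooth_imp_continuous smooth_partial_deriv\<close>)
    have s2: "smooth (?d (?d f))" and v2: "\<And>x. x \<notin> cbox a b \<Longrightarrow> ?d (?d f) x = 0"
      using van[OF smooth_partial_deriv[OF insert.prems(1)] van[OF insert.prems]] insert.prems(1)
      by (simp_all add: smooth_partial_deriv)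
    obtain K1 K2 where K1: "K1 \<ge> 0" "\<And>\<xi>. norm (fourier f \<xi>) * (\<Prod>k\<in>A. 1 + (\<xi> $ k)\<^sup>2) \<le> K1"
      and K2: "K2 \<ge> 0" "\<And>\<xi>. norm (fourier (?d (?d f)) \<xi>) * (\<Prod>k\<in>A. 1 + (\<xi> $ k)\<^sup>2) \<le> K2"
      using insert.IH[OF insert.prems] insert.IH[OF s2 v2] by metis
    have "norm (fourier (?d (?d f)) \<xi>) = (\<xi> $ k)\<^sup>2 * norm (fourier f \<xi>)" for \<xi>
      using insert.prems van
      by (simp add: fd smooth_partial_deriv norm_mult power2_eq_square)
    then have "norm (fourier f \<xi>) * (\<Prod>k\<in>insert k A. 1 + (\<xi> $ k)\<^sup>2) \<le> K1 + K2" for \<xi>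
      using add_mono[OF K1(2)[of \<xi>] K2(2)[of \<xi>]] insert.hyps by (simp add: algebra_simps)
    with K1 K2 show ?case by (intro exI[of _ "K1 + K2"]) auto
  qed
  from this[of UNIV f] assms show ?thesis by simp
qed

lemma integrable_prod_inverse_1_plus_square:
  "integrable lborel (\<lambda>\<xi>::real^'n::finite. inverse (\<Prod>k\<in>UNIV. 1 + (\<xi> $ k)\<^sup>2))"
proof -
  have "integrable lborel (\<lambda>x::real. inverse (1 + x\<^sup>2))"
    using integrable_inverse_1_plus_square by (simp add: set_integrable_def)
  then show ?thesis
    using lborel_integral_prod_coords(1)[of "\<lambda>k x. inverse (1 + x\<^sup>2)"] by (simp add: prod_inversef[symmetric] o_def)
qed

lemma exp_norm_square_eq_prod:
  "exp (c * (norm (x::real^'n::finite))\<^sup>2) = (\<Prod>k\<in>UNIV. exp (c * (x $ k)\<^sup>2))"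
  by (subst exp_sum[symmetric]) (auto simp: norm_vec_def L2_set_def sum_nonneg sum_distrib_left)

lemma has_bochner_integral_gaussian:
  assumes "a > 0"
  shows "has_bochner_integral lborel (\<lambda>\<xi>::real^'n::finite. exp (- a * (norm \<xi>)\<^sup>2)) (sqrt (pi / a) ^ CARD('n))"
proof -
  let ?s = "sqrt (1 / (2 * a))"
  have eq: "exp (- a * x\<^sup>2) = sqrt (pi / a) * normal_density 0 ?s x" for x
    using assms by (simp add: normal_density_def real_sqrt_divide real_sqrt_mult field_simps)
  have s: "0 < ?s" using assms by simp
  have "has_bochner_integral lborel (\<lambda>x. exp (- a * x\<^sup>2)) (sqrt (pi / a) * 1)"
    unfolding eq
    using integrable_normal_density[OF s, of 0] integral_normal_density[OF s, of 0]
    by (intro has_bochner_integral_mult_right) (auto simp only: has_bochner_integral_iff)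
  then show ?thesis
    unfolding exp_norm_square_eq_prod
    using lborel_integral_prod_coords[of "\<lambda>k::'n. \<lambda>x. exp (- a * x\<^sup>2)"]
    by (simp add: has_bochner_integral_iff)
qed

lemma gaussian_fourier_real:
  "has_bochner_integral lborel (\<lambda>x. cis (z * x) * of_real (std_normal_density x)) (of_real (exp (- z\<^sup>2 / 2)))"
proof -
  have "integrable lborel (\<lambda>x. cis (z * x) * complex_of_real (std_normal_density x))"
  proof (rule Bochner_Integration.integrable_bound)
    show "integrable lborel std_normal_density" by simp
    show "(\<lambda>x. cis (z * x) * complex_of_real (std_normal_density x)) \<in> borel_measurable lborel"
      by (intro borel_measurable_times borel_measurable_of_real) (auto intro!: borel_measurable_continuous_onI continuous_intros)
  qed (auto simp: norm_mult)
  moreover have "char std_normal_distribution z = (\<integral>x. cis (z * x) * complex_of_real (std_normal_density x) \<partial>lborel)"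
  proof -
    have "char std_normal_distribution z = (\<integral>x. std_normal_density x *\<^sub>R iexp (z * x) \<partial>lborel)"
      unfolding char_def by (subst integral_density) auto
    then show ?thesis by (simp add: scaleR_conv_of_real cis_conv_exp mult.commute)
  qed
  ultimately show ?thesis
    by (simp add: has_bochner_integral_iff char_std_normal_distribution)
qed

definition std_gauss :: "real ^ 'n \<Rightarrow> real" where
  "std_gauss x = (\<Prod>k\<in>UNIV. std_normal_density (x $ k))"

lemma std_gauss_nonneg: "0 \<le> std_gauss x"
  unfolding std_gauss_def by (intro prod_nonneg) auto

lemma std_gauss_conv_exp:
  "std_gauss (x::real^'n::finite) = (1 / sqrt (2 * pi)) ^ CARD('n) * exp (- 1 / 2 * (norm x)\<^sup>2)"
  unfolding exp_norm_square_eq_prod std_gauss_def std_normal_density_def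
  by (simp add: prod.distrib prod_dividef power_one_over)

lemma has_bochner_integral_std_gauss:
  "has_bochner_integral lborel (std_gauss :: real ^ 'n::finite \<Rightarrow> real) 1"
  using lborel_integral_prod_coords[of "\<lambda>k::'n. std_normal_density"]
  by (simp add: std_gauss_def[abs_def] has_bochner_integral_iff)

lemma continuous_on_std_gauss [continuous_intros]:
  "continuous_on S f \<Longrightarrow> continuous_on S (\<lambda>x. std_gauss (f x :: real ^ 'n::finite))"
  unfolding std_gauss_conv_exp by (intro continuous_intros)

text \<open>The one-dimensional case is the characteristic function of the standard normal distribution.\<close>

lemma std_gauss_fourier:
  "(\<integral>\<xi>. cis (z \<bullet> \<xi>) * of_real (std_gauss \<xi>) \<partial>lborel) =
    of_real (sqrt (2 * pi) ^ CARD('n) * std_gauss (z :: real ^ 'n::finite))"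
proof -
  let ?f = "\<lambda>k x. cis (z $ k * x) * complex_of_real (std_normal_density x)"
  have eq: "cis (z \<bullet> \<xi>) * of_real (std_gauss \<xi>) = (\<Prod>k\<in>UNIV. ?f k (\<xi> $ k))" for \<xi>
  proof -
    have "cis (z \<bullet> \<xi>) = (\<Prod>k\<in>UNIV. cis (z $ k * \<xi> $ k))"
      unfolding cis_conv_exp inner_vec_def by (simp add: exp_sum sum_distrib_left)
    then show ?thesis by (simp add: std_gauss_def prod.distrib)
  qed
  have "(\<integral>\<xi>. (\<Prod>k\<in>UNIV. ?f k (\<xi> $ k)) \<partial>lborel) = (\<Prod>k\<in>UNIV. \<integral>x. ?f k x \<partial>lborel)"
    by (rule lborel_integral_prod_coords) (use gaussian_fourier_real has_bochner_integral_iff in blast)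
  also have "\<dots> = (\<Prod>k\<in>UNIV. complex_of_real (exp (- (z $ k)\<^sup>2 / 2)))"
    by (intro prod.cong refl has_bochner_integral_integral_eq[OF gaussian_fourier_real])
  also have "\<dots> = of_real (sqrt (2 * pi) ^ CARD('n) * std_gauss z)"
    by (simp add: std_gauss_def std_normal_density_def prod_dividef)
  finally show ?thesis unfolding eq .
qed

text \<open>The inversion integral with a Gaussian cut-off of width \<open>1/s\<close>. By Fubini's theorem the inner integral
becomes the transform of a Gaussian, and so the regularised integral is an average of \<open>g\<close> over a
Gaussian of width \<open>s\<close> around \<open>x\<close>.\<close>

lemma fourier_gaussian_regularised:
  fixes g :: "real ^ 'n::finite \<Rightarrow> complex"
  assumes cont: "continuous_on UNIV g" and van: "\<And>x. x \<notin> cbox a b \<Longrightarrow> g x = 0" and s: "s > 0"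
  shows "(\<integral>\<xi>. cis (\<xi> \<bullet> x) * of_real (std_gauss (s *\<^sub>R \<xi>)) * fourier g \<xi> \<partial>lborel) =
     of_real (sqrt (2 * pi) ^ CARD('n)) * (\<integral>u. g (x - s *\<^sub>R u) * of_real (std_gauss u) \<partial>lborel)"
proof -
  define F where "F \<xi> y = cis (\<xi> \<bullet> (x - y)) * complex_of_real (std_gauss (s *\<^sub>R \<xi>)) * g y" for \<xi> y
  have contF: "continuous_on UNIV (\<lambda>(\<xi>, y). F \<xi> y)"
    unfolding F_def case_prod_beta
    by (intro continuous_intros continuous_on_compose2[OF cont]) auto
  have mF: "(\<lambda>(\<xi>, y). F \<xi> y) \<in> borel_measurable (lborel \<Otimes>\<^sub>M lborel)"
    using borel_measurable_continuous_onI[OF contF] by (simp add: lborel_prod)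
  have intg: "integrable lborel g"
    by (rule integral_vanishing_outside_cbox(1)[OF cont van])
  have normF: "norm (F \<xi> y) = std_gauss (s *\<^sub>R \<xi>) * norm (g y)" for \<xi> y
    by (simp add: F_def norm_mult std_gauss_nonneg)
  have intG: "integrable lborel (\<lambda>\<xi>::real^'n. std_gauss (s *\<^sub>R \<xi>))"
  proof -
    have "std_gauss (s *\<^sub>R \<xi>) = (1 / sqrt (2 * pi)) ^ CARD('n) * exp (- (s\<^sup>2 / 2) * (norm \<xi>)\<^sup>2)" for \<xi> :: "real^'n"
      by (simp add: std_gauss_conv_exp power_mult_distrib)
    then show ?thesis
      using has_bochner_integral_gaussian[where 'n='n, of "s\<^sup>2 / 2"] s by (simp add: has_bochner_integral_iff)
  qed
  have int: "integrable (lborel \<Otimes>\<^sub>M lborel) (\<lambda>(\<xi>, y). F \<xi> y)"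
  proof (rule lborel_pair.Fubini_integrable[OF mF])
    show "integrable lborel (\<lambda>\<xi>. \<integral>y. norm ((\<lambda>(\<xi>, y). F \<xi> y) (\<xi>, y)) \<partial>lborel)"
      using intG intg by (simp add: normF)
    show "AE \<xi> in lborel. integrable lborel (\<lambda>y. (\<lambda>(\<xi>, y). F \<xi> y) (\<xi>, y))"
    proof (intro AE_I2)
      fix \<xi> :: "real^'n"
      have "continuous_on UNIV (F \<xi>)"
        unfolding F_def by (intro continuous_intros cont)
      then show "integrable lborel (\<lambda>y. (\<lambda>(\<xi>, y). F \<xi> y) (\<xi>, y))"
        by simp (rule integral_vanishing_outside_cbox(1)[where a=a and b=b], simp_all add: F_def van)
    qed
  qed
  have "(\<integral>y. F \<xi> y \<partial>lborel) = cis (\<xi> \<bullet> x) * of_real (std_gauss (s *\<^sub>R \<xi>)) * fourier g \<xi>" for \<xi>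
  proof -
    have "F \<xi> y = cis (\<xi> \<bullet> x) * of_real (std_gauss (s *\<^sub>R \<xi>)) * (cis (- (\<xi> \<bullet> y)) * g y)" for y
    proof -
      have "cis (\<xi> \<bullet> (x - y)) = cis (\<xi> \<bullet> x) * cis (- (\<xi> \<bullet> y))"
        by (simp add: cis_mult inner_diff_right)
      then show ?thesis by (simp add: F_def mult_ac)
    qed
    then show ?thesis by (simp add: fourier_def)
  qed
  then have "(\<integral>\<xi>. cis (\<xi> \<bullet> x) * of_real (std_gauss (s *\<^sub>R \<xi>)) * fourier g \<xi> \<partial>lborel) =
      (\<integral>\<xi>. \<integral>y. F \<xi> y \<partial>lborel \<partial>lborel)" by simp
  also have "\<dots> = (\<integral>y. \<integral>\<xi>. F \<xi> y \<partial>lborel \<partial>lborel)"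
    by (rule lborel_pair.Fubini_integral[symmetric]) (rule int)
  also have "\<dots> = (\<integral>y. of_real (sqrt (2 * pi) ^ CARD('n) * (1 / s) ^ CARD('n) * std_gauss ((x - y) /\<^sub>R s)) * g y \<partial>lborel)"
  proof (intro Bochner_Integration.integral_cong refl)
    fix y
    have "(\<integral>\<xi>. cis (\<xi> \<bullet> (x - y)) * complex_of_real (std_gauss (s *\<^sub>R \<xi>)) \<partial>lborel) =
       \<bar>1 / s\<bar> ^ DIM(real^'n) *\<^sub>R (\<integral>\<xi>. cis ((0 + (1 / s) *\<^sub>R \<xi>) \<bullet> (x - y)) * complex_of_real (std_gauss (s *\<^sub>R (0 + (1 / s) *\<^sub>R \<xi>))) \<partial>lborel)"
      by (rule integral_lborel_affine) (use s in \<open>auto intro!: borel_measurable_continuous_onI continuous_intros\<close>)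
    also have "\<dots> = (1 / s) ^ CARD('n) *\<^sub>R (\<integral>\<xi>. cis (((x - y) /\<^sub>R s) \<bullet> \<xi>) * complex_of_real (std_gauss \<xi>) \<partial>lborel)"
      using s by (simp add: inner_commute divide_inverse_commute)
    also have "\<dots> = of_real (sqrt (2 * pi) ^ CARD('n) * (1 / s) ^ CARD('n) * std_gauss ((x - y) /\<^sub>R s))"
      unfolding std_gauss_fourier by (simp add: scaleR_conv_of_real)
    finally show "(\<integral>\<xi>. F \<xi> y \<partial>lborel) = of_real (sqrt (2 * pi) ^ CARD('n) * (1 / s) ^ CARD('n) * std_gauss ((x - y) /\<^sub>R s)) * g y"
      unfolding F_def by simp
  qed
  also have "\<dots> = \<bar>- s\<bar> ^ DIM(real^'n) *\<^sub>R
      (\<integral>u. of_real (sqrt (2 * pi) ^ CARD('n) * (1 / s) ^ CARD('n) * std_gauss ((x - (x + (- s) *\<^sub>R u)) /\<^sub>R s)) * g (x + (- s) *\<^sub>R u) \<partial>lborel)"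
    by (rule integral_lborel_affine) (use s in \<open>auto intro!: borel_measurable_continuous_onI continuous_intros cont\<close>)
  also have "\<dots> = \<bar>- s\<bar> ^ DIM(real^'n) *\<^sub>R
      (of_real (sqrt (2 * pi) ^ CARD('n) * (1 / s) ^ CARD('n)) * (\<integral>u. g (x - s *\<^sub>R u) * of_real (std_gauss u) \<partial>lborel))"
    using s by (subst integral_mult_right_zero[symmetric]) (simp add: mult_ac)
  also have "\<dots> = of_real (sqrt (2 * pi) ^ CARD('n)) * (\<integral>u. g (x - s *\<^sub>R u) * of_real (std_gauss u) \<partial>lborel)"
    using s by (simp add: scaleR_conv_of_real power_one_over)
  finally show ?thesis .
qed

text \<open>In the limit \<open>s \<rightarrow> 0\<close> the Gaussian averages tend to \<open>g x\<close>, while the regularised inversion integrals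
stay below the integral of \<open>h\<close>. The normalising constant of the inversion formula, at most 1, is dropped.\<close>

lemma sup_le_integral_fourier:
  fixes g :: "real ^ 'n::finite \<Rightarrow> complex"
  assumes cont: "continuous_on UNIV g" and van: "\<And>x. x \<notin> cbox a b \<Longrightarrow> g x = 0"
    and h: "integrable lborel h" "\<And>\<xi>. norm (fourier g \<xi>) \<le> h \<xi>"
  shows "norm (g x) \<le> (\<integral>\<xi>. h \<xi> \<partial>lborel)"
proof -
  let ?c = "sqrt (2 * pi) ^ CARD('n)"
  let ?I = "\<lambda>s. \<integral>u. g (x - s *\<^sub>R u) * of_real (std_gauss u) \<partial>lborel"
  have c1: "1 \<le> ?c" using pi_gt3 by (intro one_le_power) (simp add: real_le_rsqrt)
  have G1: "std_gauss \<xi> \<le> 1" for \<xi> :: "real^'n"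
  proof -
    have "(1 / sqrt (2 * pi)) ^ CARD('n) * exp (- 1 / 2 * (norm \<xi>)\<^sup>2) \<le> 1 * 1"
      using c1 by (intro mult_mono) (auto simp: power_one_over)
    then show ?thesis unfolding std_gauss_conv_exp by simp
  qed
  have h0: "0 \<le> h \<xi>" for \<xi> using h(2)[of \<xi>] norm_ge_zero order_trans by blast
  have bound: "norm (?I s) \<le> (\<integral>\<xi>. h \<xi> \<partial>lborel)" if s: "s > 0" for s
  proof -
    let ?J = "\<integral>\<xi>. cis (\<xi> \<bullet> x) * complex_of_real (std_gauss (s *\<^sub>R \<xi>)) * fourier g \<xi> \<partial>lborel"
    have "norm ?J \<le> (\<integral>\<xi>. norm (cis (\<xi> \<bullet> x) * complex_of_real (std_gauss (s *\<^sub>R \<xi>)) * fourier g \<xi>) \<partial>lborel)"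
      by (rule integral_norm_bound)
    also have "\<dots> \<le> (\<integral>\<xi>. h \<xi> \<partial>lborel)"
    proof (rule integral_mono'[OF h(1) _ h0])
      show "norm (cis (\<xi> \<bullet> x) * complex_of_real (std_gauss (s *\<^sub>R \<xi>)) * fourier g \<xi>) \<le> h \<xi>" for \<xi>
      proof -
        have "std_gauss (s *\<^sub>R \<xi>) * norm (fourier g \<xi>) \<le> 1 * h \<xi>"
          using G1 h by (intro mult_mono) auto
        then show ?thesis by (simp add: norm_mult std_gauss_nonneg)
      qed
    qed
    finally have "norm ?J \<le> (\<integral>\<xi>. h \<xi> \<partial>lborel)" .
    moreover have "?J = of_real ?c * ?I s"
      by (rule fourier_gaussian_regularised[OF cont van s])
    ultimately have "norm (of_real ?c * ?I s) \<le> (\<integral>\<xi>. h \<xi> \<partial>lborel)" by simp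
    moreover have "norm (of_real ?c * ?I s) = ?c * norm (?I s)" by (simp add: norm_mult norm_power)
    moreover have "1 * norm (?I s) \<le> ?c * norm (?I s)" using c1 by (intro mult_right_mono) auto
    ultimately show ?thesis by linarith
  qed
  obtain B where B: "\<And>y. norm (g y) \<le> B"
  proof -
    have "compact (g ` cbox a b)"
      by (intro compact_continuous_image) (use cont in \<open>auto intro: continuous_on_subset\<close>)
    then obtain B where "\<And>y. y \<in> cbox a b \<Longrightarrow> norm (g y) \<le> B"
      by (meson bounded_iff compact_imp_bounded imageI)
    then have "norm (g y) \<le> max B 0" for y using van[of y] by (cases "y \<in> cbox a b") (auto simp: max.coboundedI1)
    then show ?thesis using that by blast
  qed
  let ?s = "\<lambda>i. 1 / real (Suc i)"
  have "(\<lambda>i. ?I (?s i)) \<longlonglongrightarrow> (\<integral>u. g x * of_real (std_gauss (u::real^'n)) \<partial>lborel)"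
  proof (rule integral_dominated_convergence[where w="\<lambda>u. B * std_gauss u"])
    show "(\<lambda>u. g x * complex_of_real (std_gauss u)) \<in> borel_measurable lborel"
      by (auto intro!: borel_measurable_continuous_onI continuous_intros)
    show "(\<lambda>u. g (x - ?s i *\<^sub>R u) * complex_of_real (std_gauss u)) \<in> borel_measurable lborel" for i
      by (auto intro!: borel_measurable_continuous_onI continuous_intros continuous_on_compose2[OF cont])
    show "integrable lborel (\<lambda>u::real^'n. B * std_gauss u)"
      using has_bochner_integral_std_gauss by (auto simp: has_bochner_integral_iff)
    show "AE u in lborel. (\<lambda>i. g (x - ?s i *\<^sub>R u) * complex_of_real (std_gauss u)) \<longlonglongrightarrow> g x * complex_of_real (std_gauss u)"
    proof (intro AE_I2 tendsto_mult tendsto_const)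
      fix u
      have "(\<lambda>i. x - ?s i *\<^sub>R u) \<longlonglongrightarrow> x - 0 *\<^sub>R u"
        by (intro tendsto_intros) (rule LIMSEQ_Suc[OF lim_1_over_n])
      moreover have "isCont g x" using cont by (simp add: continuous_on_eq_continuous_at)
      ultimately show "(\<lambda>i. g (x - ?s i *\<^sub>R u)) \<longlonglongrightarrow> g x"
        using isCont_tendsto_compose by fastforce
    qed
    show "AE u in lborel. norm (g (x - ?s i *\<^sub>R u) * complex_of_real (std_gauss u)) \<le> B * std_gauss u" for i
      by (intro AE_I2) (auto simp: norm_mult std_gauss_nonneg intro!: mult_right_mono B)
  qed
  also have "(\<integral>u. g x * complex_of_real (std_gauss (u::real^'n)) \<partial>lborel) = g x"
    using has_bochner_integral_std_gauss[where 'n='n] by (simp add: has_bochner_integral_iff)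
  finally have "(\<lambda>i. norm (?I (?s i))) \<longlonglongrightarrow> norm (g x)" by (rule tendsto_norm)
  then show ?thesis
    by (rule LIMSEQ_le_const2) (auto intro!: exI[of _ 0] bound)
qed

section \<open>Finite speed of propagation\<close>

lemma DERIV_pos_part_square:
  "((\<lambda>s. (max 0 s)\<^sup>2) has_real_derivative 2 * max 0 s) (at (s::real))"
proof (cases s "0::real" rule: linorder_cases)
  case less
  have "((\<lambda>s. (max 0 s)\<^sup>2) has_real_derivative 0) (at s)"
    by (rule has_field_derivative_transform_within_open[OF DERIV_const[of 0], where S="{..<0}"])
       (use less in \<open>auto simp: max_def\<close>)
  then show ?thesis using less by (simp add: max_def)
next
  case greater
  have "((\<lambda>s. s\<^sup>2) has_real_derivative 2 * s) (at s)"
    by (auto intro!: derivative_eq_intros)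
  then have "((\<lambda>s. (max 0 s)\<^sup>2) has_real_derivative 2 * s) (at s)"
    by (rule has_field_derivative_transform_within_open[where S="{0<..}"])
       (use greater in \<open>auto simp: max_def\<close>)
  then show ?thesis using greater by (simp add: max_def)
next
  case equal
  have "((\<lambda>h. ((max 0 h)\<^sup>2 - (max 0 0)\<^sup>2) / (h - 0)) \<longlongrightarrow> (0::real)) (at 0)"
  proof (rule tendsto_sandwich[where f="\<lambda>_. 0" and h="\<lambda>h. max 0 h"])
    show "((\<lambda>h::real. max 0 h) \<longlongrightarrow> 0) (at 0)"
      using tendsto_max[OF tendsto_const[of "0::real"] tendsto_ident_at[of "0::real" UNIV]] by simp
  qed (auto simp: max_def power2_eq_square intro!: always_eventually)
  then show ?thesis unfolding equal has_field_derivative_iff by simp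
qed

lemma has_partial_deriv_mult:
  fixes f g :: "real ^ 'n \<Rightarrow> real"
  assumes "has_partial_deriv f k f' x" "has_partial_deriv g k g' x"
  shows "has_partial_deriv (\<lambda>x. f x * g x) k (f x * g' + f' * g x) x"
  using has_vector_derivative_mult[OF assms[unfolded has_partial_deriv_def]]
  by (simp add: has_partial_deriv_def)

text \<open>The density \<open>e\<close> is transported by the flux \<open>q\<close> with speed at most \<open>L\<close> in each coordinate. It is integrated against
\<open>\<eta> = (max 0 (R - c t - \<rho> x))\<^sup>2\<close>, where \<open>\<rho>\<close> is a smooth substitute for the distance to \<open>x\<^sub>0\<close>
with gradient at most 1 and \<open>c = n L\<close>. The support of \<open>\<eta>\<close> shrinks at least as fast as the density
can move in, so the integral does not increase in time. It starts at zero because initially the support avoids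
the ball of radius \<open>R\<^sub>0\<close>, and \<open>\<eta>\<close> is still positive at the point \<open>(T, x\<^sub>0)\<close>.\<close>

lemma finite_propagation_speed:
  fixes e et :: "real \<Rightarrow> real ^ 'n::finite \<Rightarrow> real" and q qx :: "'n \<Rightarrow> real \<Rightarrow> real ^ 'n \<Rightarrow> real"
  assumes e: "continuous_on ({0..} \<times> UNIV) (\<lambda>(t, x). e t x)" "\<And>t x. t \<ge> 0 \<Longrightarrow> 0 \<le> e t x"
    and et: "\<And>t x. t > 0 \<Longrightarrow> ((\<lambda>s. e s x) has_vector_derivative et t x) (at t)"
      "continuous_on ({0<..} \<times> UNIV) (\<lambda>(t, x). et t x)"
    and q: "\<And>k t. t > 0 \<Longrightarrow> continuous_on UNIV (q k t)" "\<And>k t. t > 0 \<Longrightarrow> continuous_on UNIV (qx k t)"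
      "\<And>k t x. t > 0 \<Longrightarrow> has_partial_deriv (q k t) k (qx k t x) x"
    and L: "L \<ge> 0" "\<And>k t x. t > 0 \<Longrightarrow> \<bar>q k t x\<bar> \<le> L * e t x"
    and le: "\<And>t x. t > 0 \<Longrightarrow> et t x + (\<Sum>k\<in>UNIV. qx k t x) \<le> 0"
    and init: "\<And>x. norm x > R\<^sub>0 \<Longrightarrow> e 0 x = 0"
    and T: "T \<ge> 0" and x0: "norm x0 > R\<^sub>0 + 1 + real CARD('n) * L * T"
  shows "e T x0 = 0"
proof -
  define R where "R = norm x0 - R\<^sub>0"
  define c where "c = real CARD('n) * L"
  define \<rho> where "\<rho> x = sqrt (1 + (norm (x - x0))\<^sup>2)" for x
  \<comment> \<open>Since \<open>\<rho> x0 = 1\<close>, positivity of \<open>a T x0\<close> accounts for the summand 1 in the bound on \<open>norm x0\<close>.\<close>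
  define a where "a t x = R - c * t - \<rho> x" for t x
  define \<eta> where "\<eta> t x = (max 0 (a t x))\<^sup>2" for t x
  define \<eta>t where "\<eta>t t x = 2 * max 0 (a t x) * (- c)" for t x
  define \<eta>x where "\<eta>x k t x = 2 * max 0 (a t x) * (- ((x - x0) $ k / \<rho> x))" for k t x
  have c0: "0 \<le> c" using L by (simp add: c_def)
  have \<rho>: "norm (x - x0) \<le> \<rho> x" "0 < \<rho> x" for x
    by (auto simp: \<rho>_def real_le_rsqrt add_pos_nonneg)
  have \<rho>_comp: "\<bar>(x - x0) $ k\<bar> / \<rho> x \<le> 1" for x k
    using component_le_norm_cart[of "x - x0" k] \<rho>[of x] by (simp add: divide_le_eq)
  have DERIV_\<eta>t: "((\<lambda>t. \<eta> t x) has_real_derivative \<eta>t t x) (at t)" for t x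
    unfolding \<eta>_def \<eta>t_def
    by (rule DERIV_chain2[OF DERIV_pos_part_square]) (auto simp: a_def intro!: derivative_eq_intros)
  have D\<eta>x: "has_partial_deriv (\<eta> t) k (\<eta>x k t x) x" for k t x
  proof -
    let ?y = "x - x0"
    have exp: "(norm (x + s *\<^sub>R axis k 1 - x0))\<^sup>2 = (norm ?y)\<^sup>2 + 2 * s * (?y $ k) + s\<^sup>2" for s
    proof -
      have "x + s *\<^sub>R axis k 1 - x0 = ?y + s *\<^sub>R axis k 1" by simp
      then show ?thesis
        by (simp only: power2_norm_eq_inner inner_add_left inner_add_right inner_scaleR_left inner_scaleR_right
            inner_axis inner_commute[of "axis k 1" ?y] axis_nth)
           (simp add: inner_axis power2_eq_square algebra_simps)
    qed
    have alg: "inverse r / 2 * (2 * y) = y / r" for r y :: real by (cases "r = 0") (simp_all add: field_simps)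
    have "((\<lambda>s. sqrt (1 + ((norm ?y)\<^sup>2 + 2 * s * (?y $ k) + s\<^sup>2))) has_real_derivative ?y $ k / \<rho> x) (at 0)"
    proof (rule DERIV_cong)
      let ?g = "\<lambda>s. 1 + ((norm ?y)\<^sup>2 + 2 * s * (?y $ k) + s\<^sup>2)"
      have "0 < 1 + (norm ?y)\<^sup>2" by (simp add: add_pos_nonneg)
      from DERIV_real_sqrt[OF this]
      have d: "(sqrt has_real_derivative inverse (sqrt (1 + (norm ?y)\<^sup>2)) / 2) (at (?g 0))" by simp
      have "(?g has_real_derivative 2 * (?y $ k)) (at 0)"
        by (auto intro!: derivative_eq_intros)
      from DERIV_chain2[OF d this]
      show "((\<lambda>s. sqrt (?g s)) has_real_derivative
          inverse (sqrt (1 + (norm ?y)\<^sup>2)) / 2 * (2 * (?y $ k))) (at 0)" .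
    qed (simp only: \<rho>_def alg)
    from DERIV_diff[OF DERIV_const[of "R - c * t"] this]
    have da: "((\<lambda>s. a t (x + s *\<^sub>R axis k 1)) has_real_derivative - (?y $ k / \<rho> x)) (at 0)"
      unfolding a_def \<rho>_def exp by simp
    have "((\<lambda>s. (max 0 s)\<^sup>2) has_real_derivative 2 * max 0 (a t x)) (at (a t (x + 0 *\<^sub>R axis k 1)))"
      using DERIV_pos_part_square[of "a t x"] by simp
    from DERIV_chain2[where f="\<lambda>s. (max 0 s)\<^sup>2" and g="\<lambda>s. a t (x + s *\<^sub>R axis k 1)" and x=0, OF this da]
    have "((\<lambda>s. \<eta> t (x + s *\<^sub>R axis k 1)) has_real_derivative \<eta>x k t x) (at 0)"
      unfolding \<eta>_def \<eta>x_def .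
    then show ?thesis
      unfolding has_partial_deriv_def has_real_derivative_iff_has_vector_derivative .
  qed
  have cont_a [continuous_intros]: "continuous_on A (\<lambda>z. a (f z) (g z))"
    if "continuous_on A f" "continuous_on A g" for A :: "'z::topological_space set" and f g
    unfolding a_def \<rho>_def by (intro continuous_intros that)
  have cont_\<eta> [continuous_intros]: "continuous_on A (\<lambda>z. \<eta> (f z) (g z))" "continuous_on A (\<lambda>z. \<eta>t (f z) (g z))"
    "continuous_on A (\<lambda>z. \<eta>x k (f z) (g z))"
    if "continuous_on A f" "continuous_on A g" for A :: "'z::topological_space set" and f g k
  proof -
    have "continuous_on A (\<lambda>z. \<rho> (g z))" unfolding \<rho>_def by (intro continuous_intros that)
    moreover have "\<rho> (g z) \<noteq> 0" for z using \<rho>(2)[of "g z"] by simp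
    ultimately show "continuous_on A (\<lambda>z. \<eta> (f z) (g z))" "continuous_on A (\<lambda>z. \<eta>t (f z) (g z))"
      "continuous_on A (\<lambda>z. \<eta>x k (f z) (g z))"
      unfolding \<eta>_def \<eta>t_def \<eta>x_def by (auto intro!: continuous_intros that)
  qed
  obtain b where b: "cball x0 (max R 0) \<subseteq> box (- b) b"
    using bounded_subset_box_symmetric[OF bounded_cball] .
  have van_a: "max 0 (a t x) = 0" if "t \<ge> 0" "x \<notin> cbox (- b) b" for t x
  proof -
    have "x \<notin> cball x0 (max R 0)" using b that(2) box_subset_cbox by blast
    then have "R < norm (x - x0)" by (simp add: dist_norm norm_minus_commute)
    moreover have "0 \<le> c * t" using c0 that by simp
    ultimately show ?thesis using \<rho>(1)[of x] by (simp add: a_def max_def)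
  qed
  have cont_et: "continuous_on UNIV (\<lambda>x. et t x)" if "t > 0" for t
  proof -
    have "continuous_on UNIV (\<lambda>x. (\<lambda>(t, x). et t x) (t, x))"
      by (rule continuous_on_compose2[OF et(2)]) (use that in \<open>auto intro!: continuous_intros\<close>)
    then show ?thesis by simp
  qed
  have cont_e: "continuous_on UNIV (\<lambda>x. e t x)" if "t \<ge> 0" for t
  proof -
    have "continuous_on UNIV (\<lambda>x. (\<lambda>(t, x). e t x) (t, x))"
      by (rule continuous_on_compose2[OF e(1)]) (use that in \<open>auto intro!: continuous_intros\<close>)
    then show ?thesis by simp
  qed
  define W where "W t = (\<integral>x. \<eta> t x * e t x \<partial>lborel)" for t
  have contW: "continuous_on {0..} W"
    unfolding W_def
  proof (rule continuous_on_integral_vanishing)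
    have "continuous_on ({0..} \<times> UNIV) (\<lambda>z. \<eta> (fst z) (snd z) * (\<lambda>(t, x). e t x) z)"
      by (intro continuous_intros e(1))
    then show "continuous_on ({0..} \<times> UNIV) (\<lambda>(t, x). \<eta> t x * e t x)"
      by (simp add: case_prod_beta)
    show "\<eta> t x * e t x = 0" if "t \<in> {0..}" "x \<notin> cbox (- b) b" for t x
      using van_a that by (simp add: \<eta>_def)
  qed
  have DW: "\<exists>y. (W has_real_derivative y) (at t) \<and> y \<le> 0" if t: "t > 0" for t
  proof -
    let ?f = "\<lambda>t x. \<eta> t x * et t x + \<eta>t t x * e t x"
    let ?g = "\<lambda>k x. \<eta> t x * qx k t x + \<eta>x k t x * q k t x"
    have "(W has_vector_derivative (\<integral>x. ?f t x \<partial>lborel)) (at t)"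
      unfolding W_def
    proof (rule has_vector_derivative_integral_vanishing[where U="{0<..}"])
      show "continuous_on UNIV (\<lambda>x. \<eta> s x * e s x)" if "s \<in> {0<..}" for s
        using that by (intro continuous_intros cont_e) auto
      show "((\<lambda>s. \<eta> s x * e s x) has_vector_derivative ?f s x) (at s)" if "s \<in> {0<..}" for s x
        using has_vector_derivative_mult[OF DERIV_\<eta>t[of x s, unfolded has_real_derivative_iff_has_vector_derivative] et(1)] that
        by simp
      have "continuous_on ({0<..} \<times> UNIV) (\<lambda>z. \<eta> (fst z) (snd z) * (\<lambda>(t, x). et t x) z + \<eta>t (fst z) (snd z) * (\<lambda>(t, x). e t x) z)"
        by (intro continuous_intros et(2) continuous_on_subset[OF e(1)]) auto
      then show "continuous_on ({0<..} \<times> UNIV) (\<lambda>(t, x). ?f t x)"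
        by (simp add: case_prod_beta)
      show "\<eta> s x * e s x = 0" if "s \<in> {0<..}" "x \<notin> cbox (- b) b" for s x
        using van_a that by (simp add: \<eta>_def)
    qed (use t in auto)
    moreover have "(\<integral>x. ?f t x \<partial>lborel) \<le> 0"
    proof -
      have intg: "integrable lborel (?g k)" "(\<integral>x. ?g k x \<partial>lborel) = 0" for k
      proof -
        show "integrable lborel (?g k)"
        proof (rule integral_vanishing_outside_cbox(1))
          show "continuous_on UNIV (?g k)"
            by (intro continuous_intros q(1,2)[OF t])
          show "?g k x = 0" if "x \<notin> cbox (- b) b" for x
            using van_a[OF less_imp_le[OF t] that] by (simp add: \<eta>_def \<eta>x_def)
        qed
        show "(\<integral>x. ?g k x \<partial>lborel) = 0"
        proof (rule integral_partial_deriv_eq_0[where f="\<lambda>x. \<eta> t x * q k t x" and a="- b" and b=b])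
          show "has_partial_deriv (\<lambda>x. \<eta> t x * q k t x) k (?g k x) x" for x
            by (rule has_partial_deriv_mult[OF D\<eta>x q(3)[OF t]])
        qed (use van_a[OF less_imp_le[OF t]] in \<open>auto simp: \<eta>_def[of t] intro!: continuous_intros q(1,2)[OF t]\<close>)
      qed
      have intf: "integrable lborel (?f t)"
        by (rule integral_vanishing_outside_cbox(1)[of _ "- b" b])
           (use van_a[OF less_imp_le[OF t]] t in \<open>auto simp: \<eta>_def[of t] \<eta>t_def[of t] intro!: continuous_intros cont_et cont_e\<close>)
      \<comment> \<open>The partial derivatives \<open>?g k\<close> of \<open>\<eta> q\<^sub>k\<close> integrate to zero; adding them makes the integrand pointwise nonpositive.\<close>
      have "(\<integral>x. ?f t x \<partial>lborel) = (\<integral>x. ?f t x + (\<Sum>k\<in>UNIV. ?g k x) \<partial>lborel)"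
        using intf intg by simp
      also have "\<dots> \<le> integral\<^sup>L lborel (\<lambda>_::real^'n. 0::real)"
      proof (rule integral_mono')
        fix x
        have q_le: "- ((x - x0) $ k / \<rho> x) * q k t x \<le> L * e t x" for k
        proof -
          have "- ((x - x0) $ k / \<rho> x) * q k t x \<le> \<bar>(x - x0) $ k\<bar> / \<rho> x * \<bar>q k t x\<bar>"
            using abs_ge_self[of "- ((x - x0) $ k / \<rho> x) * q k t x"] \<rho>(2)[of x]
            by (simp add: abs_mult)
          also have "\<dots> \<le> 1 * (L * e t x)"
            using \<rho>_comp[of x k] L(2)[OF t, of k x] \<rho>(2)[of x] by (intro mult_mono) auto
          finally show ?thesis by simp
        qed
        have "?f t x + (\<Sum>k\<in>UNIV. ?g k x) = \<eta> t x * (et t x + (\<Sum>k\<in>UNIV. qx k t x))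
           + 2 * max 0 (a t x) * ((\<Sum>k\<in>UNIV. - ((x - x0) $ k / \<rho> x) * q k t x) - c * e t x)"
        proof -
          define S1 where "S1 = (\<Sum>k\<in>UNIV. qx k t x)"
          define S2 where "S2 = (\<Sum>k\<in>UNIV. - ((x - x0) $ k / \<rho> x) * q k t x)"
          have "(\<Sum>k\<in>UNIV. ?g k x) = \<eta> t x * S1 + 2 * max 0 (a t x) * S2"
            by (simp only: \<eta>x_def S1_def S2_def sum.distrib sum_distrib_left mult.assoc)
          then show ?thesis
            unfolding S1_def[symmetric] S2_def[symmetric] \<eta>t_def by (simp add: algebra_simps)
        qed
        also have "\<dots> \<le> 0 + 0"
        proof (intro add_mono)
          show "\<eta> t x * (et t x + (\<Sum>k\<in>UNIV. qx k t x)) \<le> 0"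
            using le[OF t] by (intro mult_nonneg_nonpos) (auto simp: \<eta>_def)
          have "(\<Sum>k\<in>UNIV. - ((x - x0) $ k / \<rho> x) * q k t x) \<le> (\<Sum>k\<in>(UNIV::'n set). L * e t x)"
            by (intro sum_mono q_le)
          then show "2 * max 0 (a t x) * ((\<Sum>k\<in>UNIV. - ((x - x0) $ k / \<rho> x) * q k t x) - c * e t x) \<le> 0"
            by (intro mult_nonneg_nonpos) (auto simp: c_def)
        qed
        finally show "?f t x + (\<Sum>k\<in>UNIV. ?g k x) \<le> 0" by simp
      qed auto
      finally show ?thesis by simp
    qed
    ultimately show ?thesis by (auto simp: has_real_derivative_iff_has_vector_derivative)
  qed
  have "W T \<le> W 0"
    by (rule DERIV_nonpos_imp_decreasing_open[OF T])
       (use DW continuous_on_subset[OF contW] in auto)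
  also have "W 0 = 0"
  proof -
    have "\<eta> 0 x * e 0 x = 0" for x
    proof (cases "norm x > R\<^sub>0")
      case False
      have "norm x0 - norm x \<le> norm (x - x0)" by (simp add: norm_minus_commute norm_triangle_ineq2)
      then have "a 0 x \<le> 0" using False \<rho>(1)[of x] by (simp add: a_def R_def)
      then show ?thesis by (simp add: \<eta>_def)
    qed (simp add: init)
    then show ?thesis by (simp only: W_def) simp
  qed
  finally have WT: "W T \<le> 0" .
  have contT: "continuous_on UNIV (\<lambda>x. \<eta> T x * e T x)"
    by (intro continuous_intros cont_e T)
  have nn: "0 \<le> \<eta> T x * e T x" for x using e(2)[OF T] by (simp add: \<eta>_def)
  have vanT: "\<eta> T x * e T x = 0" if "x \<notin> cbox (- b) b" for x
    using van_a[OF T that] by (simp add: \<eta>_def)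
  have "W T = integral (cbox (- b) b) (\<lambda>x. \<eta> T x * e T x)"
    unfolding W_def by (rule integral_vanishing_outside_cbox(2)[OF contT vanT])
  moreover have "(\<lambda>x. \<eta> T x * e T x) integrable_on cbox (- b) b"
    by (rule integrable_continuous) (rule continuous_on_subset[OF contT], simp)
  moreover have "0 \<le> integral (cbox (- b) b) (\<lambda>x. \<eta> T x * e T x)"
    by (rule integral_nonneg) (use calculation nn in auto)
  ultimately have "((\<lambda>x. \<eta> T x * e T x) has_integral 0) (cbox (- b) b)"
    using WT by (metis antisym has_integral_integral)
  moreover have x0b: "x0 \<in> box (- b) b" using b by auto
  moreover have "x0 \<in> cbox (- b) b" using x0b box_subset_cbox[of "- b" b] by blast
  ultimately have "\<eta> T x0 * e T x0 = 0"
    by (intro has_integral_0_cbox_imp_0[where f="\<lambda>x. \<eta> T x * e T x" and a="- b" and b=b])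
       (use nn in \<open>auto intro: continuous_on_subset[OF contT]\<close>)
  moreover have "a T x0 > 0" using x0 by (simp add: a_def \<rho>_def R_def c_def)
  ultimately show ?thesis by (simp add: \<eta>_def)
qed

section \<open>Symmetric structure of the truncated system\<close>

\<comment> \<open>Facts about \<open>mi_unit k\<close>, which abbreviates \<open>axis k 1\<close>, match only if this 1 is not rewritten to \<open>Suc 0\<close>.\<close>
declare One_nat_def [simp del]

text \<open>The \<open>k\<close>-th coupling matrix of the truncated system applied to \<open>u\<close>, that is \<open>(A\<^sub>k u)\<^sub>\<beta>\<close>.
As in the definition of solutions, \<open>\<beta> - mi_unit k\<close> truncates only where it has the factor \<open>0\<close>.\<close>

definition transport :: "nat \<Rightarrow> 'n \<Rightarrow> (nat ^ 'n \<Rightarrow> complex) \<Rightarrow> nat ^ 'n \<Rightarrow> complex" where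
  "transport N k u \<beta> = of_nat (\<beta> $ k) * u (\<beta> - mi_unit k) +
     (if \<beta> + mi_unit k \<in> mi_upto N then u (\<beta> + mi_unit k) else 0)"

lemma mi_abs_add_unit: "mi_abs (\<gamma> + mi_unit k) = Suc (mi_abs (\<gamma> :: nat ^ 'n::finite))"
proof -
  have "(\<Sum>j\<in>UNIV. (mi_unit k :: nat ^ 'n) $ j) = 1"
    by (simp add: axis_def)
  then show ?thesis by (simp add: mi_abs_def sum.distrib)
qed

lemma mi_diff_unit_add: "\<beta> $ k \<noteq> 0 \<Longrightarrow> \<beta> - mi_unit k + mi_unit k = (\<beta> :: nat ^ 'n::finite)"
  by (auto simp: vec_eq_iff axis_def)

lemma mi_add_unit_diff: "\<gamma> + mi_unit k - mi_unit k = (\<gamma> :: nat ^ 'n::finite)"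
  by (auto simp: vec_eq_iff)

lemma mi_diff_unit_upto: "\<beta> \<in> mi_upto N \<Longrightarrow> \<beta> - mi_unit k \<in> mi_upto N"
proof -
  assume "\<beta> \<in> mi_upto N"
  moreover have "mi_abs (\<beta> - mi_unit k) \<le> mi_abs \<beta>"
    unfolding mi_abs_def by (intro sum_mono) simp
  ultimately show ?thesis by (simp add: mi_upto_def)
qed

lemma mi_weight_add_unit: "mi_weight (\<gamma> + mi_unit k) * real (Suc (\<gamma> $ k)) = mi_weight (\<gamma> :: nat ^ 'n::finite)"
proof -
  have g: "(\<gamma> + mi_unit k) $ k = Suc (\<gamma> $ k)" by simp
  have "mi_fact (\<gamma> + mi_unit k) = fact (Suc (\<gamma> $ k)) * (\<Prod>j\<in>UNIV - {k}. fact ((\<gamma> + mi_unit k) $ j))"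
    unfolding mi_fact_def by (subst prod.remove[of UNIV k]) (simp_all only: g finite UNIV_I)
  also have "(\<Prod>j\<in>UNIV - {k}. fact ((\<gamma> + mi_unit k) $ j)) = (\<Prod>j\<in>UNIV - {k}. fact (\<gamma> $ j) :: nat)"
    by (rule prod.cong) (auto simp: axis_def)
  also have "fact (Suc (\<gamma> $ k)) * \<dots> = Suc (\<gamma> $ k) * (fact (\<gamma> $ k) * (\<Prod>j\<in>UNIV - {k}. fact (\<gamma> $ j)))"
    by (simp only: fact_Suc of_nat_id mult.assoc)
  also have "fact (\<gamma> $ k) * (\<Prod>j\<in>UNIV - {k}. fact (\<gamma> $ j)) = mi_fact \<gamma>"
    unfolding mi_fact_def by (subst prod.remove[of UNIV k]) auto
  finally have "mi_fact (\<gamma> + mi_unit k) = Suc (\<gamma> $ k) * mi_fact \<gamma>" .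
  then show ?thesis by (simp add: mi_weight_def del: of_nat_Suc mult_Suc)
qed

definition mi_below :: "nat \<Rightarrow> (nat ^ 'n) set" where
  "mi_below N = {\<gamma>. mi_abs \<gamma> < N}"

lemma mi_below_iff: "\<gamma> \<in> mi_below N \<longleftrightarrow> \<gamma> + mi_unit k \<in> mi_upto N"
  by (simp add: mi_below_def mi_upto_def mi_abs_add_unit Suc_le_eq)

lemma mi_below_subset: "mi_below N \<subseteq> mi_upto N"
  by (auto simp: mi_below_def mi_upto_def)

lemma sum_mi_shift:
  fixes f :: "nat ^ 'n::finite \<Rightarrow> real"
  shows "(\<Sum>\<beta>\<in>{\<beta> \<in> mi_upto N. \<beta> $ k \<noteq> 0}. f \<beta>) = (\<Sum>\<gamma>\<in>mi_below N. f (\<gamma> + mi_unit k))"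
proof (rule sum.reindex_bij_witness[where i="\<lambda>\<gamma>. \<gamma> + mi_unit k" and j="\<lambda>\<beta>. \<beta> - mi_unit k"])
  fix \<beta> :: "nat ^ 'n" assume b: "\<beta> \<in> {\<beta> \<in> mi_upto N. \<beta> $ k \<noteq> 0}"
  then show e: "\<beta> - mi_unit k + mi_unit k = \<beta>" by (simp add: mi_diff_unit_add)
  show "\<beta> - mi_unit k \<in> mi_below N" unfolding mi_below_iff[of _ _ k] e using b by simp
  show "f (\<beta> - mi_unit k + mi_unit k) = f \<beta>" by (simp only: e)
next
  fix \<gamma> :: "nat ^ 'n" assume "\<gamma> \<in> mi_below N"
  then show "\<gamma> + mi_unit k \<in> {\<beta> \<in> mi_upto N. \<beta> $ k \<noteq> 0}"
    by (simp add: mi_below_iff[symmetric])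
qed (rule mi_add_unit_diff)

text \<open>The right-hand side is symmetric in \<open>u\<close> and \<open>v\<close>: for the weights \<open>1 / \<beta>!\<close> the raising part of
\<open>A\<^sub>k\<close> is the adjoint of the lowering part, because the index shift \<open>\<beta> = \<gamma> + e\<^sub>k\<close> turns
\<open>\<beta>\<^sub>k / \<beta>!\<close> into \<open>1 / \<gamma>!\<close>.\<close>

lemma transport_inner:
  fixes u v :: "nat ^ 'n::finite \<Rightarrow> complex"
  shows "(\<Sum>\<beta>\<in>mi_upto N. mi_weight \<beta> * (transport N k u \<beta> \<bullet> v \<beta>)) =
    (\<Sum>\<gamma>\<in>mi_below N. mi_weight \<gamma> * (u \<gamma> \<bullet> v (\<gamma> + mi_unit k) + u (\<gamma> + mi_unit k) \<bullet> v \<gamma>))"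
proof -
  let ?S = "mi_upto N :: (nat ^ 'n) set"
  let ?up = "\<lambda>\<beta>. mi_weight \<beta> * (real (\<beta> $ k) * (u (\<beta> - mi_unit k) \<bullet> v \<beta>))"
  let ?down = "\<lambda>\<beta>. mi_weight \<beta> * (u (\<beta> + mi_unit k) \<bullet> v \<beta>)"
  have c: "(of_nat i * z) \<bullet> w = real i * (z \<bullet> w)" for i and z w :: complex
    by (simp add: inner_complex_def algebra_simps)
  have "(\<Sum>\<beta>\<in>?S. mi_weight \<beta> * (transport N k u \<beta> \<bullet> v \<beta>)) =
     (\<Sum>\<beta>\<in>?S. ?up \<beta> + (if \<beta> \<in> mi_below N then ?down \<beta> else 0))"
    by (rule sum.cong) (auto simp: transport_def inner_add_left c mi_below_iff[of _ _ k] algebra_simps)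
  also have "\<dots> = (\<Sum>\<beta>\<in>?S. ?up \<beta>) + (\<Sum>\<beta>\<in>?S. if \<beta> \<in> mi_below N then ?down \<beta> else 0)"
    by (rule sum.distrib)
  also have "(\<Sum>\<beta>\<in>?S. if \<beta> \<in> mi_below N then ?down \<beta> else 0) = (\<Sum>\<beta>\<in>mi_below N. ?down \<beta>)"
    by (simp add: sum.inter_restrict[symmetric] finite_mi_upto Int_absorb1[OF mi_below_subset])
  also have "(\<Sum>\<beta>\<in>?S. ?up \<beta>) = (\<Sum>\<beta>\<in>{\<beta> \<in> ?S. \<beta> $ k \<noteq> 0}. ?up \<beta>)"
    by (rule sum.mono_neutral_right) (auto simp: finite_mi_upto)
  also have "\<dots> = (\<Sum>\<gamma>\<in>mi_below N. ?up (\<gamma> + mi_unit k))"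
    by (rule sum_mi_shift)
  also have "\<dots> = (\<Sum>\<gamma>\<in>mi_below N. mi_weight \<gamma> * (u \<gamma> \<bullet> v (\<gamma> + mi_unit k)))"
  proof (rule sum.cong[OF refl])
    fix \<gamma> :: "nat ^ 'n"
    have "(\<gamma> + mi_unit k) $ k = Suc (\<gamma> $ k)" by simp
    then show "?up (\<gamma> + mi_unit k) = mi_weight \<gamma> * (u \<gamma> \<bullet> v (\<gamma> + mi_unit k))"
      by (simp only: mi_add_unit_diff mult.assoc[symmetric] mi_weight_add_unit)
  qed
  finally show ?thesis by (simp add: sum.distrib distrib_left)
qed

definition mi_energy :: "nat \<Rightarrow> (nat ^ 'n \<Rightarrow> complex) \<Rightarrow> real" where
  "mi_energy N u = (\<Sum>\<beta>\<in>mi_upto N. mi_weight \<beta> * (u \<beta> \<bullet> u \<beta>))"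

lemma mi_energy_term_nonneg: "0 \<le> mi_weight \<beta> * (z \<bullet> (z::complex))"
  using mi_weight_pos[of \<beta>] by simp

lemma mi_energy_nonneg: "0 \<le> mi_energy N u"
  unfolding mi_energy_def by (intro sum_nonneg mi_energy_term_nonneg)

lemma mi_energy_ge_term:
  assumes "\<beta> \<in> mi_upto N"
  shows "mi_weight \<beta> * (u \<beta> \<bullet> u \<beta>) \<le> mi_energy N (u :: nat ^ 'n::finite \<Rightarrow> complex)"
  unfolding mi_energy_def
  by (rule member_le_sum) (auto simp: assms finite_mi_upto mi_weight_pos less_imp_le)

lemma mi_energy_eq_0D:
  fixes u :: "nat ^ 'n::finite \<Rightarrow> complex"
  assumes "mi_energy N u = 0" "\<beta> \<in> mi_upto N"
  shows "u \<beta> = 0"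
proof -
  have "mi_weight \<beta> * (u \<beta> \<bullet> u \<beta>) \<le> 0" using mi_energy_ge_term[OF assms(2), of u] assms(1) by simp
  then have "u \<beta> \<bullet> u \<beta> \<le> 0" using mi_weight_pos[of \<beta>] by (simp add: mult_le_0_iff)
  then show ?thesis by (metis antisym inner_ge_zero inner_eq_zero_iff)
qed

lemma abs_inner_le: "\<bar>2 * (x \<bullet> y)\<bar> \<le> x \<bullet> x + y \<bullet> (y::'a::real_inner)"
proof -
  have "0 \<le> (x - y) \<bullet> (x - y)" "0 \<le> (x + y) \<bullet> (x + y)" by (rule inner_ge_zero)+
  then show ?thesis by (simp add: inner_add inner_diff inner_commute abs_le_iff)
qed

text \<open>The propagation speed grows with \<open>N\<close> since neighbouring weights differ by a factor up to \<open>N\<close>. Its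
finiteness suffices, since the speed only serves to bound supports.\<close>

lemma mi_flux_le:
  fixes u :: "nat ^ 'n::finite \<Rightarrow> complex"
  shows "\<bar>\<Sum>\<gamma>\<in>mi_below N. mi_weight \<gamma> * (2 * (u \<gamma> \<bullet> u (\<gamma> + mi_unit k)))\<bar> \<le> (real N + 1) * mi_energy N u"
proof -
  let ?I = "mi_below N :: (nat ^ 'n) set"
  let ?e = "\<lambda>\<beta>. mi_weight \<beta> * (u \<beta> \<bullet> u \<beta>)"
  have below: "(\<Sum>\<gamma>\<in>?I. ?e (\<gamma> + mi_unit k)) \<le> mi_energy N u"
    unfolding sum_mi_shift[of ?e N k, symmetric] mi_energy_def
    by (rule sum_mono2) (auto simp: finite_mi_upto mi_weight_pos less_imp_le)
  have below': "(\<Sum>\<gamma>\<in>?I. ?e \<gamma>) \<le> mi_energy N u"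
    unfolding mi_energy_def
    by (rule sum_mono2) (auto simp: finite_mi_upto mi_weight_pos less_imp_le mi_below_subset[THEN subsetD])
  have "\<bar>\<Sum>\<gamma>\<in>?I. mi_weight \<gamma> * (2 * (u \<gamma> \<bullet> u (\<gamma> + mi_unit k)))\<bar>
      \<le> (\<Sum>\<gamma>\<in>?I. \<bar>mi_weight \<gamma> * (2 * (u \<gamma> \<bullet> u (\<gamma> + mi_unit k)))\<bar>)"
    by (rule sum_abs)
  also have "\<dots> \<le> (\<Sum>\<gamma>\<in>?I. ?e \<gamma> + real N * ?e (\<gamma> + mi_unit k))"
  proof (rule sum_mono)
    fix \<gamma> :: "nat ^ 'n" assume g: "\<gamma> \<in> ?I"
    let ?v = "u (\<gamma> + mi_unit k)"
    have "Suc (\<gamma> $ k) \<le> N"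
    proof -
      have "\<gamma> $ k \<le> mi_abs \<gamma>" unfolding mi_abs_def by (rule member_le_sum) auto
      then show ?thesis using g by (simp add: mi_below_def)
    qed
    then have "mi_weight (\<gamma> + mi_unit k) * real (Suc (\<gamma> $ k)) \<le> mi_weight (\<gamma> + mi_unit k) * real N"
      using mi_weight_pos[of "\<gamma> + mi_unit k"] by (intro mult_left_mono) auto
    then have w: "mi_weight \<gamma> \<le> real N * mi_weight (\<gamma> + mi_unit k)"
      by (simp only: mi_weight_add_unit mult.commute[of "real N"])
    have "\<bar>mi_weight \<gamma> * (2 * (u \<gamma> \<bullet> ?v))\<bar> = mi_weight \<gamma> * \<bar>2 * (u \<gamma> \<bullet> ?v)\<bar>"
      using mi_weight_pos[of \<gamma>] by (simp add: abs_mult)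
    also have "\<dots> \<le> mi_weight \<gamma> * (u \<gamma> \<bullet> u \<gamma> + ?v \<bullet> ?v)"
      using mi_weight_pos[of \<gamma>] by (intro mult_left_mono abs_inner_le) auto
    also have "\<dots> \<le> ?e \<gamma> + real N * ?e (\<gamma> + mi_unit k)"
      using mult_right_mono[OF w, of "?v \<bullet> ?v"] by (simp add: distrib_left)
    finally show "\<bar>mi_weight \<gamma> * (2 * (u \<gamma> \<bullet> ?v))\<bar> \<le> ?e \<gamma> + real N * ?e (\<gamma> + mi_unit k)" .
  qed
  also have "\<dots> = (\<Sum>\<gamma>\<in>?I. ?e \<gamma>) + real N * (\<Sum>\<gamma>\<in>?I. ?e (\<gamma> + mi_unit k))"
    by (simp add: sum.distrib sum_distrib_left)
  also have "\<dots> \<le> mi_energy N u + real N * mi_energy N u"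
    using below below' by (intro add_mono mult_left_mono) auto
  finally show ?thesis by (simp add: algebra_simps)
qed

locale galerkin_solution =
  fixes N :: nat and m0 :: "nat ^ 'n::finite \<Rightarrow> real ^ 'n \<Rightarrow> complex"
    and m :: "nat ^ 'n \<Rightarrow> real \<Rightarrow> real ^ 'n \<Rightarrow> complex"
  assumes sol: "truncated_solution N m0 m"
begin

definition mt :: "nat ^ 'n \<Rightarrow> real \<Rightarrow> real ^ 'n \<Rightarrow> complex" where
  "mt \<beta> t x = vector_derivative (\<lambda>s. m \<beta> s x) (at t)"

definition mx :: "'n \<Rightarrow> nat ^ 'n \<Rightarrow> real \<Rightarrow> real ^ 'n \<Rightarrow> complex" where
  "mx k \<beta> t = partial_deriv k (m \<beta> t)"

lemma cont_m: "\<beta> \<in> mi_upto N \<Longrightarrow> continuous_on ({0..} \<times> UNIV) (\<lambda>(t, x). m \<beta> t x)"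
  and cont_mt: "\<beta> \<in> mi_upto N \<Longrightarrow> continuous_on ({0<..} \<times> UNIV) (\<lambda>(t, x). mt \<beta> t x)"
  and cont_mx: "\<beta> \<in> mi_upto N \<Longrightarrow> continuous_on ({0<..} \<times> UNIV) (\<lambda>(t, x). mx k \<beta> t x)"
  and m_init: "\<beta> \<in> mi_upto N \<Longrightarrow> m \<beta> 0 x = m0 \<beta> x"
  and m_diff: "\<beta> \<in> mi_upto N \<Longrightarrow> t > 0 \<Longrightarrow> (\<lambda>(t, x). m \<beta> t x) differentiable (at (t, x))"
  using sol unfolding truncated_solution_def mt_def mx_def by auto

lemma pde:
  assumes "\<beta> \<in> mi_upto N" "t > 0"
  shows "mt \<beta> t x = - (\<Sum>k\<in>UNIV. transport N k (\<lambda>\<gamma>. mx k \<gamma> t x) \<beta>) - of_nat (mi_abs \<beta>) * m \<beta> t x"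
proof -
  have "mt \<beta> t x + (\<Sum>k\<in>UNIV. of_nat (\<beta> $ k) * mx k (\<beta> - mi_unit k) t x)
      + (\<Sum>k\<in>UNIV. if \<beta> + mi_unit k \<in> mi_upto N then mx k (\<beta> + mi_unit k) t x else 0)
      + of_nat (mi_abs \<beta>) * m \<beta> t x = 0"
    using sol assms unfolding truncated_solution_def mt_def mx_def by blast
  then show ?thesis
    by (simp add: transport_def sum.distrib algebra_simps eq_neg_iff_add_eq_0)
qed

lemma cont_slice:
  assumes "\<beta> \<in> mi_upto N"
  shows "t \<ge> 0 \<Longrightarrow> continuous_on UNIV (m \<beta> t)" "t > 0 \<Longrightarrow> continuous_on UNIV (mx k \<beta> t)"
proof -
  have p: "continuous_on UNIV (\<lambda>x::real ^ 'n. (t, x))" by (intro continuous_intros)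
  show "continuous_on UNIV (m \<beta> t)" if "t \<ge> 0"
    using continuous_on_compose2[OF cont_m[OF assms] p] that by auto
  show "continuous_on UNIV (mx k \<beta> t)" if "t > 0"
    using continuous_on_compose2[OF cont_mx[OF assms] p] that by auto
qed

lemma has_vector_derivative_m:
  assumes "\<beta> \<in> mi_upto N" "t > 0"
  shows "((\<lambda>s. m \<beta> s x) has_vector_derivative mt \<beta> t x) (at t)"
proof -
  have "((\<lambda>(t, x). m \<beta> t x) \<circ> (\<lambda>s. (s, x))) differentiable (at t)"
    by (rule differentiable_chain_at) (use m_diff[OF assms] in \<open>auto intro!: derivative_intros\<close>)
  then show ?thesis by (simp add: o_def vector_derivative_works mt_def)
qed

lemma has_partial_deriv_m:
  assumes "\<beta> \<in> mi_upto N" "t > 0"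
  shows "has_partial_deriv (m \<beta> t) k (mx k \<beta> t x) x"
proof -
  have "((\<lambda>(t, x). m \<beta> t x) \<circ> (\<lambda>x. (t, x))) differentiable (at x)"
    by (rule differentiable_chain_at) (use m_diff[OF assms] in \<open>auto intro!: derivative_intros\<close>)
  then have "m \<beta> t differentiable (at x)" by (simp add: o_def)
  then show ?thesis unfolding mx_def by (rule differentiable_has_partial_deriv)
qed

text \<open>The energy density satisfies \<open>\<partial>\<^sub>t e + \<Sum>\<^sub>k \<partial>\<^sub>k q\<^sub>k = - 2 \<Sum> |\<beta>| |m\<^sub>\<beta>|\<^sup>2 / \<beta>!\<close>: by symmetry of
the coupling matrices the transport terms form a divergence, and the remaining terms have a sign.\<close>

lemma compact_support:
  assumes init: "\<And>\<beta> x. \<beta> \<in> mi_upto N \<Longrightarrow> norm x > R\<^sub>0 \<Longrightarrow> m0 \<beta> x = 0"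
    and t: "t \<ge> 0" and x: "norm x > R\<^sub>0 + 1 + real CARD('n) * (real N + 1) * t" and b: "\<beta> \<in> mi_upto N"
  shows "m \<beta> t x = 0"
proof -
  let ?S = "mi_upto N :: (nat ^ 'n) set" and ?I = "mi_below N :: (nat ^ 'n) set"
  define e where "e t x = mi_energy N (\<lambda>\<beta>. m \<beta> t x)" for t x
  define et where "et t x = (\<Sum>\<beta>\<in>?S. mi_weight \<beta> * (2 * (mt \<beta> t x \<bullet> m \<beta> t x)))" for t x
  define q where "q k t x = (\<Sum>\<gamma>\<in>?I. mi_weight \<gamma> * (2 * (m \<gamma> t x \<bullet> m (\<gamma> + mi_unit k) t x)))" for k t x
  define qx where "qx k t x = 2 * (\<Sum>\<gamma>\<in>?I. mi_weight \<gamma> *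
     (mx k \<gamma> t x \<bullet> m (\<gamma> + mi_unit k) t x + mx k (\<gamma> + mi_unit k) t x \<bullet> m \<gamma> t x))" for k t x
  have m_pos: "continuous_on ({0<..} \<times> UNIV) (\<lambda>(t, x). m \<beta> t x)" if "\<beta> \<in> ?S" for \<beta>
    by (rule continuous_on_subset[OF cont_m[OF that]]) auto
  have I: "\<gamma> \<in> ?S" "\<gamma> + mi_unit k \<in> ?S" if "\<gamma> \<in> ?I" for \<gamma> k
    using that mi_below_subset mi_below_iff by blast+
  have "e t x = 0"
  proof (rule finite_propagation_speed[where e=e and T=t and ?x0.0=x and R\<^sub>0=R\<^sub>0 and L="real N + 1" and et=et and q=q and qx=qx])
    have "continuous_on ({0..} \<times> UNIV) (\<lambda>z. e (fst z) (snd z))"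
      unfolding e_def mi_energy_def
      by (intro continuous_intros) (use cont_m in \<open>auto simp: case_prod_beta\<close>)
    then show "continuous_on ({0..} \<times> UNIV) (\<lambda>(t, x). e t x)" by (simp add: case_prod_beta)
    show "0 \<le> e t x" for t x by (simp add: e_def mi_energy_nonneg)
    show "((\<lambda>s. e s x) has_vector_derivative et t x) (at t)" if "t > 0" for t x
      unfolding e_def et_def mi_energy_def
    proof (intro has_vector_derivative_sum)
      fix \<beta> assume b: "\<beta> \<in> ?S"
      have "((\<lambda>s. m \<beta> s x \<bullet> m \<beta> s x) has_vector_derivative 2 * (mt \<beta> t x \<bullet> m \<beta> t x)) (at t)"
        using has_derivative_inner[OF has_vector_derivative_m[OF b that, of x, unfolded has_vector_derivative_def]
            has_vector_derivative_m[OF b that, of x, unfolded has_vector_derivative_def]]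
        by (simp add: has_vector_derivative_def inner_commute algebra_simps)
      from has_vector_derivative_mult_right[OF this, of "mi_weight \<beta>"]
      show "((\<lambda>s. mi_weight \<beta> * (m \<beta> s x \<bullet> m \<beta> s x)) has_vector_derivative mi_weight \<beta> * (2 * (mt \<beta> t x \<bullet> m \<beta> t x))) (at t)" .
    qed
    have "continuous_on ({0<..} \<times> UNIV) (\<lambda>z. et (fst z) (snd z))"
      unfolding et_def
      by (intro continuous_intros)
         (use cont_mt m_pos in \<open>auto simp: case_prod_beta\<close>)
    then show "continuous_on ({0<..} \<times> UNIV) (\<lambda>(t, x). et t x)" by (simp add: case_prod_beta)
    show "continuous_on UNIV (q k t)" if "t > 0" for k t
      unfolding q_def by (intro continuous_intros cont_slice) (use that I in auto)
    show "continuous_on UNIV (qx k t)" if "t > 0" for k t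
      unfolding qx_def by (intro continuous_intros cont_slice) (use that I in auto)
    show "has_partial_deriv (q k t) k (qx k t x) x" if t: "t > 0" for k t x
      unfolding q_def qx_def has_partial_deriv_def sum_distrib_left
    proof (intro has_vector_derivative_sum)
      fix \<gamma> assume g: "\<gamma> \<in> ?I"
      let ?\<gamma>' = "\<gamma> + mi_unit k"
      note d = has_partial_deriv_m[OF I(1)[OF g] t, of k x, unfolded has_partial_deriv_def has_vector_derivative_def]
        has_partial_deriv_m[OF I(2)[OF g] t, of k k x, unfolded has_partial_deriv_def has_vector_derivative_def]
      have "((\<lambda>s. m \<gamma> t (x + s *\<^sub>R axis k 1) \<bullet> m ?\<gamma>' t (x + s *\<^sub>R axis k 1)) has_vector_derivative
          mx k \<gamma> t x \<bullet> m ?\<gamma>' t x + mx k ?\<gamma>' t x \<bullet> m \<gamma> t x) (at 0)"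
        using has_derivative_inner[OF d]
        by (simp add: has_vector_derivative_def inner_commute algebra_simps)
      from has_vector_derivative_mult_right[OF this, of "2 * mi_weight \<gamma>"]
      show "((\<lambda>s. mi_weight \<gamma> * (2 * (m \<gamma> t (x + s *\<^sub>R axis k 1) \<bullet> m ?\<gamma>' t (x + s *\<^sub>R axis k 1)))) has_vector_derivative
          2 * (mi_weight \<gamma> * (mx k \<gamma> t x \<bullet> m ?\<gamma>' t x + mx k ?\<gamma>' t x \<bullet> m \<gamma> t x))) (at 0)"
        by (simp add: mult_ac)
    qed
    show "\<bar>q k t x\<bar> \<le> (real N + 1) * e t x" for k t x
      unfolding q_def e_def by (rule mi_flux_le)
    show "et t x + (\<Sum>k\<in>UNIV. qx k t x) \<le> 0" if "t > 0" for t x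
    proof -
      have qx: "qx k t x = 2 * (\<Sum>\<beta>\<in>?S. mi_weight \<beta> * (transport N k (\<lambda>\<gamma>. mx k \<gamma> t x) \<beta> \<bullet> m \<beta> t x))" for k
        unfolding qx_def transport_inner ..
      have c: "(of_nat i * z) \<bullet> z = real i * (z \<bullet> z)" for i and z :: complex
        by (simp add: inner_complex_def algebra_simps)
      have "et t x = (\<Sum>\<beta>\<in>?S. - (\<Sum>k\<in>UNIV. 2 * (mi_weight \<beta> * (transport N k (\<lambda>\<gamma>. mx k \<gamma> t x) \<beta> \<bullet> m \<beta> t x)))
          - 2 * (real (mi_abs \<beta>) * (mi_weight \<beta> * (m \<beta> t x \<bullet> m \<beta> t x))))"
        unfolding et_def
      proof (rule sum.cong[OF refl])
        fix \<beta> assume "\<beta> \<in> ?S"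
        then show "mi_weight \<beta> * (2 * (mt \<beta> t x \<bullet> m \<beta> t x)) =
          - (\<Sum>k\<in>UNIV. 2 * (mi_weight \<beta> * (transport N k (\<lambda>\<gamma>. mx k \<gamma> t x) \<beta> \<bullet> m \<beta> t x)))
          - 2 * (real (mi_abs \<beta>) * (mi_weight \<beta> * (m \<beta> t x \<bullet> m \<beta> t x)))"
          by (simp add: pde[OF _ that] inner_diff_left inner_minus_left inner_sum_left c
              sum_distrib_left[symmetric] algebra_simps)
      qed
      also have "\<dots> = - (\<Sum>k\<in>UNIV. qx k t x)
          - 2 * (\<Sum>\<beta>\<in>?S. real (mi_abs \<beta>) * (mi_weight \<beta> * (m \<beta> t x \<bullet> m \<beta> t x)))"
        unfolding qx sum_subtractf sum_negf by (subst sum.swap) (simp add: sum_distrib_left)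
      finally have "et t x + (\<Sum>k\<in>UNIV. qx k t x) =
          - 2 * (\<Sum>\<beta>\<in>?S. real (mi_abs \<beta>) * (mi_weight \<beta> * (m \<beta> t x \<bullet> m \<beta> t x)))" by simp
      moreover have "0 \<le> (\<Sum>\<beta>\<in>?S. real (mi_abs \<beta>) * (mi_weight \<beta> * (m \<beta> t x \<bullet> m \<beta> t x)))"
        by (intro sum_nonneg mult_nonneg_nonneg mi_energy_term_nonneg) auto
      ultimately show ?thesis by simp
    qed
    show "e 0 x = 0" if "norm x > R\<^sub>0" for x
      using that by (simp add: e_def mi_energy_def m_init init)
  qed (use t x in auto)
  then show ?thesis unfolding e_def using b by (rule mi_energy_eq_0D)
qed

end

section \<open>Hypocoercivity at a fixed frequency\<close>

lemma exp_decay: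
  fixes f :: "real \<Rightarrow> real"
  assumes "s \<le> t" and cont: "continuous_on {s..t} f"
    and der: "\<And>r. s < r \<Longrightarrow> r < t \<Longrightarrow> \<exists>f'. (f has_real_derivative f') (at r) \<and> f' \<le> - \<kappa> * f r"
  shows "f t \<le> exp (- \<kappa> * (t - s)) * f s"
proof -
  have "exp (\<kappa> * t) * f t \<le> exp (\<kappa> * s) * f s"
  proof (rule DERIV_nonpos_imp_decreasing_open[OF \<open>s \<le> t\<close>])
    fix r assume r: "s < r" "r < t"
    then obtain f' where f': "(f has_real_derivative f') (at r)" "f' \<le> - \<kappa> * f r" using der by blast
    have "((\<lambda>r. exp (\<kappa> * r) * f r) has_real_derivative exp (\<kappa> * r) * (f' + \<kappa> * f r)) (at r)"
      by (auto intro!: derivative_eq_intros f'(1) simp: algebra_simps)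
    moreover have "exp (\<kappa> * r) * (f' + \<kappa> * f r) \<le> 0"
      using f'(2) by (intro mult_nonneg_nonpos) auto
    ultimately show "\<exists>y. ((\<lambda>r. exp (\<kappa> * r) * f r) has_real_derivative y) (at r) \<and> y \<le> 0" by blast
  qed (intro continuous_intros cont)
  then have "exp (- \<kappa> * t) * (exp (\<kappa> * t) * f t) \<le> exp (- \<kappa> * t) * (exp (\<kappa> * s) * f s)"
    by (intro mult_left_mono) auto
  moreover have "exp (- \<kappa> * t) * exp (\<kappa> * t) = 1" "exp (- \<kappa> * t) * exp (\<kappa> * s) = exp (- \<kappa> * (t - s))"
    by (simp_all add: exp_add[symmetric] algebra_simps)
  ultimately show ?thesis by (simp only: mult.assoc[symmetric] mult_1)
qed

lemma has_real_derivative_inner: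
  fixes f g :: "real \<Rightarrow> complex"
  assumes "(f has_vector_derivative f') (at t)" "(g has_vector_derivative g') (at t)"
  shows "((\<lambda>t. f t \<bullet> g t) has_real_derivative f' \<bullet> g t + f t \<bullet> g') (at t)"
  using has_derivative_inner[OF assms[unfolded has_vector_derivative_def]]
  by (simp add: has_real_derivative_iff_has_vector_derivative has_vector_derivative_def inner_commute algebra_simps)

lemma mi_weight_0: "mi_weight 0 = 1"
  by (simp add: mi_weight_def mi_fact_def)

lemma mi_weight_unit: "mi_weight (mi_unit k :: nat ^ 'n::finite) = 1"
  using mi_weight_add_unit[of "0 :: nat ^ 'n" k] by (simp add: mi_weight_0)

lemma mi_abs_0: "mi_abs 0 = 0"
  by (simp add: mi_abs_def)

lemma mi_abs_unit: "mi_abs (mi_unit k :: nat ^ 'n::finite) = 1"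
  using mi_abs_add_unit[of "0 :: nat ^ 'n" k] by (simp add: mi_abs_0)

lemma transport_mult: "transport N k (\<lambda>\<gamma>. c * u \<gamma>) \<beta> = c * transport N k u \<beta>"
  by (simp add: transport_def algebra_simps)

text \<open>Half the rate at which the energy is lost.\<close>

definition mi_dissipation :: "nat \<Rightarrow> (nat ^ 'n \<Rightarrow> complex) \<Rightarrow> real" where
  "mi_dissipation N u = (\<Sum>\<beta>\<in>mi_upto N. real (mi_abs \<beta>) * (mi_weight \<beta> * (u \<beta> \<bullet> u \<beta>)))"

lemma mi_dissipation_ge_term:
  fixes u :: "nat ^ 'n::finite \<Rightarrow> complex"
  assumes "\<beta> \<in> mi_upto N"
  shows "real (mi_abs \<beta>) * (mi_weight \<beta> * (u \<beta> \<bullet> u \<beta>)) \<le> mi_dissipation N u"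
  unfolding mi_dissipation_def
  by (rule member_le_sum) (auto simp: assms finite_mi_upto mi_weight_pos less_imp_le)

lemma mi_dissipation_nonneg: "0 \<le> mi_dissipation N u"
  unfolding mi_dissipation_def by (intro sum_nonneg mult_nonneg_nonneg mi_energy_term_nonneg) auto

text \<open>The dissipation controls all components except the one with index \<open>0\<close>.\<close>

lemma mi_energy_le_dissipation:
  fixes u :: "nat ^ 'n::finite \<Rightarrow> complex"
  shows "mi_energy N u \<le> u 0 \<bullet> u 0 + mi_dissipation N u"
proof -
  let ?S = "mi_upto N :: (nat ^ 'n) set"
  have z: "(0 :: nat ^ 'n) \<in> ?S" by (simp add: mi_upto_def mi_abs_0)
  have "mi_energy N u = u 0 \<bullet> u 0 + (\<Sum>\<beta>\<in>?S - {0}. mi_weight \<beta> * (u \<beta> \<bullet> u \<beta>))"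
    unfolding mi_energy_def using z by (simp add: sum.remove[of ?S 0] finite_mi_upto mi_weight_0)
  also have "(\<Sum>\<beta>\<in>?S - {0}. mi_weight \<beta> * (u \<beta> \<bullet> u \<beta>)) \<le>
      (\<Sum>\<beta>\<in>?S - {0}. real (mi_abs \<beta>) * (mi_weight \<beta> * (u \<beta> \<bullet> u \<beta>)))"
  proof (rule sum_mono)
    fix \<beta> :: "nat ^ 'n" assume b: "\<beta> \<in> ?S - {0}"
    then obtain k where "\<beta> $ k \<noteq> 0" by (auto simp: vec_eq_iff)
    moreover have "\<beta> $ k \<le> mi_abs \<beta>" unfolding mi_abs_def by (rule member_le_sum) auto
    ultimately have "1 \<le> real (mi_abs \<beta>)" by linarith
    from mult_right_mono[OF this mi_energy_term_nonneg[of \<beta> "u \<beta>"]]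
    show "mi_weight \<beta> * (u \<beta> \<bullet> u \<beta>) \<le> real (mi_abs \<beta>) * (mi_weight \<beta> * (u \<beta> \<bullet> u \<beta>))" by simp
  qed
  also have "\<dots> = mi_dissipation N u"
    unfolding mi_dissipation_def using z by (simp add: sum.remove[of ?S 0] finite_mi_upto mi_abs_0)
  finally show ?thesis by simp
qed

text \<open>The equations of the Fourier coefficients at a fixed frequency \<open>\<xi>\<close>. Since \<open>D\<close> does not control \<open>u 0\<close>, the
mixed term \<open>J\<close> between \<open>u 0\<close> and the first moments is added to the energy. Its derivative contains the
missing \<open>- |\<xi>|\<^sup>2 |u 0|\<^sup>2\<close>, and its other terms involve the first moments \<open>p\<close>, contracted with \<open>\<xi>\<close>, and
the second moments \<open>v\<close>, contracted twice to \<open>q\<close>. All of these have positive order and are controlled by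
\<open>D\<close> with constants that depend only on the dimension \<open>n\<close>. For \<open>N = 1\<close> the second moments are cut off.\<close>

locale symbol_ode =
  fixes N :: nat and \<xi> :: "real ^ 'n::finite" and u :: "nat ^ 'n \<Rightarrow> real \<Rightarrow> complex" and n :: real
  assumes N: "N \<ge> 1" and n: "n = real CARD('n)"
    and cont_u: "\<And>\<beta> T. \<beta> \<in> mi_upto N \<Longrightarrow> continuous_on {0..T} (u \<beta>)"
    and ode: "\<And>\<beta> t. \<beta> \<in> mi_upto N \<Longrightarrow> t > 0 \<Longrightarrow>
      (u \<beta> has_vector_derivative
        - (\<Sum>k\<in>UNIV. \<i> * of_real (\<xi> $ k) * transport N k (\<lambda>\<gamma>. u \<gamma> t) \<beta>)
        - of_nat (mi_abs \<beta>) * u \<beta> t) (at t)"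
begin

abbreviation "X \<equiv> norm \<xi>"
definition "E t = mi_energy N (\<lambda>\<beta>. u \<beta> t)"
definition "D t = mi_dissipation N (\<lambda>\<beta>. u \<beta> t)"
definition "p t = (\<Sum>k\<in>UNIV. \<xi> $ k *\<^sub>R u (mi_unit k) t)"
definition "v j k t = (if mi_unit j + mi_unit k \<in> mi_upto N then u (mi_unit j + mi_unit k) t else 0)"
definition "q t = (\<Sum>j\<in>UNIV. \<Sum>k\<in>UNIV. (\<xi> $ j * \<xi> $ k) *\<^sub>R v j k t)"
definition "J t = (\<i> * u 0 t) \<bullet> p t"

lemma n1: "1 \<le> n"
  unfolding n using zero_less_card_finite[where 'a='n] by linarith

lemma zero_mem: "0 \<in> mi_upto N"
  by (simp add: mi_upto_def mi_abs_0)

lemma unit_mem: "mi_unit k \<in> mi_upto N"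
  using N by (simp add: mi_upto_def mi_abs_unit)

lemma E_nonneg: "0 \<le> E t"
  by (simp add: E_def mi_energy_nonneg)

lemma D_nonneg: "0 \<le> D t"
  by (simp add: D_def mi_dissipation_nonneg)

lemma E_le: "E t \<le> u 0 t \<bullet> u 0 t + D t"
  unfolding E_def D_def by (rule mi_energy_le_dissipation)

lemma u0_le_E: "u 0 t \<bullet> u 0 t \<le> E t"
  using mi_energy_ge_term[OF zero_mem, of "\<lambda>\<beta>. u \<beta> t"] by (simp add: E_def mi_weight_0)

lemma norm_unit_le_D: "norm (u (mi_unit k) t) \<le> sqrt (D t)"
  using mi_dissipation_ge_term[OF unit_mem, of k "\<lambda>\<beta>. u \<beta> t"]
  by (intro real_le_rsqrt) (simp add: D_def mi_weight_unit mi_abs_unit power2_norm_eq_inner)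

lemma norm_unit_le_E: "norm (u (mi_unit k) t) \<le> sqrt (E t)"
  using mi_energy_ge_term[OF unit_mem, of k "\<lambda>\<beta>. u \<beta> t"]
  by (intro real_le_rsqrt) (simp add: E_def mi_weight_unit power2_norm_eq_inner)

text \<open>Multi-indices of order 2 have factorial at most 2, and the dissipation carries the factor 2 for them; hence each second
moment is bounded with constant 1.\<close>

lemma norm_v_le: "norm (v j k t) \<le> sqrt (D t)"
proof (cases "mi_unit j + mi_unit k \<in> (mi_upto N :: (nat ^ 'n) set)")
  case True
  let ?\<beta> = "mi_unit j + mi_unit k :: nat ^ 'n"
  have "mi_weight ?\<beta> * real (Suc ((mi_unit j :: nat ^ 'n) $ k)) = 1"
    by (simp only: mi_weight_add_unit mi_weight_unit)
  moreover have "real (Suc ((mi_unit j :: nat ^ 'n) $ k)) \<le> 2" by (simp add: axis_def)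
  ultimately have "1 \<le> mi_weight ?\<beta> * 2"
    using mult_left_mono[of "real (Suc ((mi_unit j :: nat ^ 'n) $ k))" 2 "mi_weight ?\<beta>"] mi_weight_pos[of ?\<beta>]
    by (simp del: of_nat_Suc)
  then have "1 * (u ?\<beta> t \<bullet> u ?\<beta> t) \<le> (mi_weight ?\<beta> * 2) * (u ?\<beta> t \<bullet> u ?\<beta> t)"
    by (intro mult_right_mono) auto
  also have "\<dots> = real (mi_abs ?\<beta>) * (mi_weight ?\<beta> * (u ?\<beta> t \<bullet> u ?\<beta> t))"
    by (simp add: mi_abs_add_unit mi_abs_unit)
  also have "\<dots> \<le> D t" unfolding D_def by (rule mi_dissipation_ge_term[OF True])
  finally show ?thesis using True
    by (intro real_le_rsqrt) (simp add: v_def power2_norm_eq_inner)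
qed (simp add: v_def D_nonneg)

lemma norm_p_le:
  assumes "\<And>k. norm (u (mi_unit k) t) \<le> c"
  shows "norm (p t) \<le> n * X * c"
proof -
  have "norm (p t) \<le> (\<Sum>k\<in>UNIV. norm (\<xi> $ k *\<^sub>R u (mi_unit k) t))"
    unfolding p_def by (rule norm_sum)
  also have "\<dots> \<le> (\<Sum>k\<in>(UNIV :: 'n set). X * c)"
    using component_le_norm_cart[of \<xi>] assms by (intro sum_mono) (auto intro!: mult_mono)
  finally show ?thesis by (simp add: n)
qed

lemma norm_q_le: "norm (q t) \<le> n\<^sup>2 * X\<^sup>2 * sqrt (D t)"
proof -
  have "norm (q t) \<le> (\<Sum>j\<in>UNIV. \<Sum>k\<in>UNIV. norm ((\<xi> $ j * \<xi> $ k) *\<^sub>R v j k t))"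
    unfolding q_def by (intro norm_sum[THEN order_trans] sum_mono order_refl)
  also have "\<dots> \<le> (\<Sum>j\<in>(UNIV :: 'n set). \<Sum>k\<in>(UNIV :: 'n set). (X * X) * sqrt (D t))"
    using component_le_norm_cart[of \<xi>] norm_v_le
    by (intro sum_mono) (auto simp: abs_mult intro!: mult_mono)
  finally show ?thesis by (simp add: n power2_eq_square)
qed

text \<open>The coupling matrices are symmetric, so after multiplication by \<open>\<i>\<close> they are skew and do not contribute to the
derivative of the energy.\<close>

lemma DERIV_E:
  assumes "t > 0"
  shows "(E has_real_derivative - 2 * D t) (at t)"
proof -
  let ?S = "mi_upto N :: (nat ^ 'n) set"
  let ?u = "\<lambda>\<beta>. u \<beta> t"
  let ?T = "\<lambda>k \<beta>. transport N k ?u \<beta>"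
  let ?u' = "\<lambda>\<beta>. - (\<Sum>k\<in>UNIV. \<i> * of_real (\<xi> $ k) * ?T k \<beta>) - of_nat (mi_abs \<beta>) * u \<beta> t"
  have c: "(of_nat i * z) \<bullet> z = real i * (z \<bullet> z)" for i and z :: complex
    by (simp add: inner_complex_def algebra_simps)
  have skew: "(\<Sum>\<beta>\<in>?S. mi_weight \<beta> * ((\<i> * ?T k \<beta>) \<bullet> u \<beta> t)) = 0" for k
  proof -
    have "(\<Sum>\<beta>\<in>?S. mi_weight \<beta> * ((\<i> * ?T k \<beta>) \<bullet> u \<beta> t)) =
        (\<Sum>\<beta>\<in>?S. mi_weight \<beta> * (transport N k (\<lambda>\<gamma>. \<i> * ?u \<gamma>) \<beta> \<bullet> ?u \<beta>))"
      by (simp only: transport_mult)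
    also have "\<dots> = 0"
      unfolding transport_inner by (rule sum.neutral) (simp add: inner_complex_def)
    finally show ?thesis .
  qed
  have re: "\<i> * of_real r * z = r *\<^sub>R (\<i> * z)" for r z
    by (simp add: scaleR_conv_of_real mult_ac)
  have "((\<lambda>t. \<Sum>\<beta>\<in>?S. mi_weight \<beta> * (u \<beta> t \<bullet> u \<beta> t)) has_real_derivative
      (\<Sum>\<beta>\<in>?S. mi_weight \<beta> * (?u' \<beta> \<bullet> u \<beta> t + u \<beta> t \<bullet> ?u' \<beta>))) (at t)"
    by (intro DERIV_sum DERIV_cmult has_real_derivative_inner ode assms)
  also have "(\<Sum>\<beta>\<in>?S. mi_weight \<beta> * (?u' \<beta> \<bullet> u \<beta> t + u \<beta> t \<bullet> ?u' \<beta>)) =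
      (\<Sum>\<beta>\<in>?S. - 2 * (\<Sum>k\<in>UNIV. \<xi> $ k * (mi_weight \<beta> * ((\<i> * ?T k \<beta>) \<bullet> u \<beta> t)))
         - 2 * (real (mi_abs \<beta>) * (mi_weight \<beta> * (u \<beta> t \<bullet> u \<beta> t))))"
  proof (rule sum.cong[OF refl])
    fix \<beta>
    have "?u' \<beta> \<bullet> u \<beta> t = - (\<Sum>k\<in>UNIV. \<xi> $ k * ((\<i> * ?T k \<beta>) \<bullet> u \<beta> t)) - real (mi_abs \<beta>) * (u \<beta> t \<bullet> u \<beta> t)"
      by (simp only: re inner_diff_left inner_minus_left inner_sum_left inner_scaleR_left c)
    then show "mi_weight \<beta> * (?u' \<beta> \<bullet> u \<beta> t + u \<beta> t \<bullet> ?u' \<beta>) =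
      - 2 * (\<Sum>k\<in>UNIV. \<xi> $ k * (mi_weight \<beta> * ((\<i> * ?T k \<beta>) \<bullet> u \<beta> t)))
         - 2 * (real (mi_abs \<beta>) * (mi_weight \<beta> * (u \<beta> t \<bullet> u \<beta> t)))"
      by (simp only: inner_commute[of "u \<beta> t" "?u' \<beta>"]) (simp add: sum_distrib_left algebra_simps)
  qed
  also have "\<dots> = - 2 * (\<Sum>k\<in>UNIV. \<xi> $ k * (\<Sum>\<beta>\<in>?S. mi_weight \<beta> * ((\<i> * ?T k \<beta>) \<bullet> u \<beta> t))) - 2 * D t"
    unfolding D_def mi_dissipation_def sum_subtractf sum_distrib_left
    by (subst sum.swap) simp
  also have "\<dots> = - 2 * D t" by (simp add: skew)
  finally show ?thesis by (simp add: E_def[abs_def] mi_energy_def)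
qed

lemma deriv_u0:
  assumes "t > 0"
  shows "(u 0 has_vector_derivative - (\<i> * p t)) (at t)"
proof -
  have "transport N k (\<lambda>\<gamma>. u \<gamma> t) 0 = u (mi_unit k) t" for k
    using unit_mem[of k] by (simp add: transport_def)
  then have "(\<Sum>k\<in>UNIV. \<i> * of_real (\<xi> $ k) * transport N k (\<lambda>\<gamma>. u \<gamma> t) 0) = \<i> * p t"
    by (simp add: p_def sum_distrib_left scaleR_conv_of_real mult_ac)
  with ode[OF zero_mem assms] show ?thesis by (simp add: mi_abs_0)
qed

lemma deriv_unit:
  assumes "t > 0"
  shows "(u (mi_unit j) has_vector_derivative
    - (\<i> * (\<xi> $ j *\<^sub>R u 0 t)) - \<i> * (\<Sum>k\<in>UNIV. \<xi> $ k *\<^sub>R v j k t) - u (mi_unit j) t) (at t)"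
proof -
  have "of_nat ((mi_unit j :: nat ^ 'n) $ k) * u (mi_unit j - mi_unit k) t = (if k = j then u 0 t else 0)" for k
    by (simp add: axis_def)
  then have "transport N k (\<lambda>\<gamma>. u \<gamma> t) (mi_unit j) = (if k = j then u 0 t else 0) + v j k t" for k
    by (simp add: transport_def v_def)
  then have "(\<Sum>k\<in>UNIV. \<i> * of_real (\<xi> $ k) * transport N k (\<lambda>\<gamma>. u \<gamma> t) (mi_unit j)) =
      (\<Sum>k\<in>UNIV. (if k = j then \<i> * of_real (\<xi> $ k) * u 0 t else 0) + \<i> * of_real (\<xi> $ k) * v j k t)"
    by (intro sum.cong) (auto simp: algebra_simps)
  also have "\<dots> = \<i> * (\<xi> $ j *\<^sub>R u 0 t) + \<i> * (\<Sum>k\<in>UNIV. \<xi> $ k *\<^sub>R v j k t)"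
    by (simp add: sum.distrib sum_distrib_left scaleR_conv_of_real mult_ac)
  finally show ?thesis using ode[OF unit_mem assms, of j] by (simp add: mi_abs_unit algebra_simps)
qed

lemma DERIV_J:
  assumes "t > 0"
  shows "(J has_real_derivative
    p t \<bullet> p t - X\<^sup>2 * (u 0 t \<bullet> u 0 t) - u 0 t \<bullet> q t - (\<i> * u 0 t) \<bullet> p t) (at t)"
proof -
  let ?e' = "\<lambda>j. - (\<i> * (\<xi> $ j *\<^sub>R u 0 t)) - \<i> * (\<Sum>k\<in>UNIV. \<xi> $ k *\<^sub>R v j k t) - u (mi_unit j) t"
  have "(p has_vector_derivative (\<Sum>j\<in>UNIV. \<xi> $ j *\<^sub>R ?e' j)) (at t)"
    unfolding p_def[abs_def] by (intro has_vector_derivative_sum)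
      (use has_vector_derivative_scaleR[OF DERIV_const deriv_unit[OF assms]] in auto)
  moreover have "((\<lambda>t. \<i> * u 0 t) has_vector_derivative \<i> * - (\<i> * p t)) (at t)"
    by (intro has_vector_derivative_mult_right deriv_u0 assms)
  ultimately have *: "(J has_real_derivative
     (\<i> * - (\<i> * p t)) \<bullet> p t + (\<i> * u 0 t) \<bullet> (\<Sum>j\<in>UNIV. \<xi> $ j *\<^sub>R ?e' j)) (at t)"
    unfolding J_def[abs_def] by (intro has_real_derivative_inner)
  have "(\<Sum>j\<in>UNIV. \<xi> $ j *\<^sub>R ?e' j) = - (\<i> * (X\<^sup>2 *\<^sub>R u 0 t)) - \<i> * q t - p t"
  proof -
    have "X\<^sup>2 = (\<Sum>j\<in>UNIV. \<xi> $ j * \<xi> $ j)"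
      by (simp add: power2_norm_eq_inner inner_vec_def)
    then show ?thesis
      by (simp add: q_def p_def scaleR_diff_right sum_subtractf sum_negf scaleR_sum_left scaleR_sum_right
          sum_distrib_left)
  qed
  moreover have "\<i> * - (\<i> * z) = z" "(\<i> * z) \<bullet> (\<i> * w) = z \<bullet> w" for z w
    by (simp_all add: inner_complex_def complex_eq_iff)
  ultimately have "(\<i> * - (\<i> * p t)) \<bullet> p t + (\<i> * u 0 t) \<bullet> (\<Sum>j\<in>UNIV. \<xi> $ j *\<^sub>R ?e' j) =
      p t \<bullet> p t - X\<^sup>2 * (u 0 t \<bullet> u 0 t) - u 0 t \<bullet> q t - (\<i> * u 0 t) \<bullet> p t"
    by (simp only: inner_diff_right inner_minus_right mult_scaleR_right inner_scaleR_right)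
  with * show ?thesis by (simp only:)
qed

lemma E_antimono:
  assumes "0 \<le> s" "s \<le> t"
  shows "E t \<le> E s"
proof -
  have "E t \<le> exp (- 0 * (t - s)) * E s"
  proof (rule exp_decay[OF assms(2)])
    show "continuous_on {s..t} E"
      unfolding E_def[abs_def] mi_energy_def using assms
      by (intro continuous_intros continuous_on_subset[OF cont_u]) auto
    show "\<exists>f'. (E has_real_derivative f') (at r) \<and> f' \<le> - 0 * E r" if "s < r" for r
      using DERIV_E[of r] D_nonneg[of r] that assms by (intro exI[of _ "- 2 * D r"]) auto
  qed
  then show ?thesis by simp
qed

text \<open>With this choice of \<open>\<delta>\<close> the error terms in the derivative of \<open>\<delta> J / (1 + |\<xi>|\<^sup>2)\<close> use up exactly one half
of the dissipation \<open>2 D\<close>.\<close>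

definition "\<delta> = 1 / (2 * n ^ 4)"
definition "\<Lambda> t = E t + \<delta> / (1 + X\<^sup>2) * J t"
definition "rate = X\<^sup>2 / (1 + X\<^sup>2)"

lemma one_plus_X2: "0 < 1 + X\<^sup>2"
  by (simp add: add_pos_nonneg)

lemma rate_bounds: "0 \<le> rate" "rate \<le> 1"
  using one_plus_X2 by (auto simp: rate_def divide_le_eq)

lemma \<delta>_bounds: "0 < \<delta>" "\<delta> * (2 * n ^ 4) = 1" "\<delta> * n \<le> 1 / 2" "\<delta> \<le> 1"
proof -
  have n4: "1 \<le> n ^ 4" using n1 by (rule one_le_power)
  then have n0: "0 < 2 * n ^ 4" "1 \<le> 2 * n ^ 4" by linarith+
  then show p: "0 < \<delta>" and e: "\<delta> * (2 * n ^ 4) = 1" and "\<delta> \<le> 1"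
    using n1 by (auto simp: \<delta>_def divide_le_eq_1)
  have "n \<le> n ^ 4" using power_increasing[of 1 4 n] n1 by simp
  then have "\<delta> * n \<le> \<delta> * n ^ 4" using p by (intro mult_left_mono) auto
  with e show "\<delta> * n \<le> 1 / 2" by linarith
qed

lemma \<Lambda>_equiv: "3 / 4 * E t \<le> \<Lambda> t" "\<Lambda> t \<le> 5 / 4 * E t"
proof -
  have "\<bar>J t\<bar> \<le> norm (\<i> * u 0 t) * norm (p t)" unfolding J_def by (rule Cauchy_Schwarz_ineq2)
  also have "\<dots> = norm (u 0 t) * norm (p t)" by (simp add: norm_mult)
  also have "\<dots> \<le> sqrt (E t) * (n * X * sqrt (E t))"
    using u0_le_E[of t] E_nonneg[of t]
    by (intro mult_mono norm_p_le norm_unit_le_E real_le_rsqrt) (auto simp: power2_norm_eq_inner)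
  also have "\<dots> = n * X * E t" using E_nonneg[of t] by (simp add: mult_ac)
  finally have J: "\<bar>J t\<bar> \<le> n * X * E t" .
  have "2 * X \<le> 1 + X\<^sup>2" using zero_le_power2[of "1 - X"] by (simp add: power2_diff)
  then have X: "X / (1 + X\<^sup>2) \<le> 1 / 2" using one_plus_X2 by (simp add: divide_le_eq)
  have "\<bar>\<delta> / (1 + X\<^sup>2) * J t\<bar> = \<delta> / (1 + X\<^sup>2) * \<bar>J t\<bar>"
    using \<delta>_bounds(1) one_plus_X2 by (simp add: abs_mult)
  also have "\<dots> \<le> \<delta> / (1 + X\<^sup>2) * (n * X * E t)"
    using J \<delta>_bounds(1) one_plus_X2 by (intro mult_left_mono) auto
  also have "\<dots> = (\<delta> * n) * (X / (1 + X\<^sup>2)) * E t" by simp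
  also have "\<dots> \<le> (1 / 2) * (1 / 2) * E t"
    using \<delta>_bounds X E_nonneg[of t] one_plus_X2 n1 by (intro mult_right_mono mult_mono) auto
  finally have "\<bar>\<delta> / (1 + X\<^sup>2) * J t\<bar> \<le> 1 / 4 * E t" by simp
  then show "3 / 4 * E t \<le> \<Lambda> t" "\<Lambda> t \<le> 5 / 4 * E t" unfolding \<Lambda>_def by linarith+
qed

text \<open>Young's inequality moves half of the good term \<open>- |\<xi>|\<^sup>2 |u 0|\<^sup>2\<close> onto the products of \<open>u 0\<close> with the
first and second moments, a quarter for each.\<close>

lemma J_deriv_le:
  "p t \<bullet> p t - X\<^sup>2 * (u 0 t \<bullet> u 0 t) - u 0 t \<bullet> q t - (\<i> * u 0 t) \<bullet> p t
    \<le> - (X\<^sup>2 * (u 0 t \<bullet> u 0 t)) / 2 + 2 * n ^ 4 * (1 + X\<^sup>2) * D t"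
proof -
  define U where "U = norm (u 0 t)"
  define d where "d = sqrt (D t)"
  have D: "D t = d\<^sup>2" "0 \<le> d" using D_nonneg[of t] by (auto simp: d_def)
  have p: "norm (p t) \<le> n * X * d" unfolding d_def by (rule norm_p_le) (rule norm_unit_le_D)
  have "p t \<bullet> p t \<le> (n * X * d)\<^sup>2"
    using power_mono[OF p norm_ge_zero, of 2] by (simp add: power2_norm_eq_inner)
  moreover have "- (u 0 t \<bullet> q t) \<le> U * (n\<^sup>2 * X\<^sup>2 * d)"
  proof -
    have "- (u 0 t \<bullet> q t) \<le> norm (u 0 t) * norm (q t)"
      using Cauchy_Schwarz_ineq2[of "u 0 t" "q t"] by linarith
    also have "\<dots> \<le> U * (n\<^sup>2 * X\<^sup>2 * d)"
      using norm_q_le[of t] unfolding U_def d_def by (intro mult_left_mono) auto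
    finally show ?thesis .
  qed
  moreover have "- ((\<i> * u 0 t) \<bullet> p t) \<le> U * (n * X * d)"
  proof -
    have "- ((\<i> * u 0 t) \<bullet> p t) \<le> norm (\<i> * u 0 t) * norm (p t)"
      using Cauchy_Schwarz_ineq2[of "\<i> * u 0 t" "p t"] by linarith
    also have "\<dots> \<le> U * (n * X * d)"
      using p by (simp add: norm_mult U_def mult_left_mono)
    finally show ?thesis .
  qed
  moreover have "U * (n\<^sup>2 * X\<^sup>2 * d) \<le> X\<^sup>2 * U\<^sup>2 / 4 + n ^ 4 * X\<^sup>2 * d\<^sup>2"
  proof -
    have "0 \<le> X\<^sup>2 * (U - 2 * n\<^sup>2 * d)\<^sup>2" by simp
    also have "\<dots> = X\<^sup>2 * U\<^sup>2 + 4 * (n ^ 4 * X\<^sup>2 * d\<^sup>2) - 4 * (U * (n\<^sup>2 * X\<^sup>2 * d))"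
      by algebra
    finally show ?thesis by simp
  qed
  moreover have "U * (n * X * d) \<le> X\<^sup>2 * U\<^sup>2 / 4 + n\<^sup>2 * d\<^sup>2"
  proof -
    have "0 \<le> (X * U - 2 * n * d)\<^sup>2" by simp
    also have "\<dots> = X\<^sup>2 * U\<^sup>2 + 4 * (n\<^sup>2 * d\<^sup>2) - 4 * (U * (n * X * d))"
      by algebra
    finally show ?thesis by simp
  qed
  moreover have "n\<^sup>2 * d\<^sup>2 \<le> n ^ 4 * d\<^sup>2" "(n * X * d)\<^sup>2 \<le> n ^ 4 * X\<^sup>2 * d\<^sup>2"
  proof -
    have n24: "n\<^sup>2 \<le> n ^ 4" using n1 by (rule power_increasing[rotated]) simp
    then show "n\<^sup>2 * d\<^sup>2 \<le> n ^ 4 * d\<^sup>2" by (intro mult_right_mono) auto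
    from n24 have "n\<^sup>2 * (X\<^sup>2 * d\<^sup>2) \<le> n ^ 4 * (X\<^sup>2 * d\<^sup>2)" by (intro mult_right_mono) auto
    then show "(n * X * d)\<^sup>2 \<le> n ^ 4 * X\<^sup>2 * d\<^sup>2" by (simp add: power_mult_distrib)
  qed
  moreover have "0 \<le> n ^ 4 * d\<^sup>2" by simp
  moreover have "2 * n ^ 4 * (1 + X\<^sup>2) * D t = 2 * (n ^ 4 * d\<^sup>2) + 2 * (n ^ 4 * X\<^sup>2 * d\<^sup>2)"
    by (simp add: D algebra_simps)
  moreover have "X\<^sup>2 * (u 0 t \<bullet> u 0 t) = X\<^sup>2 * U\<^sup>2" by (simp add: U_def power2_norm_eq_inner)
  ultimately show ?thesis by linarith
qed

text \<open>The function \<open>\<Lambda>\<close> is equivalent to the energy and its derivative is at most \<open>- D - \<delta> rate |u 0|\<^sup>2 / 2\<close>, which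
dominates \<open>- \<delta> rate E / 2\<close>.\<close>

lemma hypocoercive_decay:
  assumes "0 \<le> s" "s \<le> t"
  shows "E t \<le> 2 * exp (- (rate / (5 * n ^ 4)) * (t - s)) * E s"
proof -
  let ?\<kappa> = "rate / (5 * n ^ 4)"
  have \<kappa>: "?\<kappa> = 2 / 5 * (\<delta> * rate)"
    using n1 by (simp add: \<delta>_def)
  have "\<Lambda> t \<le> exp (- ?\<kappa> * (t - s)) * \<Lambda> s"
  proof (rule exp_decay[OF assms(2)])
    show "continuous_on {s..t} \<Lambda>"
      unfolding \<Lambda>_def[abs_def] E_def J_def p_def mi_energy_def using assms zero_mem unit_mem
      by (intro continuous_intros continuous_on_subset[OF cont_u]) auto
    fix r assume r: "s < r" "r < t"
    let ?J' = "p r \<bullet> p r - X\<^sup>2 * (u 0 r \<bullet> u 0 r) - u 0 r \<bullet> q r - (\<i> * u 0 r) \<bullet> p r"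
    let ?U = "u 0 r \<bullet> u 0 r"
    have "(\<Lambda> has_real_derivative - 2 * D r + \<delta> / (1 + X\<^sup>2) * ?J') (at r)"
      unfolding \<Lambda>_def[abs_def] using r assms by (intro DERIV_add DERIV_cmult DERIV_E DERIV_J) auto
    moreover have "- 2 * D r + \<delta> / (1 + X\<^sup>2) * ?J' \<le> - ?\<kappa> * \<Lambda> r"
    proof -
      have "\<delta> / (1 + X\<^sup>2) * ?J' \<le> \<delta> / (1 + X\<^sup>2) * (- (X\<^sup>2 * ?U) / 2 + 2 * n ^ 4 * (1 + X\<^sup>2) * D r)"
        using J_deriv_le[of r] \<delta>_bounds(1) one_plus_X2 by (intro mult_left_mono) auto
      also have "\<dots> = - (\<delta> * rate * ?U) / 2 + (\<delta> * (2 * n ^ 4)) * D r"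
        using one_plus_X2 by (simp add: rate_def field_simps)
      also have "\<dots> = - (\<delta> * rate * ?U) / 2 + D r" by (simp only: \<delta>_bounds(2) mult_1)
      finally have 1: "- 2 * D r + \<delta> / (1 + X\<^sup>2) * ?J' \<le> - D r - (\<delta> * rate * ?U) / 2" by simp
      have "\<delta> * rate \<le> 1 * 1" using \<delta>_bounds rate_bounds by (intro mult_mono) auto
      then have "\<delta> * rate * D r \<le> 1 * D r" using D_nonneg by (intro mult_right_mono) auto
      moreover have "0 \<le> \<delta> * rate * D r" using \<delta>_bounds rate_bounds D_nonneg[of r] by simp
      moreover have "\<delta> * rate * E r \<le> \<delta> * rate * (?U + D r)"
        using E_le[of r] \<delta>_bounds rate_bounds by (intro mult_left_mono) auto
      moreover have "\<delta> * rate * \<Lambda> r \<le> \<delta> * rate * (5 / 4 * E r)"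
        using \<Lambda>_equiv(2)[of r] \<delta>_bounds rate_bounds by (intro mult_left_mono) auto
      moreover have "\<delta> * rate * (?U + D r) = \<delta> * rate * ?U + \<delta> * rate * D r" by (simp add: algebra_simps)
      ultimately show ?thesis using 1 unfolding \<kappa> by simp
    qed
    ultimately show "\<exists>f'. (\<Lambda> has_real_derivative f') (at r) \<and> f' \<le> - ?\<kappa> * \<Lambda> r" by blast
  qed
  also have "\<dots> \<le> exp (- ?\<kappa> * (t - s)) * (5 / 4 * E s)"
    by (intro mult_left_mono \<Lambda>_equiv) auto
  finally have "3 / 4 * E t \<le> exp (- ?\<kappa> * (t - s)) * (5 / 4 * E s)"
    using \<Lambda>_equiv(1)[of t] by linarith
  moreover have "0 \<le> exp (- ?\<kappa> * (t - s)) * E s" using E_nonneg[of s] by simp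
  ultimately show ?thesis by (simp add: mult.assoc)
qed

text \<open>The component \<open>u 0\<close> exchanges energy with the others only at a rate proportional to \<open>|\<xi>|\<close>, while the others are damped
with rate at least 1. So for small \<open>|\<xi>|\<close> and large \<open>t\<close> little more than the initial energy of \<open>u 0\<close> is left.\<close>

lemma low_frequency:
  assumes t: "0 \<le> t"
  shows "E t \<le> (norm (u 0 0))\<^sup>2 + E 0 * (exp (- t) + n\<^sup>2 * X\<^sup>2 + 2 * n * X * t)"
proof -
  let ?U = "\<lambda>r. u 0 r \<bullet> u 0 r"
  define K where "K = n\<^sup>2 * X\<^sup>2 * E 0"
  define M where "M = 2 * n * X * E 0"
  have DU: "(?U has_real_derivative - 2 * ((\<i> * p r) \<bullet> u 0 r)) (at r)" if "0 < r" for r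
    using has_real_derivative_inner[OF deriv_u0[OF that] deriv_u0[OF that]]
    by (simp add: inner_commute)
  have contU: "continuous_on {0..t} ?U"
    using zero_mem by (intro continuous_intros cont_u)
  have contE: "continuous_on {0..t} E"
    unfolding E_def[abs_def] mi_energy_def by (intro continuous_intros cont_u)
  have ip: "\<bar>(\<i> * p r) \<bullet> u 0 r\<bar> \<le> norm (p r) * norm (u 0 r)" for r
    using Cauchy_Schwarz_ineq2[of "\<i> * p r" "u 0 r"] by (simp add: norm_mult)
  have U_le: "norm (u 0 r) \<le> sqrt (E r)" for r
    using u0_le_E[of r] by (intro real_le_rsqrt) (simp add: power2_norm_eq_inner)
  have "?U t - M * t \<le> exp (- 0 * (t - 0)) * (?U 0 - M * 0)"
  proof (rule exp_decay[OF t])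
    show "continuous_on {0..t} (\<lambda>r. ?U r - M * r)" by (intro continuous_intros contU)
    fix r assume r: "0 < r" "r < t"
    have "norm (p r) * norm (u 0 r) \<le> (n * X * sqrt (E r)) * sqrt (E r)"
      using U_le E_nonneg[of r] n1 by (intro mult_mono norm_p_le norm_unit_le_E) auto
    also have "\<dots> = n * X * E r" using E_nonneg[of r] by simp
    also have "\<dots> \<le> n * X * E 0" using E_antimono[of 0 r] r n1 by (intro mult_left_mono) auto
    finally have "- 2 * ((\<i> * p r) \<bullet> u 0 r) - M \<le> 0" using ip[of r] unfolding M_def by linarith
    moreover have "((\<lambda>r. ?U r - M * r) has_real_derivative - 2 * ((\<i> * p r) \<bullet> u 0 r) - M) (at r)"
      using r by (intro DERIV_diff DU) (auto intro!: derivative_eq_intros)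
    ultimately show "\<exists>f'. ((\<lambda>r. ?U r - M * r) has_real_derivative f') (at r) \<and> f' \<le> - 0 * (?U r - M * r)"
      by auto
  qed
  then have U: "?U t \<le> ?U 0 + M * t" by simp
  \<comment> \<open>\<open>E - |u 0|\<^sup>2\<close> is at most \<open>D\<close> and is forced only through its coupling to \<open>u 0\<close>, with strength \<open>K\<close>.\<close>
  have "(E t - ?U t) - K \<le> exp (- 1 * (t - 0)) * ((E 0 - ?U 0) - K)"
  proof (rule exp_decay[OF t])
    show "continuous_on {0..t} (\<lambda>r. (E r - ?U r) - K)" by (intro continuous_intros contU contE)
    fix r assume r: "0 < r" "r < t"
    define d where "d = sqrt (D r)"
    have d: "D r = d\<^sup>2" using D_nonneg[of r] by (simp add: d_def)
    have "norm (p r) * norm (u 0 r) \<le> (n * X * d) * norm (u 0 r)"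
      unfolding d_def by (intro mult_right_mono norm_p_le norm_unit_le_D) auto
    moreover have "2 * ((n * X * d) * norm (u 0 r)) \<le> d\<^sup>2 + n\<^sup>2 * X\<^sup>2 * (norm (u 0 r))\<^sup>2"
      using zero_le_power2[of "d - n * X * norm (u 0 r)"]
      by (simp add: power2_diff power_mult_distrib mult_ac)
    moreover have "n\<^sup>2 * X\<^sup>2 * (norm (u 0 r))\<^sup>2 \<le> K"
      unfolding K_def using u0_le_E[of r] E_antimono[of 0 r] r
      by (intro mult_left_mono) (auto simp: power2_norm_eq_inner)
    ultimately have "2 * ((\<i> * p r) \<bullet> u 0 r) \<le> D r + K" using ip[of r] d by linarith
    then have "- 2 * D r - - 2 * ((\<i> * p r) \<bullet> u 0 r) - 0 \<le> - 1 * ((E r - ?U r) - K)"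
      using E_le[of r] by (simp add: algebra_simps)
    moreover have "((\<lambda>r. (E r - ?U r) - K) has_real_derivative - 2 * D r - - 2 * ((\<i> * p r) \<bullet> u 0 r) - 0) (at r)"
      using r by (intro DERIV_diff DU DERIV_E DERIV_const) auto
    ultimately show "\<exists>f'. ((\<lambda>r. (E r - ?U r) - K) has_real_derivative f') (at r) \<and> f' \<le> - 1 * ((E r - ?U r) - K)"
      by blast
  qed
  also have "\<dots> \<le> exp (- t) * E 0"
  proof -
    have "0 \<le> K" using E_nonneg[of 0] by (simp add: K_def)
    then have "(E 0 - ?U 0) - K \<le> E 0" using inner_ge_zero[of "u 0 0"] by linarith
    then show ?thesis by simp
  qed
  finally show ?thesis
    using U unfolding K_def M_def by (simp add: algebra_simps power2_norm_eq_inner)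
qed

end

section \<open>Galerkin solutions in Fourier space\<close>

locale supported_galerkin_solution = galerkin_solution N m0 m
  for N :: nat and m0 :: "nat ^ 'n::finite \<Rightarrow> real ^ 'n \<Rightarrow> complex" and m +
  fixes R\<^sub>0 :: real
  assumes init_support: "\<And>\<beta> x. \<beta> \<in> mi_upto N \<Longrightarrow> norm x > R\<^sub>0 \<Longrightarrow> m0 \<beta> x = 0"
begin

lemma common_box:
  obtains b where "\<And>\<beta> t x. \<beta> \<in> mi_upto N \<Longrightarrow> 0 \<le> t \<Longrightarrow> t \<le> T \<Longrightarrow> x \<notin> cbox (- b) b \<Longrightarrow> m \<beta> t x = 0"
proof -
  define r where "r = R\<^sub>0 + 1 + real CARD('n) * (real N + 1) * T"
  obtain b where b: "cball 0 r \<subseteq> cbox (- b) (b :: real ^ 'n)"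
    using bounded_subset_cbox_symmetric[OF bounded_cball] .
  show ?thesis
  proof (rule that)
    fix \<beta> :: "nat ^ 'n" and t and x :: "real ^ 'n" assume *: "\<beta> \<in> mi_upto N" "0 \<le> t" "t \<le> T" "x \<notin> cbox (- b) b"
    have "norm x > r" using b *(4) by (metis in_mono mem_cball_0 not_le)
    moreover have "real CARD('n) * (real N + 1) * t \<le> real CARD('n) * (real N + 1) * T"
      using *(3) by (intro mult_left_mono) auto
    ultimately have "norm x > R\<^sub>0 + 1 + real CARD('n) * (real N + 1) * t" unfolding r_def by linarith
    then show "m \<beta> t x = 0" using compact_support[OF init_support] * by blast
  qed
qed

lemma continuous_on_fourier_m:
  assumes b: "\<beta> \<in> mi_upto N"
  shows "continuous_on {0..T} (\<lambda>t. fourier (m \<beta> t) \<xi>)"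
proof -
  obtain b where v: "\<And>\<beta> t x. \<beta> \<in> mi_upto N \<Longrightarrow> 0 \<le> t \<Longrightarrow> t \<le> T \<Longrightarrow> x \<notin> cbox (- b) b \<Longrightarrow> m \<beta> t x = 0"
    by (rule common_box[of T]) blast
  show ?thesis
    unfolding fourier_def
  proof (rule continuous_on_integral_vanishing)
    have "continuous_on ({0..T} \<times> UNIV) (\<lambda>z. (\<lambda>(t, x). m \<beta> t x) z)"
      by (rule continuous_on_subset[OF cont_m[OF b]]) auto
    then have "continuous_on ({0..T} \<times> UNIV) (\<lambda>z. cis (- (\<xi> \<bullet> snd z)) * (\<lambda>(t, x). m \<beta> t x) z)"
      by (intro continuous_intros)
    then show "continuous_on ({0..T} \<times> UNIV) (\<lambda>(t, x). cis (- (\<xi> \<bullet> x)) * m \<beta> t x)"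
      by (simp add: case_prod_beta)
    show "cis (- (\<xi> \<bullet> x)) * m \<beta> t x = 0" if "t \<in> {0..T}" "x \<notin> cbox (- b) b" for t x
      using v[OF b, of t x] that by simp
  qed
qed

text \<open>Differentiation in time under the integral sign; the equation then expresses the integrand by spatial derivatives, whose
transforms are multiples of the transforms of the components.\<close>

lemma fourier_m_ode:
  assumes b: "\<beta> \<in> mi_upto N" and t: "t > 0"
  shows "((\<lambda>s. fourier (m \<beta> s) \<xi>) has_vector_derivative
    - (\<Sum>k\<in>UNIV. \<i> * of_real (\<xi> $ k) * transport N k (\<lambda>\<gamma>. fourier (m \<gamma> t) \<xi>) \<beta>)
    - of_nat (mi_abs \<beta>) * fourier (m \<beta> t) \<xi>) (at t)"
proof -
  let ?e = "\<lambda>x. cis (- (\<xi> \<bullet> x))"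
  let ?S = "mi_upto N :: (nat ^ 'n) set"
  obtain b where v: "\<And>\<beta> s x. \<beta> \<in> ?S \<Longrightarrow> 0 \<le> s \<Longrightarrow> s \<le> t + 1 \<Longrightarrow> x \<notin> cbox (- b) b \<Longrightarrow> m \<beta> s x = 0"
    by (rule common_box[of "t + 1"]) blast
  have vt: "m \<gamma> t x = 0" if "\<gamma> \<in> ?S" "x \<notin> cbox (- b) b" for \<gamma> x
    using v[OF that(1) _ _ that(2), of t] t by simp
  have D: "((\<lambda>s. fourier (m \<beta> s) \<xi>) has_vector_derivative (\<integral>x. ?e x * mt \<beta> t x \<partial>lborel)) (at t)"
    unfolding fourier_def
  proof (rule has_vector_derivative_integral_vanishing[where U="{0<..<t+1}"])
    show "continuous_on UNIV (\<lambda>x. ?e x * m \<beta> s x)" if "s \<in> {0<..<t+1}" for s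
      using that by (intro continuous_intros cont_slice(1)[OF assms(1)]) auto
    show "((\<lambda>s. ?e x * m \<beta> s x) has_vector_derivative ?e x * mt \<beta> s x) (at s)" if "s \<in> {0<..<t+1}" for s x
      using that by (intro has_vector_derivative_mult_right has_vector_derivative_m assms(1)) auto
    have "continuous_on ({0<..<t+1} \<times> UNIV) (\<lambda>z. (\<lambda>(t, x). mt \<beta> t x) z)"
      by (rule continuous_on_subset[OF cont_mt[OF assms(1)]]) auto
    then have "continuous_on ({0<..<t+1} \<times> UNIV) (\<lambda>z. ?e (snd z) * (\<lambda>(t, x). mt \<beta> t x) z)"
      by (intro continuous_intros)
    then show "continuous_on ({0<..<t+1} \<times> UNIV) (\<lambda>(s, x). ?e x * mt \<beta> s x)"
      by (simp add: case_prod_beta)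
    show "?e x * m \<beta> s x = 0" if "s \<in> {0<..<t+1}" "x \<notin> cbox (- b) b" for s x
      using v[OF assms(1), of s x] that by simp
  qed (use t in auto)
  have hm: "has_bochner_integral lborel (\<lambda>x. ?e x * m \<gamma> t x) (fourier (m \<gamma> t) \<xi>)" if "\<gamma> \<in> ?S" for \<gamma>
    unfolding has_bochner_integral_iff fourier_def
  proof (intro conjI refl integral_vanishing_outside_cbox(1))
    show "continuous_on UNIV (\<lambda>x. ?e x * m \<gamma> t x)"
      using t by (intro continuous_intros cont_slice(1)[OF that]) auto
    show "?e x * m \<gamma> t x = 0" if "x \<notin> cbox (- b) b" for x using vt[OF \<open>\<gamma> \<in> ?S\<close> that] by simp
  qed
  have hx: "has_bochner_integral lborel (\<lambda>x. ?e x * mx k \<gamma> t x) (\<i> * of_real (\<xi> $ k) * fourier (m \<gamma> t) \<xi>)"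
    if g: "\<gamma> \<in> ?S" for \<gamma> k
  proof -
    have vx: "mx k \<gamma> t x = 0" if "x \<notin> cbox (- b) b" for x
      by (rule partial_deriv_vanishing[OF has_partial_deriv_m[OF g t] vt[OF g] closed_cbox that])
    have "fourier (mx k \<gamma> t) \<xi> = \<i> * of_real (\<xi> $ k) * fourier (m \<gamma> t) \<xi>"
      using t by (intro fourier_partial_deriv[where a="- b" and b=b] cont_slice[OF g] has_partial_deriv_m[OF g] vt[OF g]) auto
    moreover have "integrable lborel (\<lambda>x. ?e x * mx k \<gamma> t x)"
    proof (rule integral_vanishing_outside_cbox(1))
      show "continuous_on UNIV (\<lambda>x. ?e x * mx k \<gamma> t x)"
        using t by (intro continuous_intros cont_slice(2)[OF g]) auto
      show "?e x * mx k \<gamma> t x = 0" if "x \<notin> cbox (- b) b" for x using vx[OF that] by simp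
    qed
    ultimately show ?thesis by (simp add: has_bochner_integral_iff fourier_def)
  qed
  have hT: "has_bochner_integral lborel (\<lambda>x. ?e x * transport N k (\<lambda>\<gamma>. mx k \<gamma> t x) \<beta>)
      (\<i> * of_real (\<xi> $ k) * transport N k (\<lambda>\<gamma>. fourier (m \<gamma> t) \<xi>) \<beta>)" for k
  proof -
    have "has_bochner_integral lborel (\<lambda>x. transport N k (\<lambda>\<gamma>. ?e x * mx k \<gamma> t x) \<beta>)
        (transport N k (\<lambda>\<gamma>. \<i> * of_real (\<xi> $ k) * fourier (m \<gamma> t) \<xi>) \<beta>)"
      unfolding transport_def
      by (intro has_bochner_integral_add has_bochner_integral_mult_right hx mi_diff_unit_upto assms(1))
         (auto intro: hx)
    then show ?thesis by (simp only: transport_mult)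
  qed
  have "has_bochner_integral lborel
     (\<lambda>x. - (\<Sum>k\<in>UNIV. ?e x * transport N k (\<lambda>\<gamma>. mx k \<gamma> t x) \<beta>) - of_nat (mi_abs \<beta>) * (?e x * m \<beta> t x))
     (- (\<Sum>k\<in>UNIV. \<i> * of_real (\<xi> $ k) * transport N k (\<lambda>\<gamma>. fourier (m \<gamma> t) \<xi>) \<beta>)
       - of_nat (mi_abs \<beta>) * fourier (m \<beta> t) \<xi>)"
    by (intro has_bochner_integral_diff has_bochner_integral_minus has_bochner_integral_sum hT
        has_bochner_integral_mult_right hm assms(1))
  also have "(\<lambda>x. - (\<Sum>k\<in>UNIV. ?e x * transport N k (\<lambda>\<gamma>. mx k \<gamma> t x) \<beta>) - of_nat (mi_abs \<beta>) * (?e x * m \<beta> t x)) =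
      (\<lambda>x. ?e x * mt \<beta> t x)"
    by (rule ext) (simp add: pde[OF assms] sum_distrib_left[symmetric] algebra_simps)
  finally show ?thesis using D by (simp add: has_bochner_integral_iff)
qed

lemma symbol_ode_fourier:
  assumes "N \<ge> 1"
  shows "symbol_ode N \<xi> (\<lambda>\<beta> t. fourier (m \<beta> t) \<xi>) (real CARD('n))"
  by unfold_locales (use assms continuous_on_fourier_m fourier_m_ode in auto)

end

lemma L2_set_mi_weight:
  "sqrt (mi_energy N u) = L2_set (\<lambda>\<beta>. sqrt (mi_weight \<beta>) * norm (u \<beta>)) (mi_upto N)"
  unfolding mi_energy_def L2_set_def
  by (simp add: power_mult_distrib power2_norm_eq_inner mi_weight_pos less_imp_le)

text \<open>Minkowski's integral inequality by duality: the scalar function \<open>g\<close> pairs the vector \<open>f\<close> with its value at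
\<open>x\<close>, so that \<open>g x\<close> is the energy at \<open>x\<close>, and the Cauchy-Schwarz inequality bounds the transform of \<open>g\<close>.
Estimating the components separately would lose a factor depending on \<open>N\<close>.\<close>

lemma sqrt_mi_energy_le_integral_fourier:
  fixes f :: "nat ^ 'n::finite \<Rightarrow> real ^ 'n \<Rightarrow> complex"
  assumes cont: "\<And>\<beta>. \<beta> \<in> mi_upto N \<Longrightarrow> continuous_on UNIV (f \<beta>)"
    and van: "\<And>\<beta> x. \<beta> \<in> mi_upto N \<Longrightarrow> x \<notin> cbox a b \<Longrightarrow> f \<beta> x = 0"
    and h: "integrable lborel h" "\<And>\<xi>. sqrt (mi_energy N (\<lambda>\<beta>. fourier (f \<beta>) \<xi>)) \<le> h \<xi>"
  shows "sqrt (mi_energy N (\<lambda>\<beta>. f \<beta> x)) \<le> (\<integral>\<xi>. h \<xi> \<partial>lborel)"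
proof -
  let ?S = "mi_upto N :: (nat ^ 'n) set"
  define r where "r = sqrt (mi_energy N (\<lambda>\<beta>. f \<beta> x))"
  have r0: "0 \<le> r" by (simp add: r_def mi_energy_nonneg)
  define g where "g y = (\<Sum>\<beta>\<in>?S. (of_real (mi_weight \<beta>) * cnj (f \<beta> x)) * f \<beta> y)" for y
  have "norm (g x) \<le> (\<integral>\<xi>. r * h \<xi> \<partial>lborel)"
  proof (rule sup_le_integral_fourier)
    show "continuous_on UNIV g" unfolding g_def by (intro continuous_intros cont)
    show "g y = 0" if "y \<notin> cbox a b" for y
      unfolding g_def by (rule sum.neutral) (simp add: van that)
    show "integrable lborel (\<lambda>\<xi>. r * h \<xi>)" using h(1) by simp
    fix \<xi>
    have int: "integrable lborel (\<lambda>y. cis (- (\<xi> \<bullet> y)) * f \<beta> y)" if "\<beta> \<in> ?S" for \<beta>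
      by (rule integral_vanishing_outside_cbox(1)[of _ a b])
         (use that van in \<open>auto intro!: continuous_intros cont\<close>)
    have "fourier g \<xi> = (\<integral>y. (\<Sum>\<beta>\<in>?S. (of_real (mi_weight \<beta>) * cnj (f \<beta> x)) * (cis (- (\<xi> \<bullet> y)) * f \<beta> y)) \<partial>lborel)"
      unfolding fourier_def g_def by (simp add: sum_distrib_left mult_ac)
    also have "\<dots> = (\<Sum>\<beta>\<in>?S. (of_real (mi_weight \<beta>) * cnj (f \<beta> x)) * fourier (f \<beta>) \<xi>)"
      unfolding fourier_def using int by (subst Bochner_Integration.integral_sum) auto
    finally have "norm (fourier g \<xi>) \<le> (\<Sum>\<beta>\<in>?S. norm ((of_real (mi_weight \<beta>) * cnj (f \<beta> x)) * fourier (f \<beta>) \<xi>))"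
      by (simp add: norm_sum)
    also have "\<dots> = (\<Sum>\<beta>\<in>?S. \<bar>sqrt (mi_weight \<beta>) * norm (f \<beta> x)\<bar> * \<bar>sqrt (mi_weight \<beta>) * norm (fourier (f \<beta>) \<xi>)\<bar>)"
    proof (rule sum.cong[OF refl])
      fix \<beta> :: "nat ^ 'n"
      have "mi_weight \<beta> = sqrt (mi_weight \<beta>) * sqrt (mi_weight \<beta>)" using mi_weight_pos[of \<beta>] by simp
      then show "norm ((of_real (mi_weight \<beta>) * cnj (f \<beta> x)) * fourier (f \<beta>) \<xi>) =
          \<bar>sqrt (mi_weight \<beta>) * norm (f \<beta> x)\<bar> * \<bar>sqrt (mi_weight \<beta>) * norm (fourier (f \<beta>) \<xi>)\<bar>"
        using mi_weight_pos[of \<beta>] by (simp add: norm_mult abs_mult)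
    qed
    also have "\<dots> \<le> L2_set (\<lambda>\<beta>. sqrt (mi_weight \<beta>) * norm (f \<beta> x)) ?S * L2_set (\<lambda>\<beta>. sqrt (mi_weight \<beta>) * norm (fourier (f \<beta>) \<xi>)) ?S"
      by (rule L2_set_mult_ineq)
    also have "\<dots> = r * sqrt (mi_energy N (\<lambda>\<beta>. fourier (f \<beta>) \<xi>))"
      by (simp add: L2_set_mi_weight r_def)
    also have "\<dots> \<le> r * h \<xi>" using h(2) r0 by (rule mult_left_mono)
    finally show "norm (fourier g \<xi>) \<le> r * h \<xi>" .
  qed
  moreover have "g x = of_real (r\<^sup>2)"
  proof -
    have "g x = (\<Sum>\<beta>\<in>?S. of_real (mi_weight \<beta> * (f \<beta> x \<bullet> f \<beta> x)))"
      unfolding g_def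
    proof (rule sum.cong[OF refl])
      fix \<beta>
      have "cnj (f \<beta> x) * f \<beta> x = of_real (f \<beta> x \<bullet> f \<beta> x)"
        by (metis complex_norm_square mult.commute power2_norm_eq_inner)
      then show "of_real (mi_weight \<beta>) * cnj (f \<beta> x) * f \<beta> x = of_real (mi_weight \<beta> * (f \<beta> x \<bullet> f \<beta> x))"
        by (simp add: mult.assoc)
    qed
    moreover have "r\<^sup>2 = mi_energy N (\<lambda>\<beta>. f \<beta> x)" by (simp add: r_def mi_energy_nonneg)
    ultimately show ?thesis by (simp only: mi_energy_def of_real_sum)
  qed
  ultimately have "r * r \<le> r * (\<integral>\<xi>. h \<xi> \<partial>lborel)"
    using r0 by (simp add: power2_eq_square norm_mult)
  moreover have "0 \<le> (\<integral>\<xi>. h \<xi> \<partial>lborel)"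
  proof (rule Bochner_Integration.integral_nonneg)
    show "0 \<le> h \<xi>" for \<xi>
      using h(2)[of \<xi>] mi_energy_nonneg[of N "\<lambda>\<beta>. fourier (f \<beta>) \<xi>"] by (meson order_trans real_sqrt_ge_zero)
  qed
  ultimately show ?thesis
    using r0 unfolding r_def[symmetric] by (cases "r = 0") auto
qed

text \<open>For \<open>N = 0\<close> the polynomial is \<open>\<tau>\<close>, which has the real root \<open>0\<close> at every frequency.\<close>

lemma not_strongly_stable_0: "\<not> strongly_stable (fp_poly 0 :: complex \<Rightarrow> real ^ 'n::finite \<Rightarrow> complex)"
proof
  assume "strongly_stable (fp_poly 0 :: complex \<Rightarrow> real ^ 'n \<Rightarrow> complex)"
  then have st: "fp_poly 0 \<tau> \<xi> = 0 \<Longrightarrow> Im \<tau> = 0 \<Longrightarrow> \<xi> = 0" for \<tau> and \<xi> :: "real ^ 'n"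
    unfolding strongly_stable_def stable_def by blast
  have S: "(mi_upto 0 :: (nat ^ 'n) set) = {0}"
    by (auto simp: mi_upto_def mi_abs_def vec_eq_iff)
  have "fp_poly 0 0 \<xi> = 0" for \<xi> :: "real ^ 'n"
  proof -
    have "(0 :: nat ^ 'n) \<noteq> mi_unit j" for j by (auto simp: vec_eq_iff axis_def)
    then have "fp_A j 0 (0 :: nat ^ 'n) = 0" for j by (auto simp: fp_A_def)
    then show ?thesis
      by (simp add: fp_poly_def det_on_def S permutes_sing fp_B_def mi_abs_0)
  qed
  from st[OF this[of "axis undefined 1"]] show False by (simp add: axis_eq_0_iff)
qed

lemma test_function_support:
  fixes f :: "real ^ 'n::finite \<Rightarrow> complex"
  assumes "test_function f"
  obtains R where "\<And>x. norm x > R \<Longrightarrow> f x = 0"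
proof -
  have "bounded {x. f x \<noteq> 0}"
    using assms unfolding test_function_def
    by (meson bounded_subset closure_subset compact_imp_bounded)
  then obtain R where "\<forall>x\<in>{x. f x \<noteq> 0}. norm x \<le> R" unfolding bounded_iff by blast
  then show ?thesis using that[of R] by fastforce
qed

lemma test_function_fourier_decay:
  fixes f :: "real ^ 'n::finite \<Rightarrow> complex"
  assumes f: "test_function f"
  shows "\<exists>K\<ge>0. \<forall>\<xi>. norm (fourier f \<xi>) \<le> K * inverse (\<Prod>k\<in>UNIV. 1 + (\<xi> $ k)\<^sup>2)"
proof -
  obtain R where R: "\<And>x. norm x > R \<Longrightarrow> f x = 0" by (rule test_function_support[OF f]) blast
  obtain b where b: "cball 0 R \<subseteq> cbox (- b) (b :: real ^ 'n)"
    using bounded_subset_cbox_symmetric[OF bounded_cball] .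
  have "f x = 0" if "x \<notin> cbox (- b) b" for x
    using R[of x] b that by (metis in_mono mem_cball_0 not_le)
  then obtain K where K: "K \<ge> 0" "\<And>\<xi>. norm (fourier f \<xi>) * (\<Prod>k\<in>UNIV. 1 + (\<xi> $ k)\<^sup>2) \<le> K"
    using fourier_rapid_decay[of f "- b" b] f unfolding test_function_def by blast
  have "0 < (\<Prod>k\<in>UNIV. 1 + (\<xi> $ k)\<^sup>2)" for \<xi> :: "real ^ 'n"
    by (intro prod_pos) (auto simp: add_pos_nonneg)
  then have "norm (fourier f \<xi>) \<le> K * inverse (\<Prod>k\<in>UNIV. 1 + (\<xi> $ k)\<^sup>2)" for \<xi>
    using K(2)[of \<xi>] by (simp add: divide_inverse[symmetric] pos_le_divide_eq)
  with K(1) show ?thesis by blast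
qed

lemma mi_weight_le_1: "mi_weight \<beta> \<le> 1"
proof -
  have "1 \<le> real (mi_fact \<beta>)" using mi_fact_pos[of \<beta>] by linarith
  then show ?thesis by (simp add: mi_weight_def divide_le_eq)
qed

lemma initial_energy_decay:
  fixes m0 :: "nat ^ 'n::finite \<Rightarrow> real ^ 'n \<Rightarrow> complex"
  assumes "\<And>\<beta>. test_function (m0 \<beta>)"
  obtains A where "A \<ge> 0"
    "\<And>\<xi>. sqrt (mi_energy N (\<lambda>\<beta>. fourier (m0 \<beta>) \<xi>)) \<le> A * inverse (\<Prod>k\<in>UNIV. 1 + (\<xi> $ k)\<^sup>2)"
proof -
  let ?S = "mi_upto N :: (nat ^ 'n) set"
  let ?w = "\<lambda>\<xi>::real^'n. inverse (\<Prod>k\<in>UNIV. 1 + (\<xi> $ k)\<^sup>2)"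
  obtain K where K: "\<And>\<beta>. K \<beta> \<ge> 0" "\<And>\<beta> \<xi>. norm (fourier (m0 \<beta>) \<xi>) \<le> K \<beta> * ?w \<xi>"
    using test_function_fourier_decay[OF assms] by metis
  show ?thesis
  proof (rule that)
    show "0 \<le> (\<Sum>\<beta>\<in>?S. K \<beta>)" by (intro sum_nonneg K)
    fix \<xi>
    have "sqrt (mi_energy N (\<lambda>\<beta>. fourier (m0 \<beta>) \<xi>)) \<le> (\<Sum>\<beta>\<in>?S. sqrt (mi_weight \<beta>) * norm (fourier (m0 \<beta>) \<xi>))"
      unfolding L2_set_mi_weight by (rule L2_set_le_sum) (auto simp: mi_weight_pos less_imp_le)
    also have "\<dots> \<le> (\<Sum>\<beta>\<in>?S. 1 * (K \<beta> * ?w \<xi>))"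
      using K mi_weight_le_1 by (intro sum_mono mult_mono) (auto simp: mi_weight_pos less_imp_le)
    finally show "sqrt (mi_energy N (\<lambda>\<beta>. fourier (m0 \<beta>) \<xi>)) \<le> (\<Sum>\<beta>\<in>?S. K \<beta>) * ?w \<xi>"
      by (simp add: sum_distrib_right)
  qed
qed

lemma prod_one_plus_square_ge_1: "1 \<le> (\<Prod>k\<in>UNIV. 1 + ((\<xi> :: real ^ 'n::finite) $ k)\<^sup>2)"
  by (rule prod_ge_1) simp

text \<open>First the waiting time \<open>s\<close> makes the exponential term small, then the radius \<open>\<rho>\<close> of the frequency window makes the other
terms small for this \<open>s\<close>.\<close>

lemma low_frequency_window:
  fixes M n :: real
  assumes "M \<ge> 0" "n \<ge> 0"
  obtains s \<rho> where "s \<ge> 0" "0 < \<rho>" "\<rho> \<le> 1"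
    "\<And>X. 0 \<le> X \<Longrightarrow> X \<le> \<rho> \<Longrightarrow> M * (exp (- s) + n\<^sup>2 * X\<^sup>2 + 2 * n * X * s) \<le> 1"
proof -
  define s where "s = ln (2 * M + 1)"
  define Q where "Q = n\<^sup>2 + 2 * n * s"
  define \<rho> where "\<rho> = 1 / (2 * (M * Q) + 1)"
  have s: "0 \<le> s" using assms by (simp add: s_def)
  have MQ: "0 \<le> M * Q" using assms s by (simp add: Q_def)
  have half: "y / (2 * y + 1) \<le> 1 / 2" if "0 \<le> y" for y :: real
    using that by (simp add: divide_le_eq)
  show ?thesis
  proof (rule that[OF s])
    show "0 < \<rho>" "\<rho> \<le> 1" using MQ by (auto simp: \<rho>_def)
    fix X :: real assume X: "0 \<le> X" "X \<le> \<rho>"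
    have "X \<le> 1" using X(2) \<open>\<rho> \<le> 1\<close> by simp
    then have "X\<^sup>2 \<le> X" using X(1) by (simp add: power2_eq_square mult_left_le)
    then have "n\<^sup>2 * X\<^sup>2 + 2 * n * X * s \<le> X * Q"
      using mult_left_mono[of "X\<^sup>2" X "n\<^sup>2"] by (simp add: Q_def algebra_simps)
    then have "M * (n\<^sup>2 * X\<^sup>2 + 2 * n * X * s) \<le> M * (X * Q)" using assms by (intro mult_left_mono)
    also have "\<dots> = X * (M * Q)" by simp
    also have "\<dots> \<le> \<rho> * (M * Q)" using X MQ by (intro mult_right_mono)
    also have "\<dots> \<le> 1 / 2" using half[OF MQ] by (simp add: \<rho>_def)
    finally have 1: "M * (n\<^sup>2 * X\<^sup>2 + 2 * n * X * s) \<le> 1 / 2" .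
    have "exp (- s) = 1 / (2 * M + 1)" using assms by (simp add: s_def exp_minus inverse_eq_divide)
    then have "M * exp (- s) \<le> 1 / 2" using half[OF assms(1)] by simp
    with 1 show "M * (exp (- s) + n\<^sup>2 * X\<^sup>2 + 2 * n * X * s) \<le> 1" by (simp add: distrib_left)
  qed
qed

section \<open>Decay of the Galerkin approximation\<close>

lemma sqrt_le_exp_decay:
  assumes "e \<le> 2 * exp (- (2 * y)) * z" "0 \<le> z"
  shows "sqrt e \<le> sqrt 2 * exp (- y) * sqrt z"
proof -
  have "exp (- (2 * y)) = (exp (- y))\<^sup>2" by (simp add: exp_double[symmetric])
  then have "sqrt (2 * exp (- (2 * y)) * z) = sqrt 2 * exp (- y) * sqrt z"
    by (simp add: real_sqrt_mult)
  then show ?thesis using real_sqrt_le_mono[OF assms(1)] by simp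
qed

lemma eventually_exp_le_powr:
  fixes K c s k :: real
  assumes "c > 0"
  shows "eventually (\<lambda>t. K * exp (- c * (t - s)) \<le> (1 + t) powr (- k)) at_top"
proof -
  have "((\<lambda>t. K * exp (- c * (t - s)) * (1 + t) powr k) \<longlongrightarrow> 0) at_top"
    using assms by real_asymp
  then have "eventually (\<lambda>t. K * exp (- c * (t - s)) * (1 + t) powr k < 1) at_top"
    by (rule order_tendstoD) simp
  then show ?thesis
    using eventually_gt_at_top[of 0]
  proof eventually_elim
    case (elim t)
    then show ?case by (simp add: powr_minus inverse_eq_divide pos_le_divide_eq less_imp_le)
  qed
qed

text \<open>For times up to \<open>T\<close> the energy is bounded by its initial value. For later times the square root of the energy at frequency
\<open>\<xi>\<close> is at most the sum of a Gaussian, which estimates the frequencies with \<open>|\<xi>| \<le> \<rho>\<close> by restarting the decay at time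
\<open>s\<close>, and an exponentially small multiple of the integrable bound on the initial data. The integral of the Gaussian gives the constant,
into which the higher components of the data do not enter.\<close>

lemma sqrt_energy_decay:
  fixes m0 :: "nat ^ 'n::finite \<Rightarrow> real ^ 'n \<Rightarrow> complex"
  assumes test: "\<And>\<beta>. test_function (m0 \<beta>)" and N: "N \<ge> 1"
    and n: "n = real CARD('n)" and c: "c = 1 / (5 * n ^ 4)"
    and U: "U = (\<integral>x. norm (m0 0 x) \<partial>lborel)"
  shows "\<exists>C\<^sub>N>0. \<forall>m. truncated_solution N m0 m \<longrightarrow> (\<forall>t\<ge>0. \<forall>x.
    sqrt (mi_energy N (\<lambda>\<beta>. m \<beta> t x)) \<le>
      (sqrt 2 * sqrt (U\<^sup>2 + 1) * sqrt (8 * pi / c) ^ CARD('n) + 1) * (1 + t) powr (- n / 2) + C\<^sub>N * exp (- t))"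
proof -
  let ?S = "mi_upto N :: (nat ^ 'n) set"
  define w where "w \<xi> = inverse (\<Prod>k\<in>UNIV. 1 + (\<xi> $ k)\<^sup>2)" for \<xi> :: "real ^ 'n"
  have w: "0 \<le> w \<xi>" "w \<xi> \<le> 1" for \<xi>
    using prod_one_plus_square_ge_1[of \<xi>] by (auto simp: w_def inverse_le_1_iff)
  have intw: "integrable lborel w" unfolding w_def[abs_def] by (rule integrable_prod_inverse_1_plus_square)
  define I where "I = (\<integral>\<xi>. w \<xi> \<partial>lborel)"
  have I0: "0 \<le> I" unfolding I_def by (rule Bochner_Integration.integral_nonneg) (rule w)
  have n1: "1 \<le> n" unfolding n using zero_less_card_finite[where 'a='n] by linarith
  have c0: "0 < c" using n1 by (simp add: c)
  obtain A where A: "A \<ge> 0" "\<And>\<xi>. sqrt (mi_energy N (\<lambda>\<beta>. fourier (m0 \<beta>) \<xi>)) \<le> A * w \<xi>"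
    unfolding w_def by (rule initial_energy_decay[where ?m0.0=m0 and N=N, OF test]) blast
  obtain s \<rho> where s: "s \<ge> 0" and \<rho>: "0 < \<rho>" "\<rho> \<le> 1"
    and window: "\<And>X. 0 \<le> X \<Longrightarrow> X \<le> \<rho> \<Longrightarrow> A\<^sup>2 * (exp (- s) + n\<^sup>2 * X\<^sup>2 + 2 * n * X * s) \<le> 1"
    by (rule low_frequency_window[of "A\<^sup>2" n]) (use n1 in auto)
  define c2 where "c2 = c * (\<rho>\<^sup>2 / (1 + \<rho>\<^sup>2)) / 2"
  have c2: "0 < c2" using c0 \<rho> by (simp add: c2_def add_pos_nonneg)
  obtain T\<^sub>1 where T1: "\<And>t. t \<ge> T\<^sub>1 \<Longrightarrow> sqrt 2 * A * I * exp (- c2 * (t - s)) \<le> (1 + t) powr (- (n / 2))"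
    using eventually_exp_le_powr[OF c2, of "sqrt 2 * A * I" s "n / 2"] unfolding eventually_at_top_linorder by blast
  \<comment> \<open>From time \<open>2 s + 1\<close> on, \<open>t - s\<close> is at least \<open>(1 + t) / 2\<close>.\<close>
  define T where "T = max T\<^sub>1 (2 * s + 1)"
  define C where "C = sqrt 2 * sqrt (U\<^sup>2 + 1) * sqrt (8 * pi / c) ^ CARD('n) + 1"
  have C1: "1 \<le> C" using c0 by (simp add: C_def)
  have "\<exists>R. \<forall>x. norm x > R \<longrightarrow> m0 \<beta> x = 0" for \<beta>
    by (rule test_function_support[OF test[of \<beta>]]) blast
  then obtain R where R: "\<And>\<beta> x. norm x > R \<beta> \<Longrightarrow> m0 \<beta> x = 0" by metis
  define R\<^sub>0 where "R\<^sub>0 = (\<Sum>\<beta>\<in>?S. \<bar>R \<beta>\<bar>)"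
  have R0: "m0 \<beta> x = 0" if "\<beta> \<in> ?S" "norm x > R\<^sub>0" for \<beta> x
  proof -
    have "\<bar>R \<beta>\<bar> \<le> R\<^sub>0" unfolding R\<^sub>0_def by (rule member_le_sum) (auto simp: that finite_mi_upto)
    then show ?thesis using that by (intro R) linarith
  qed
  show ?thesis
    unfolding C_def[symmetric]
  proof (intro exI conjI allI impI)
    show "0 < A * I * exp T + 1" using A I0 by (simp add: add_nonneg_pos)
    fix m and t :: real and x :: "real ^ 'n" assume sol: "truncated_solution N m0 m" and t: "t \<ge> 0"
    interpret supported_galerkin_solution N m0 m R\<^sub>0
      by unfold_locales (use sol R0 in auto)
    define En where "En t \<xi> = mi_energy N (\<lambda>\<beta>. fourier (m \<beta> t) \<xi>)" for t \<xi>
    define r where "r \<xi> = (norm \<xi>)\<^sup>2 / (1 + (norm \<xi>)\<^sup>2)" for \<xi> :: "real ^ 'n"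
    have decay: "En t \<xi> \<le> 2 * exp (- (r \<xi> * c) * (t - s)) * En s \<xi>" if "0 \<le> s" "s \<le> t" for s t \<xi>
    proof -
      interpret symbol_ode N \<xi> "\<lambda>\<beta> t. fourier (m \<beta> t) \<xi>" n
        unfolding n by (rule symbol_ode_fourier[OF N])
      show ?thesis
        using hypocoercive_decay[OF that] by (simp add: E_def rate_def En_def r_def c)
    qed
    have anti: "En t \<xi> \<le> En s \<xi>" if "0 \<le> s" "s \<le> t" for s t \<xi>
    proof -
      interpret symbol_ode N \<xi> "\<lambda>\<beta> t. fourier (m \<beta> t) \<xi>" n
        unfolding n by (rule symbol_ode_fourier[OF N])
      show ?thesis using E_antimono[OF that] by (simp add: E_def En_def)
    qed
    have m_0: "m \<beta> 0 = m0 \<beta>" if "\<beta> \<in> ?S" for \<beta>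
      using m_init[OF that] by (intro ext)
    have En0_eq: "En 0 \<xi> = mi_energy N (\<lambda>\<beta>. fourier (m0 \<beta>) \<xi>)" for \<xi>
      unfolding En_def mi_energy_def by (intro sum.cong refl) (simp add: m_0)
    have En0: "sqrt (En 0 \<xi>) \<le> A * w \<xi>" for \<xi>
      unfolding En0_eq by (rule A)
    have En_nonneg: "0 \<le> En t \<xi>" for t \<xi> by (simp add: En_def mi_energy_nonneg)
    have En0_le: "En 0 \<xi> \<le> A\<^sup>2" for \<xi>
    proof -
      have "A * w \<xi> \<le> A * 1" using w A(1) by (intro mult_left_mono)
      then have "sqrt (En 0 \<xi>) \<le> A" using En0[of \<xi>] by simp
      then have "(sqrt (En 0 \<xi>))\<^sup>2 \<le> A\<^sup>2" using En_nonneg by (intro power_mono) auto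
      then show ?thesis using En_nonneg by simp
    qed
    have low: "En s \<xi> \<le> U\<^sup>2 + 1" if "norm \<xi> \<le> \<rho>" for \<xi>
    proof -
      interpret symbol_ode N \<xi> "\<lambda>\<beta> t. fourier (m \<beta> t) \<xi>" n
        unfolding n by (rule symbol_ode_fourier[OF N])
      have "norm (fourier (m 0 0) \<xi>) \<le> U"
        unfolding m_0[OF zero_mem] U by (rule norm_fourier_le)
      then have "(norm (fourier (m 0 0) \<xi>))\<^sup>2 \<le> U\<^sup>2" by (intro power_mono) auto
      moreover have "En 0 \<xi> * (exp (- s) + n\<^sup>2 * (norm \<xi>)\<^sup>2 + 2 * n * norm \<xi> * s) \<le>
          A\<^sup>2 * (exp (- s) + n\<^sup>2 * (norm \<xi>)\<^sup>2 + 2 * n * norm \<xi> * s)"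
        using En0_le s n1 by (intro mult_right_mono) (auto intro!: add_nonneg_nonneg)
      moreover have "A\<^sup>2 * (exp (- s) + n\<^sup>2 * (norm \<xi>)\<^sup>2 + 2 * n * norm \<xi> * s) \<le> 1"
        by (rule window) (use that in auto)
      moreover have "En s \<xi> \<le> (norm (fourier (m 0 0) \<xi>))\<^sup>2 +
          En 0 \<xi> * (exp (- s) + n\<^sup>2 * (norm \<xi>)\<^sup>2 + 2 * n * norm \<xi> * s)"
        using low_frequency[OF s] by (simp add: E_def En_def)
      ultimately show ?thesis by linarith
    qed
    obtain b where b: "\<And>\<beta> x. \<beta> \<in> ?S \<Longrightarrow> x \<notin> cbox (- b) b \<Longrightarrow> m \<beta> t x = 0"
      by (rule common_box[of t]) (use t in blast)
    note sup = sqrt_mi_energy_le_integral_fourier[where f="\<lambda>\<beta>. m \<beta> t" and a="- b" and b=b and N=N and x=x,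
        OF cont_slice(1)[OF _ t] b, folded En_def]
    show "sqrt (mi_energy N (\<lambda>\<beta>. m \<beta> t x)) \<le> C * (1 + t) powr (- n / 2) + (A * I * exp T + 1) * exp (- t)"
    proof (cases "t \<le> T")
      case True
      have "sqrt (mi_energy N (\<lambda>\<beta>. m \<beta> t x)) \<le> (\<integral>\<xi>. A * w \<xi> \<partial>lborel)"
      proof (rule sup)
        show "integrable lborel (\<lambda>\<xi>. A * w \<xi>)" using intw by simp
        show "sqrt (En t \<xi>) \<le> A * w \<xi>" for \<xi>
          using real_sqrt_le_mono[OF anti[OF order_refl t]] En0 order_trans by blast
      qed
      also have "\<dots> = A * I" by (simp add: I_def)
      also have "\<dots> \<le> A * I * exp (T - t)"
        using mult_left_mono[of 1 "exp (T - t)" "A * I"] True A(1) I0 by simp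
      also have "\<dots> = A * I * exp T * exp (- t)" by (simp add: mult.assoc exp_add[symmetric])
      also have "\<dots> \<le> C * (1 + t) powr (- n / 2) + (A * I * exp T + 1) * exp (- t)"
        using C1 by (simp add: distrib_right add_nonneg_nonneg)
      finally show ?thesis .
    next
      case False
      then have tT: "t \<ge> T\<^sub>1" "t \<ge> 2 * s + 1" by (auto simp: T_def)
      then have ts: "s \<le> t" "0 < t - s" "(1 + t) / 2 \<le> t - s" using s by auto
      define a where "a = c / 4 * (t - s)"
      have a: "0 < a" using c0 ts by (simp add: a_def)
      define h where "h \<xi> = sqrt 2 * sqrt (U\<^sup>2 + 1) * exp (- a * (norm \<xi>)\<^sup>2) + sqrt 2 * A * exp (- c2 * (t - s)) * w \<xi>" for \<xi> :: "real ^ 'n"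
      have "sqrt (mi_energy N (\<lambda>\<beta>. m \<beta> t x)) \<le> (\<integral>\<xi>. h \<xi> \<partial>lborel)"
      proof (rule sup)
        show "integrable lborel h"
          unfolding h_def[abs_def] using has_bochner_integral_gaussian[OF a, where 'n='n] intw
          by (simp add: has_bochner_integral_iff)
        fix \<xi> :: "real ^ 'n"
        have r_mono: "y / (1 + y) \<le> z / (1 + z)" if "0 \<le> y" "y \<le> z" for y z :: real
          using that by (simp add: divide_simps) (simp add: algebra_simps)
        show "sqrt (En t \<xi>) \<le> h \<xi>"
        proof (cases "norm \<xi> \<le> \<rho>")
          case True
          have "(norm \<xi>)\<^sup>2 \<le> 1" using True \<rho> by (simp add: power_le_one)
          then have "(norm \<xi>)\<^sup>2 / 2 \<le> r \<xi>"
            unfolding r_def by (intro divide_left_mono) (auto simp: add_pos_nonneg)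
          then have "(norm \<xi>)\<^sup>2 / 2 * (c * (t - s)) \<le> r \<xi> * (c * (t - s))"
            using c0 ts by (intro mult_right_mono) auto
          moreover have "2 * (a * (norm \<xi>)\<^sup>2) = (norm \<xi>)\<^sup>2 / 2 * (c * (t - s))"
            "- (r \<xi> * c) * (t - s) = - (r \<xi> * (c * (t - s)))"
            by (simp_all add: a_def)
          ultimately have "exp (- (r \<xi> * c) * (t - s)) \<le> exp (- (2 * (a * (norm \<xi>)\<^sup>2)))"
            unfolding exp_le_cancel_iff by linarith
          then have "2 * exp (- (r \<xi> * c) * (t - s)) * En s \<xi> \<le> 2 * exp (- (2 * (a * (norm \<xi>)\<^sup>2))) * (U\<^sup>2 + 1)"
            using low[OF True] En_nonneg by (intro mult_mono) auto
          then have "En t \<xi> \<le> 2 * exp (- (2 * (a * (norm \<xi>)\<^sup>2))) * (U\<^sup>2 + 1)"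
            using decay[OF s ts(1), of \<xi>] by linarith
          from sqrt_le_exp_decay[OF this]
          have "sqrt (En t \<xi>) \<le> sqrt 2 * exp (- (a * (norm \<xi>)\<^sup>2)) * sqrt (U\<^sup>2 + 1)" by simp
          moreover have "0 \<le> sqrt 2 * A * exp (- c2 * (t - s)) * w \<xi>" using A w by simp
          ultimately show ?thesis by (simp add: h_def mult_ac)
        next
          case False
          then have "\<rho>\<^sup>2 \<le> (norm \<xi>)\<^sup>2" using \<rho> by (intro power_mono) auto
          then have "\<rho>\<^sup>2 / (1 + \<rho>\<^sup>2) \<le> r \<xi>" unfolding r_def by (intro r_mono) auto
          then have "\<rho>\<^sup>2 / (1 + \<rho>\<^sup>2) * (c * (t - s)) \<le> r \<xi> * (c * (t - s))"
            using c0 ts by (intro mult_right_mono) auto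
          moreover have "2 * (c * z / 2 * y) = z * (c * y)" for y z :: real by simp
          then have "2 * (c2 * (t - s)) = \<rho>\<^sup>2 / (1 + \<rho>\<^sup>2) * (c * (t - s))"
            by (simp only: c2_def)
          moreover have "- (r \<xi> * c) * (t - s) = - (r \<xi> * (c * (t - s)))" by simp
          ultimately have "exp (- (r \<xi> * c) * (t - s)) \<le> exp (- (2 * (c2 * (t - s))))"
            unfolding exp_le_cancel_iff by linarith
          then have "2 * exp (- (r \<xi> * c) * (t - s)) * En s \<xi> \<le> 2 * exp (- (2 * (c2 * (t - s)))) * En 0 \<xi>"
            using anti[OF order_refl s] En_nonneg by (intro mult_mono) auto
          then have "En t \<xi> \<le> 2 * exp (- (2 * (c2 * (t - s)))) * En 0 \<xi>"
            using decay[OF s ts(1), of \<xi>] by linarith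
          from sqrt_le_exp_decay[OF this En_nonneg]
          have "sqrt (En t \<xi>) \<le> sqrt 2 * exp (- (c2 * (t - s))) * sqrt (En 0 \<xi>)" .
          also have "\<dots> \<le> sqrt 2 * exp (- (c2 * (t - s))) * (A * w \<xi>)"
            by (intro mult_left_mono En0) auto
          finally show ?thesis by (simp add: h_def mult_ac add_increasing)
        qed
      qed
      also have "(\<integral>\<xi>. h \<xi> \<partial>lborel) = sqrt 2 * sqrt (U\<^sup>2 + 1) * sqrt (pi / a) ^ CARD('n) + sqrt 2 * A * I * exp (- c2 * (t - s))"
      proof -
        have "has_bochner_integral lborel w I" using intw by (simp add: has_bochner_integral_iff I_def)
        then have "has_bochner_integral lborel h (sqrt 2 * sqrt (U\<^sup>2 + 1) * sqrt (pi / a) ^ CARD('n) + sqrt 2 * A * exp (- c2 * (t - s)) * I)"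
          unfolding h_def[abs_def]
          by (intro has_bochner_integral_add has_bochner_integral_mult_right has_bochner_integral_gaussian a)
        then show ?thesis by (simp add: has_bochner_integral_iff mult_ac)
      qed
      also have "\<dots> \<le> sqrt 2 * sqrt (U\<^sup>2 + 1) * (sqrt (8 * pi / c) ^ CARD('n) * (1 + t) powr (- (n / 2))) + (1 + t) powr (- (n / 2))"
      proof (intro add_mono mult_left_mono T1 tT)
        have "c * (1 + t) / 8 \<le> a" using ts c0 by (simp add: a_def)
        then have "pi / a \<le> pi / (c * (1 + t) / 8)"
          using a c0 t by (intro divide_left_mono) auto
        also have "\<dots> = 8 * pi / c * (1 / (1 + t))" using c0 t by (simp add: field_simps)
        finally have "sqrt (pi / a) \<le> sqrt (8 * pi / c) * sqrt (1 / (1 + t))"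
          by (simp only: real_sqrt_mult[symmetric] real_sqrt_le_iff)
        then have "sqrt (pi / a) ^ CARD('n) \<le> (sqrt (8 * pi / c) * sqrt (1 / (1 + t))) ^ CARD('n)"
          using a by (intro power_mono) auto
        also have "\<dots> = sqrt (8 * pi / c) ^ CARD('n) * (1 + t) powr (- (n / 2))"
        proof -
          have "sqrt (1 / (1 + t)) = (1 + t) powr (- (1 / 2))"
            using t by (simp add: real_sqrt_divide powr_minus powr_half_sqrt inverse_eq_divide)
          then have "sqrt (1 / (1 + t)) ^ CARD('n) = (1 + t) powr (- (n / 2))"
            using t by (simp add: powr_realpow[symmetric] powr_powr n)
          then show ?thesis by (simp only: power_mult_distrib)
        qed
        finally show "sqrt (pi / a) ^ CARD('n) \<le> sqrt (8 * pi / c) ^ CARD('n) * (1 + t) powr (- (n / 2))" .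
      qed auto
      also have "\<dots> = C * (1 + t) powr (- n / 2)" by (simp add: C_def algebra_simps)
      also have "\<dots> \<le> C * (1 + t) powr (- n / 2) + (A * I * exp T + 1) * exp (- t)"
        using A I0 by (simp add: add_nonneg_nonneg)
      finally show ?thesis .
    qed
  qed
qed

theorem theorem8p7:
  assumes "CARD('n::finite) \<in> {1, 2, 3}"
  shows "\<exists>\<epsilon> :: nat \<Rightarrow> real. (\<forall>N. \<epsilon> N > 0) \<and>
    (\<forall>m0 :: nat ^ 'n \<Rightarrow> real ^ 'n \<Rightarrow> complex. (\<forall>\<beta>. test_function (m0 \<beta>)) \<longrightarrow>
      (\<exists>C>0. \<forall>N. strongly_stable (fp_poly N :: complex \<Rightarrow> real ^ 'n \<Rightarrow> complex) \<longrightarrow>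
        (\<exists>C\<^sub>N>0. \<forall>m. truncated_solution N m0 m \<longrightarrow>
          (\<forall>t\<ge>0. Linf_L2_norm (\<lambda>c. exp (- (norm c)\<^sup>2 / 2)) (galerkin N m t)
             \<le> ennreal (C * (1 + t) powr (- real CARD('n) / 2) + C\<^sub>N * exp (- \<epsilon> N * t))))))"
proof (intro exI[of _ "\<lambda>_. 1"] conjI allI impI)
  fix m0 :: "nat ^ 'n \<Rightarrow> real ^ 'n \<Rightarrow> complex" assume "\<forall>\<beta>. test_function (m0 \<beta>)"
  then have test: "\<And>\<beta>. test_function (m0 \<beta>)" by blast
  define c where "c = 1 / (5 * real CARD('n) ^ 4)"
  define U where "U = (\<integral>x. norm (m0 0 x) \<partial>lborel)"
  define C where "C = sqrt 2 * sqrt (U\<^sup>2 + 1) * sqrt (8 * pi / c) ^ CARD('n) + 1"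
  show "\<exists>C>0. \<forall>N. strongly_stable (fp_poly N :: complex \<Rightarrow> real ^ 'n \<Rightarrow> complex) \<longrightarrow>
        (\<exists>C\<^sub>N>0. \<forall>m. truncated_solution N m0 m \<longrightarrow>
          (\<forall>t\<ge>0. Linf_L2_norm (\<lambda>c. exp (- (norm c)\<^sup>2 / 2)) (galerkin N m t)
             \<le> ennreal (C * (1 + t) powr (- real CARD('n) / 2) + C\<^sub>N * exp (- 1 * t))))"
  proof (rule exI[of _ C], intro conjI allI impI)
    show "C > 0" by (simp add: C_def c_def add_nonneg_pos)
    fix N assume "strongly_stable (fp_poly N :: complex \<Rightarrow> real ^ 'n \<Rightarrow> complex)"
    then have N: "N \<ge> 1" using not_strongly_stable_0 by (cases N) auto
    obtain C\<^sub>N where CN: "C\<^sub>N > 0" "\<And>m t x. truncated_solution N m0 m \<Longrightarrow> t \<ge> 0 \<Longrightarrow>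
        sqrt (mi_energy N (\<lambda>\<beta>. m \<beta> t x)) \<le> C * (1 + t) powr (- real CARD('n) / 2) + C\<^sub>N * exp (- t)"
      using sqrt_energy_decay[where ?m0.0=m0, OF test N refl c_def U_def] unfolding C_def[symmetric] by blast
    show "\<exists>C\<^sub>N>0. \<forall>m. truncated_solution N m0 m \<longrightarrow>
          (\<forall>t\<ge>0. Linf_L2_norm (\<lambda>c. exp (- (norm c)\<^sup>2 / 2)) (galerkin N m t)
             \<le> ennreal (C * (1 + t) powr (- real CARD('n) / 2) + C\<^sub>N * exp (- 1 * t)))"
    proof (rule exI[of _ C\<^sub>N], intro conjI allI impI)
      fix m and t :: real assume sol: "truncated_solution N m0 m" and t: "t \<ge> 0"
      show "Linf_L2_norm (\<lambda>c. exp (- (norm c)\<^sup>2 / 2)) (galerkin N m t)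
             \<le> ennreal (C * (1 + t) powr (- real CARD('n) / 2) + C\<^sub>N * exp (- 1 * t))"
        unfolding Linf_L2_norm_def
      proof (rule SUP_least)
        fix x
        have "L2_weighted_norm (\<lambda>c. exp (- (norm c)\<^sup>2 / 2)) (galerkin N m t x) \<le> ennreal (sqrt (mi_energy N (\<lambda>\<beta>. m \<beta> t x)))"
          using L2_weighted_norm_galerkin[of N m t x] by (simp add: mi_energy_def power2_norm_eq_inner)
        also have "\<dots> \<le> ennreal (C * (1 + t) powr (- real CARD('n) / 2) + C\<^sub>N * exp (- 1 * t))"
          using CN(2)[OF sol t, of x] by (intro ennreal_leI) simp
        finally show "L2_weighted_norm (\<lambda>c. exp (- (norm c)\<^sup>2 / 2)) (galerkin N m t x)
            \<le> ennreal (C * (1 + t) powr (- real CARD('n) / 2) + C\<^sub>N * exp (- 1 * t))" .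
      qed
    qed (rule CN(1))
  qed
qed simp

end
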